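(* Let $d\in[1,+\infty]$ and suppose $(f_t)_{t\ge0}$ is a decreasing Loewner chain of order $d$. Denote $\Omega_t:=f_t(\mathbb{D})$ and $g_t:=f_t^{-1}:\Omega_t\to\mathbb{D}$ for all $t\ge0$, and $t(z):=\sup\{t\ge0:z\in\Omega_t\}$ for all $z\in\mathbb{D}$. Then there exist a Herglotz vector field $G$ of order $d$ and a null-set $N\subset[0,+\infty)$ such that the following three statements hold. (i) For every $t\in[0,+\infty)\setminus N$ the function $$z\mapsto\frac{\partial g_t(z)}{\partial t}:=\lim_{h\to0}\frac{g_{t+h}(z)-g_t(z)}{h}$$ is well defined and holomorphic in $\Omega_t$. Moreover, for every $z\in\mathbb{D}$ the function $[0,t(z))\ni t\mapsto w_z(t):=g_t(z)$ is the maximal (non-extendable) solution with values in $\mathbb{D}$ to the initial value problem $$\frac{dw}{dt}=-G(w,t),\quad t\ge0,\qquad w(0)=z.$$ Substituting $w_z(t)$ for $w(t)$ turns this equation into an equality that holds for all $t\in[0,t(z))\setminus N$. (ii) The function $F(z,t):=f_t(z)$, $t\ge0$, $z\in\mathbb{D}$, is a solution to the generalized Loewner–Kufarev PDE $$\frac{\partial F(z,t)}{\partial t}=\frac{\partial F(z,t)}{\partial z}\,G(z,t)\qquad( * )$$ with the initial condition $F(\cdot,0)=\mathrm{id}_{\mathbb{D}}$. Substituting $f_t(z)$ for $F(z,t)$ turns this equation into an equality that holds for all $t\in[0,+\infty)\setminus N$ and all $z\in\mathbb{D}$. (iii) Given any holomorphic function $F_0:\mathbb{D}\to\mathbb{C}$,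 the initial value problem $F(\cdot,0)=F_0$ for the PDE $( * )$ has a unique solution $(z,t)\mapsto F(z,t)\in\mathbb{C}$, which is defined for all $(z,t)\in\mathbb{D}\times[0,+\infty)$ and is given by the formula $F(\cdot,t)=F_0\circ f_t$, $t\in[0,+\infty)$. The Herglotz vector field $G$ for which at least one of these statements holds (with some null-set $N$, which may depend on $G$) is essentially unique, i.e. any two such Herglotz vector fields agree for all $t\in[0,+\infty)\setminus M$ and all $z\in\mathbb{D}$, where $M\subset[0,+\infty)$ is a null-set.
   Context: $\mathbb{D}=\{z\in\mathbb{C}:|z|<1\}$; $\mathrm{Hol}(\mathbb{D},\mathbb{D})$ is the set of holomorphic self-maps of $\mathbb{D}$. A null-set is a set of Lebesgue measure zero. Decreasing Loewner chain of order $d$: a family $(f_t)_{t\ge0}$ of holomorphic self-maps of $\mathbb{D}$ such that (DC1) each $f_t:\mathbb{D}\to\mathbb{D}$ is univalent; (DC2) $f_0=\mathrm{id}_{\mathbb{D}}$ and $f_t(\mathbb{D})\subset f_s(\mathbb{D})$ whenever $0\le s\le t$; (DC3) for any compact set $K\subset\mathbb{D}$ and all $T>0$ there exists a non-negative function $k_{K,T}\in L^d([0,T],\mathbb{R})$ such that $|f_s(z)-f_t(z)|\le\int_s^tk_{K,T}(\xi)\,d\xi$ for all $z\in K$ and all $0\le s\le t\le T$. Infinitesimal generator: a one-parametric semigroup in $\mathrm{Hol}(\mathbb{D},\mathbb{D})$ is a family $(\phi_t)_{t\ge0}$ of holomorphic self-maps of $\mathbb{D}$ with $\phi_0=\mathrm{id}_{\mathbb{D}}$,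 $\phi_t\circ\phi_s=\phi_{t+s}$ for all $s,t\ge0$, and $\phi_t(z)\to z$ as $t\to0^+$ for all $z\in\mathbb{D}$. Its infinitesimal generator is the holomorphic function $H:\mathbb{D}\to\mathbb{C}$ such that for each $z\in\mathbb{D}$ the function $t\mapsto\phi_t(z)$ solves $dw/dt=H(w)$, $w(0)=z$. Herglotz vector field of order $d$: a function $G:\mathbb{D}\times[0,+\infty)\to\mathbb{C}$ such that (1) for all $z\in\mathbb{D}$ the function $t\mapsto G(z,t)$ is measurable on $[0,+\infty)$; (2) for all $t\ge0$ the function $z\mapsto G(z,t)$ is holomorphic in $\mathbb{D}$; (3) for any compact set $K\subset\mathbb{D}$ and any $T>0$ there exists a non-negative function $k_{K,T}\in L^d([0,T],\mathbb{R})$ such that $|G(z,t)|\le k_{K,T}(t)$ for all $z\in K$ and a.e. $t\in[0,T]$; (4) for a.e. $t\ge0$ the function $G(\cdot,t)$ is the infinitesimal generator of a one-parametric semigroup in $\mathrm{Hol}(\mathbb{D},\mathbb{D})$. The ODE is understood in the sense of Carathéodory: solutions are locally absolutely continuous functions on an interval, with values in $\mathbb{D}$, satisfying the equation almost everywhere. A solution is maximal if it is not the restriction of another solution $[0,T)\to\mathbb{D}$, $T\in(0,+\infty]$, of the same initial value problem to a proper subset of $[0,T)$. Solution to the PDE $( * )$: a function $F:\mathbb{D}\times E\to\mathbb{C}$, where $E\subset[0,+\infty)$ is an interval, such that $F$ is continuous in $\mathbb{D}\times E$; $F(\cdot,t)$ is holomorphic in $\mathbb{D}$ for every $t\in E$;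 $F(z,\cdot)$ is locally absolutely continuous in $E$ for every $z\in\mathbb{D}$; and for every $z\in\mathbb{D}$ the equation holds for a.e. $t\in E$. *)

theory Defs
  imports "HOL-Analysis.Analysis"
begin

abbreviation unit_disc :: "complex set" where
  "unit_disc \<equiv> ball 0 1"

(* {0..<T} for a right endpoint T that may be infinite *)
definition half_line_upto :: "ereal \<Rightarrow> real set" where
  "half_line_upto T = {t. 0 \<le> t \<and> ereal t < T}"

definition Lebesgue_null :: "real set \<Rightarrow> bool" where
  "Lebesgue_null N \<longleftrightarrow> N \<subseteq> {0..} \<and> N \<in> null_sets lebesgue"

(* k \<in> L^d([0,T]) for 1 \<le> d \<le> \<infinity> *)
definition in_Ld :: "ennreal \<Rightarrow> real \<Rightarrow> (real \<Rightarrow> real) \<Rightarrow> bool" where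
  "in_Ld d T k \<longleftrightarrow>
     k \<in> borel_measurable (lebesgue_on {0..T}) \<and>
     (if d = \<infinity> then \<exists>C. AE x in lebesgue_on {0..T}. \<bar>k x\<bar> \<le> C
      else integrable (lebesgue_on {0..T}) (\<lambda>x. \<bar>k x\<bar> powr enn2real d))"

(* P is a finite family of intervals [u,v], encoded as pairs (u,v), with pairwise disjoint
   interiors. *)
definition abs_continuous_on_interval :: "real \<Rightarrow> real \<Rightarrow> (real \<Rightarrow> complex) \<Rightarrow> bool" where
  "abs_continuous_on_interval a b h \<longleftrightarrow>
     (\<forall>\<epsilon>>0. \<exists>\<delta>>0. \<forall>P :: (real \<times> real) set.
        finite P \<and> (\<forall>(u, v) \<in> P. a \<le> u \<and> u \<le> v \<and> v \<le> b) \<and>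
        disjoint_family_on (\<lambda>(u, v). {u<..<v}) P \<and>
        (\<Sum>(u, v)\<in>P. v - u) < \<delta>
        \<longrightarrow> (\<Sum>(u, v)\<in>P. norm (h v - h u)) < \<epsilon>)"

definition locally_abs_continuous_on :: "real set \<Rightarrow> (real \<Rightarrow> complex) \<Rightarrow> bool" where
  "locally_abs_continuous_on E h \<longleftrightarrow>
     (\<forall>a b. a \<le> b \<and> {a..b} \<subseteq> E \<longrightarrow> abs_continuous_on_interval a b h)"

definition decreasing_Loewner_chain :: "ennreal \<Rightarrow> (real \<Rightarrow> complex \<Rightarrow> complex) \<Rightarrow> bool" where
  "decreasing_Loewner_chain d f \<longleftrightarrow>
     (\<forall>t\<ge>0. f t holomorphic_on unit_disc \<and> f t ` unit_disc \<subseteq> unit_disc \<and> inj_on (f t) unit_disc) \<and>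
     (\<forall>z\<in>unit_disc. f 0 z = z) \<and>
     (\<forall>s t. 0 \<le> s \<and> s \<le> t \<longrightarrow> f t ` unit_disc \<subseteq> f s ` unit_disc) \<and>
     (\<forall>K T. compact K \<and> K \<subseteq> unit_disc \<and> T > 0 \<longrightarrow>
        (\<exists>k. (\<forall>\<xi>\<in>{0..T}. 0 \<le> k \<xi>) \<and> in_Ld d T k \<and>
             (\<forall>z\<in>K. \<forall>s t. 0 \<le> s \<and> s \<le> t \<and> t \<le> T \<longrightarrow>
                cmod (f s z - f t z) \<le> (\<integral>\<xi>. k \<xi> \<partial>(lebesgue_on {s..t})))))"

definition one_parameter_semigroup :: "(real \<Rightarrow> complex \<Rightarrow> complex) \<Rightarrow> bool" where
  "one_parameter_semigroup \<phi> \<longleftrightarrow>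
     (\<forall>t\<ge>0. \<phi> t holomorphic_on unit_disc \<and> \<phi> t ` unit_disc \<subseteq> unit_disc) \<and>
     (\<forall>z\<in>unit_disc. \<phi> 0 z = z) \<and>
     (\<forall>s\<ge>0. \<forall>t\<ge>0. \<forall>z\<in>unit_disc. \<phi> t (\<phi> s z) = \<phi> (t + s) z) \<and>
     (\<forall>z\<in>unit_disc. ((\<lambda>t. \<phi> t z) \<longlongrightarrow> z) (at_right 0))"

definition infinitesimal_generator :: "(complex \<Rightarrow> complex) \<Rightarrow> bool" where
  "infinitesimal_generator H \<longleftrightarrow>
     H holomorphic_on unit_disc \<and>
     (\<exists>\<phi>. one_parameter_semigroup \<phi> \<and>
        (\<forall>z\<in>unit_disc. \<forall>t\<ge>0.
           ((\<lambda>s. \<phi> s z) has_vector_derivative H (\<phi> t z)) (at t within {0..})))"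

definition Herglotz_vector_field :: "ennreal \<Rightarrow> (complex \<Rightarrow> real \<Rightarrow> complex) \<Rightarrow> bool" where
  "Herglotz_vector_field d G \<longleftrightarrow>
     (\<forall>z\<in>unit_disc. (\<lambda>t. G z t) \<in> borel_measurable (lebesgue_on {0..})) \<and>
     (\<forall>t\<ge>0. (\<lambda>z. G z t) holomorphic_on unit_disc) \<and>
     (\<forall>K T. compact K \<and> K \<subseteq> unit_disc \<and> T > 0 \<longrightarrow>
        (\<exists>k. (\<forall>t\<in>{0..T}. 0 \<le> k t) \<and> in_Ld d T k \<and>
             (\<forall>z\<in>K. AE t in lebesgue_on {0..T}. cmod (G z t) \<le> k t))) \<and>
     (AE t in lebesgue_on {0..}. infinitesimal_generator (\<lambda>z. G z t))"

(* Caratheodory solution, on the interval E and with values in the disc, of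
   dw/dt = v(w,t), w(0) = z. *)
definition ivp_solution ::
    "(complex \<Rightarrow> real \<Rightarrow> complex) \<Rightarrow> complex \<Rightarrow> real set \<Rightarrow> (real \<Rightarrow> complex) \<Rightarrow> bool" where
  "ivp_solution v z E w \<longleftrightarrow>
     is_interval E \<and> E \<subseteq> {0..} \<and> 0 \<in> E \<and>
     w ` E \<subseteq> unit_disc \<and> locally_abs_continuous_on E w \<and> w 0 = z \<and>
     (AE t in lebesgue_on E. (w has_vector_derivative v (w t) t) (at t within E))"

definition maximal_ivp_solution ::
    "(complex \<Rightarrow> real \<Rightarrow> complex) \<Rightarrow> complex \<Rightarrow> real set \<Rightarrow> (real \<Rightarrow> complex) \<Rightarrow> bool" where
  "maximal_ivp_solution v z E w \<longleftrightarrow>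
     ivp_solution v z E w \<and>
     \<not> (\<exists>T u. 0 < T \<and> ivp_solution v z (half_line_upto T) u \<and>
              E \<subset> half_line_upto T \<and> (\<forall>t\<in>E. u t = w t))"

(* Solution of the generalized Loewner-Kufarev equation dF/dt = dF/dz * G on unit_disc \<times> E. *)
definition Loewner_Kufarev_solution ::
    "(complex \<Rightarrow> real \<Rightarrow> complex) \<Rightarrow> real set \<Rightarrow> (complex \<Rightarrow> real \<Rightarrow> complex) \<Rightarrow> bool" where
  "Loewner_Kufarev_solution G E F \<longleftrightarrow>
     is_interval E \<and> E \<subseteq> {0..} \<and>
     continuous_on (unit_disc \<times> E) (\<lambda>(z, t). F z t) \<and>
     (\<forall>t\<in>E. (\<lambda>z. F z t) holomorphic_on unit_disc) \<and>
     (\<forall>z\<in>unit_disc. locally_abs_continuous_on E (\<lambda>t. F z t)) \<and>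
     (\<forall>z\<in>unit_disc. AE t in lebesgue_on E.
        ((\<lambda>s. F z s) has_vector_derivative deriv (\<lambda>x. F x t) z * G z t) (at t within E))"

definition chain_image :: "(real \<Rightarrow> complex \<Rightarrow> complex) \<Rightarrow> real \<Rightarrow> complex set" where
  "chain_image f t = f t ` unit_disc"

(* Meaningful only on chain_image f t. *)
definition chain_inverse :: "(real \<Rightarrow> complex \<Rightarrow> complex) \<Rightarrow> real \<Rightarrow> complex \<Rightarrow> complex" where
  "chain_inverse f t = inv_into unit_disc (f t)"

definition exit_time :: "(real \<Rightarrow> complex \<Rightarrow> complex) \<Rightarrow> complex \<Rightarrow> ereal" where
  "exit_time f z = Sup (ereal ` {t. 0 \<le> t \<and> z \<in> chain_image f t})"

(* In the first conjunct, the eventuality says that the difference quotient makes sense for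
   all small h, so that its limit does not involve values of chain_inverse f (t + h) outside
   chain_image f (t + h).  Since g_s is defined for s \<ge> 0 only, h ranges over {-t..}; this makes
   the limit one-sided only for t = 0.
   The last part of the second conjunct is the definite article in "the maximal solution". *)
definition inverse_ode_statement ::
    "(real \<Rightarrow> complex \<Rightarrow> complex) \<Rightarrow> (complex \<Rightarrow> real \<Rightarrow> complex) \<Rightarrow> real set \<Rightarrow> bool" where
  "inverse_ode_statement f G N \<longleftrightarrow>
     (\<forall>t\<in>{0..} - N. \<exists>g'. g' holomorphic_on chain_image f t \<and>
        (\<forall>z\<in>chain_image f t.
           (\<forall>\<^sub>F h in at 0 within {-t..}. z \<in> chain_image f (t + h)) \<and>
           ((\<lambda>h. (chain_inverse f (t + h) z - chain_inverse f t z) / complex_of_real h)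
              \<longlongrightarrow> g' z) (at 0 within {-t..}))) \<and>
     (\<forall>z\<in>unit_disc.
        maximal_ivp_solution (\<lambda>w t. - G w t) z
          (half_line_upto (exit_time f z)) (\<lambda>t. chain_inverse f t z) \<and>
        (\<forall>E w. maximal_ivp_solution (\<lambda>w t. - G w t) z E w \<longrightarrow>
           E = half_line_upto (exit_time f z) \<and> (\<forall>t\<in>E. w t = chain_inverse f t z))) \<and>
     (\<forall>z\<in>unit_disc. \<forall>t\<in>half_line_upto (exit_time f z) - N.
        ((\<lambda>s. chain_inverse f s z) has_vector_derivative - G (chain_inverse f t z) t)
          (at t within half_line_upto (exit_time f z)))"

definition chain_pde_statement ::
    "(real \<Rightarrow> complex \<Rightarrow> complex) \<Rightarrow> (complex \<Rightarrow> real \<Rightarrow> complex) \<Rightarrow> real set \<Rightarrow> bool" where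
  "chain_pde_statement f G N \<longleftrightarrow>
     Loewner_Kufarev_solution G {0..} (\<lambda>z t. f t z) \<and>
     (\<forall>z\<in>unit_disc. f 0 z = z) \<and>
     (\<forall>t\<in>{0..} - N. \<forall>z\<in>unit_disc.
        ((\<lambda>s. f s z) has_vector_derivative deriv (f t) z * G z t) (at t within {0..}))"

(* Uniqueness is among the solutions on all intervals E containing 0. *)
definition pde_ivp_statement ::
    "(real \<Rightarrow> complex \<Rightarrow> complex) \<Rightarrow> (complex \<Rightarrow> real \<Rightarrow> complex) \<Rightarrow> bool" where
  "pde_ivp_statement f G \<longleftrightarrow>
     (\<forall>F0. F0 holomorphic_on unit_disc \<longrightarrow>
        Loewner_Kufarev_solution G {0..} (\<lambda>z t. F0 (f t z)) \<and>
        (\<forall>z\<in>unit_disc. F0 (f 0 z) = F0 z) \<and>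
        (\<forall>E F. 0 \<in> E \<and> Loewner_Kufarev_solution G E F \<and> (\<forall>z\<in>unit_disc. F z 0 = F0 z) \<longrightarrow>
           (\<forall>t\<in>E. \<forall>z\<in>unit_disc. F z t = F0 (f t z))))"

end

theory Submission imports Defs "HOL-Complex_Analysis.Complex_Analysis" begin

text \<open>
Write \<open>\<Omega>\<^sub>t\<close> for the image of \<open>f\<^sub>t\<close> and \<open>g\<^sub>t\<close> for the inverse of \<open>f\<^sub>t\<close>. There is only one candidate for the vector field,
\<open>G(z,t) = (\<partial>f\<^sub>t(z)/\<partial>t) / f\<^sub>t'(z)\<close>, and everything rests on finding one null set of times outside of which the
time derivative exists for \<^emph>\<open>all\<close> points \<open>z\<close> simultaneously.

For a fixed point the condition \<open>|f\<^sub>s(z) - f\<^sub>t(z)| \<le> \<integral>\<^sub>s\<^sup>t k\<close> makes \<open>t \<mapsto> f\<^sub>t(z)\<close> absolutely continuous, hence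
differentiable almost everywhere (\<open>integral_dominated_vector_differentiable_ae\<close>; the density comes from the
Radon-Nikodym theorem and the differentiation of indefinite integrals from Henstock's lemma and Vitali
coverings). A countable dense set of points therefore shares a null set. As the same \<open>k\<close> serves a whole
compact set, the difference quotients in \<open>t\<close> form a locally bounded family of holomorphic functions, and Montel's
theorem carries convergence from the dense set to the disc, with a holomorphic limit
(\<open>dominated_holomorphic_family_differentiable_ae\<close>).

The divided difference \<open>(f\<^sub>t(a) - f\<^sub>t(b)) / (a - b)\<close>, continued by \<open>f\<^sub>t'(a)\<close> to the diagonal, is jointly continuous
in \<open>(t,a,b)\<close> and, by injectivity, has no zero. It is the chain rule in a finite form: it gives the derivative of
\<open>s \<mapsto> f\<^sub>s(u(s))\<close> along a curve, the derivative \<open>-G(g\<^sub>t(z),t)\<close> of \<open>g\<^sub>t(z)\<close>, the absolute continuity of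
\<open>t \<mapsto> g\<^sub>t(z)\<close>, and the lower bound for \<open>|f\<^sub>t'|\<close> that keeps the integrability class \<open>L\<^sup>d\<close> when passing from \<open>f\<close> to \<open>G\<close>.

Both uniqueness statements are conservation laws. Along a solution \<open>u\<close> of \<open>dw/dt = -G(w,t)\<close> the function
\<open>f\<^sub>t(u(t))\<close> is absolutely continuous with derivative zero almost everywhere, so it keeps its initial value \<open>z\<close>; this
forces \<open>u(t) = g\<^sub>t(z)\<close>, and it forbids a solution to live longer than \<open>z\<close> stays in \<open>\<Omega>\<^sub>t\<close>. In the same way a solution
\<open>F\<close> of the partial differential equation is constant along the curves \<open>t \<mapsto> g\<^sub>t(\<zeta>)\<close>, which are its characteristics, and
that gives \<open>F(\<cdot>,t) = F\<^sub>0 \<circ> f\<^sub>t\<close>.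

It remains that \<open>G(\<cdot>,t)\<close> generates a semigroup. It is the limit of \<open>(\<phi> - id)/h\<close> for the self-maps
\<open>\<phi> = g\<^sub>t \<circ> f\<^sub>t\<^sub>+\<^sub>h\<close> of the disc. The Schwarz lemma for these maps yields in the limit the inequality
\<open>Re (cnj z * H z) \<le> (1 - |z|\<^sup>2) * Re (cnj z * H 0)\<close> for \<open>H = G(\<cdot>,t)\<close>, which keeps the solutions of \<open>w' = H(w)\<close> inside
a compact part of the disc for bounded times; so they exist for all times and form the semigroup
(\<open>infinitesimal_generator_if_disc_inequality\<close>).

Essential uniqueness follows because each of the three statements determines \<open>G(z,t)\<close> from the time derivative of the chain or
of its inverse, for almost all \<open>t\<close> and for all \<open>z\<close> or at least for all \<open>z\<close> of a countable dense set.
\<close>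

section \<open>Indefinite integrals and differentiation almost everywhere\<close>

lemma integral_Icc_diff:
  fixes k :: "real \<Rightarrow> real"
  assumes "k integrable_on {a..b}" "a \<le> u" "u \<le> v" "v \<le> b"
  shows "integral {a..v} k - integral {a..u} k = integral {u..v} k"
proof -
  have "k integrable_on {a..v}"
    by (rule integrable_on_subinterval[OF assms(1)]) (use assms in auto)
  from Henstock_Kurzweil_Integration.integral_combine[OF assms(2,3) this] show ?thesis by simp
qed

text \<open>
Lebesgue's differentiation theorem in one variable. Let \<open>bad n\<close> be the set of points at which the mean value over
arbitrarily short intervals around the point misses \<open>k x\<close> by more than \<open>1 / (n + 1)\<close>. Henstock's lemma bounds the total error
over any fine partial division tagged in \<open>bad n\<close>, hence the total length of disjoint offending intervals; by Vitali's
covering theorem such intervals exhaust \<open>bad n\<close> up to a null set. The interval may straddle the point: this form is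
what sums over tagged divisions need, where a tag lies anywhere in its interval.
\<close>

lemma indefinite_integral_straddle_derivative_ae:
  fixes k :: "real \<Rightarrow> real"
  assumes k: "k integrable_on {a..b}"
  obtains N where "negligible N"
    "\<And>x e. x \<in> {a..b} - N \<Longrightarrow> 0 < e \<Longrightarrow> \<exists>d>0. \<forall>u v. a \<le> u \<and> u \<le> x \<and> x \<le> v \<and> v \<le> b \<and> v - u < d
        \<longrightarrow> \<bar>integral {u..v} k - (v - u) * k x\<bar> \<le> e * (v - u)"
proof -
  define bad where "bad n = {x\<in>{a..b}. \<forall>d>0. \<exists>u v. a \<le> u \<and> u \<le> x \<and> x \<le> v \<and> v \<le> b \<and> v - u < d
      \<and> (v - u) / Suc n < \<bar>integral {u..v} k - (v - u) * k x\<bar>}" for n :: nat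
  have "negligible (bad n)" for n
    unfolding negligible_outer_le
  proof (intro allI impI)
    fix e :: real assume e: "0 < e"
    obtain g where g: "gauge g"
      and gp: "\<And>p. \<lbrakk>p tagged_partial_division_of (cbox a b); g fine p\<rbrakk> \<Longrightarrow>
             sum (\<lambda>(x,K). norm (Henstock_Kurzweil_Integration.content K *\<^sub>R k x - integral K k)) p < e / Suc n"
    proof (rule Henstock_lemma[of k a b "e / Suc n"])
      show "k integrable_on cbox a b" "0 < e / Suc n" using k e by simp_all
    qed (rule that)
    (* the offending intervals, each stored with the bad point that it contains *)
    define I where "I = {(x,u,v). x \<in> bad n \<and> a \<le> u \<and> u \<le> x \<and> x \<le> v \<and> v \<le> b \<and> u < v \<and> {u..v} \<subseteq> g x
      \<and> (v - u) / Suc n < \<bar>integral {u..v} k - (v - u) * k x\<bar>}"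
    let ?c = "\<lambda>(x,u,v). (u+v)/2" and ?r = "\<lambda>(x,u,v). (v-u)/(2::real)"
    let ?B = "\<lambda>i::real\<times>real\<times>real. cball (?c i) (?r i)"
    have B: "?B (x,u,v) = {u..v}" for x u v :: real
      by (simp add: cball_eq_atLeastAtMost field_simps)
    have r: "0 < ?r i" if "i \<in> I" for i using that by (auto simp: I_def)
    have cov: "\<exists>i. i \<in> I \<and> x \<in> ?B i \<and> ?r i < d" if x: "x \<in> bad n" and d: "0 < d" for x d
    proof -
      obtain \<eta> where \<eta>: "\<eta> > 0" "ball x \<eta> \<subseteq> g x"
        using g by (meson gauge_def openE)
      have "min d \<eta> > 0" using d \<eta> by auto
      then obtain u v where uv: "a \<le> u" "u \<le> x" "x \<le> v" "v \<le> b" "v - u < min d \<eta>"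
         "(v - u) / Suc n < \<bar>integral {u..v} k - (v - u) * k x\<bar>"
        using x unfolding bad_def by blast
      have "u \<noteq> v" using uv(6) by auto
      then have "u < v" using uv by auto
      have "{u..v} \<subseteq> ball x \<eta>" using uv by (auto simp: dist_real_def)
      then have "(x,u,v) \<in> I" using uv x \<eta> \<open>u < v\<close> by (auto simp: I_def)
      moreover have "x \<in> ?B (x,u,v)" using uv B by simp
      ultimately show ?thesis using uv(5) d \<open>u<v\<close> by (intro exI[of _ "(x,u,v)"]) auto
    qed
    obtain C where C: "countable C" "C \<subseteq> I"
        "pairwise (\<lambda>i j. disjnt (?B i) (?B j)) C" "negligible (bad n - (\<Union>i\<in>C. ?B i))"
      using Vitali_covering_theorem_cballs[of I ?r "bad n" ?c] r cov by blast
    have fin: "measure lebesgue (\<Union>i\<in>C'. ?B i) \<le> e" if C': "C' \<subseteq> C" "finite C'" for C'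
    proof -
      define p where "p = (\<lambda>(x,u,v). (x,{u..v})) ` C'"
      have memI: "x \<in> bad n" "a \<le> u" "u \<le> x" "x \<le> v" "v \<le> b" "u < v" "{u..v} \<subseteq> g x"
         "(v - u) / Suc n < \<bar>integral {u..v} k - (v - u) * k x\<bar>" if "(x,u,v) \<in> C'" for x u v
        using that C' C(2) by (auto simp: I_def)
      have inj: "inj_on (\<lambda>(x,u,v). (x,{u..v})) C'"
        by (rule inj_onI) (auto dest!: memI(6) simp: Icc_eq_Icc)
      have "p tagged_partial_division_of (cbox a b)"
        unfolding tagged_partial_division_of_def
      proof (intro conjI allI impI)
        show "finite p" using C' by (simp add: p_def)
      next
        fix x K assume "(x,K) \<in> p"
        then obtain u v where uv: "(x,u,v) \<in> C'" "K = {u..v}" by (auto simp: p_def)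
        show "x \<in> K" "K \<subseteq> cbox a b" using memI[OF uv(1)] uv(2) by auto
        show "\<exists>a b. K = cbox a b" unfolding uv(2) by (intro exI[of _ u] exI[of _ v]) simp
      next
        fix x1 K1 x2 K2
        assume as: "(x1, K1) \<in> p \<and> (x2, K2) \<in> p \<and> (x1, K1) \<noteq> (x2, K2)"
        have "\<exists>u v. (x,u,v) \<in> C' \<and> K = {u..v}" if "(x,K) \<in> p" for x K
          using that by (auto simp: p_def)
        with as obtain u1 v1 u2 v2 where uv: "(x1,u1,v1) \<in> C'" "K1 = {u1..v1}" "(x2,u2,v2) \<in> C'" "K2 = {u2..v2}"
          by meson
        have "(x1,u1,v1) \<in> C" "(x2,u2,v2) \<in> C" "(x1,u1,v1) \<noteq> (x2,u2,v2)" using uv as C' by auto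
        then have "disjnt (?B (x1,u1,v1)) (?B (x2,u2,v2))" by (rule pairwiseD[OF C(3)])
        then have "disjnt K1 K2" unfolding B uv(2,4) .
        then show "interior K1 \<inter> interior K2 = {}"
          using interior_subset unfolding disjnt_def by blast
      qed
      moreover have "g fine p"
        unfolding fine_def p_def
      proof clarify
        fix x u v z assume "(x,u,v) \<in> C'" "z \<in> {u..v}"
        then show "z \<in> g x" using memI(7) by blast
      qed
      ultimately have "sum (\<lambda>(x,K). norm (Henstock_Kurzweil_Integration.content K *\<^sub>R k x - integral K k)) p < e / Suc n" by (rule gp)
      moreover have "sum (\<lambda>(x,K). norm (Henstock_Kurzweil_Integration.content K *\<^sub>R k x - integral K k)) p
          = (\<Sum>(x,u,v)\<in>C'. norm ((v-u) * k x - integral {u..v} k))"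
        unfolding p_def by (subst sum.reindex[OF inj]) (auto intro!: sum.cong dest!: memI(6))
      moreover have "(\<Sum>(x,u,v)\<in>C'. (v-u) / Suc n) \<le> (\<Sum>(x,u,v)\<in>C'. norm ((v-u) * k x - integral {u..v} k))"
        by (rule sum_mono) (auto dest!: memI(8) simp: abs_minus_commute simp del: of_nat_Suc)
      ultimately have "(\<Sum>(x,u,v)\<in>C'. (v-u) / Suc n) < e / Suc n" by simp
      also have "(\<Sum>(x,u,v)\<in>C'. (v-u) / Suc n) = (\<Sum>(x,u,v)\<in>C'. (v-u)) / Suc n"
        by (simp add: sum_divide_distrib case_prod_unfold)
      finally have le: "(\<Sum>(x,u,v)\<in>C'. (v-u)) < e" by (simp add: divide_strict_right_mono divide_less_cancel)
      have "measure lebesgue (\<Union>i\<in>C'. ?B i) \<le> (\<Sum>i\<in>C'. measure lebesgue (?B i))"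
        by (rule measure_UNION_le) (use C' in auto)
      also have "\<dots> = (\<Sum>(x,u,v)\<in>C'. (v-u))"
      proof (rule sum.cong[OF refl])
        fix i assume i: "i \<in> C'"
        obtain x u v where eq: "i = (x,u,v)" by (cases i)
        then have "u < v" using memI(6) i by blast
        then show "measure lebesgue (?B i) = (\<lambda>(x,u,v). v-u) i" unfolding eq B by simp
      qed
      finally show ?thesis using le by simp
    qed
    have m: "(\<Union>i\<in>C. ?B i) \<in> lmeasurable" "measure lebesgue (\<Union>i\<in>C. ?B i) \<le> e"
      by (rule fmeasurable_UN_bound measure_UN_bound; use C fin in auto)+
    let ?T = "(bad n - (\<Union>i\<in>C. ?B i)) \<union> (\<Union>i\<in>C. ?B i)"
    have "measure lebesgue ?T \<le> measure lebesgue (bad n - (\<Union>i\<in>C. ?B i)) + measure lebesgue (\<Union>i\<in>C. ?B i)"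
      by (rule measure_Un_le) (use C(4) m negligible_imp_measurable fmeasurableD in blast)+
    moreover have "measure lebesgue (bad n - (\<Union>i\<in>C. ?B i)) = 0"
      using C(4) negligible_imp_measure0 by blast
    moreover have "?T \<in> lmeasurable" using C(4) m negligible_imp_measurable by blast
    ultimately show "\<exists>T. bad n \<subseteq> T \<and> T \<in> lmeasurable \<and> measure lebesgue T \<le> e"
      using m(2) by (intro exI[of _ ?T]) auto
  qed
  then have neg: "negligible (\<Union>n. bad n)"
    using negligible_countable_Union[of "range bad"] by auto
  show ?thesis
  proof (rule that[OF neg])
    fix x e :: real assume x: "x \<in> {a..b} - (\<Union>n. bad n)" and e: "0 < e"
    obtain n where n: "inverse (Suc n) < e" using e reals_Archimedean by blast
    have "x \<in> {a..b}" "x \<notin> bad n" using x by auto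
    then have "\<exists>d>0. \<forall>u v. \<not> (a \<le> u \<and> u \<le> x \<and> x \<le> v \<and> v \<le> b \<and> v - u < d
      \<and> (v - u) / Suc n < \<bar>integral {u..v} k - (v - u) * k x\<bar>)"
      unfolding bad_def by blast
    then obtain d where d: "d > 0" "\<And>u v. a \<le> u \<Longrightarrow> u \<le> x \<Longrightarrow> x \<le> v \<Longrightarrow> v \<le> b \<Longrightarrow> v - u < d
      \<Longrightarrow> \<bar>integral {u..v} k - (v - u) * k x\<bar> \<le> (v - u) / Suc n"
      unfolding not_less[symmetric] by metis
    have "\<bar>integral {u..v} k - (v - u) * k x\<bar> \<le> e * (v - u)"
      if "a \<le> u" "u \<le> x" "x \<le> v" "v \<le> b" "v - u < d" for u v
    proof -
      have "(v - u) / Suc n \<le> e * (v - u)"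
        using n that mult_right_mono[of "inverse (Suc n)" e "v-u"] by (simp add: field_simps)
      then show ?thesis using d(2)[OF that] by linarith
    qed
    then show "\<exists>d>0. \<forall>u v. a \<le> u \<and> u \<le> x \<and> x \<le> v \<and> v \<le> b \<and> v - u < d
        \<longrightarrow> \<bar>integral {u..v} k - (v - u) * k x\<bar> \<le> e * (v - u)" using d(1) by blast
  qed
qed

lemma straddle_derivative_imp_DERIV:
  fixes H :: "real \<Rightarrow> real"
  assumes x: "x \<in> {a<..<b}"
    and st: "\<And>e. 0 < e \<Longrightarrow> \<exists>d>0. \<forall>u v. a \<le> u \<and> u \<le> x \<and> x \<le> v \<and> v \<le> b \<and> v - u < d
        \<longrightarrow> \<bar>(H v - H u) - (v - u) * D\<bar> \<le> e * (v - u)"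
  shows "(H has_real_derivative D) (at x)"
  unfolding DERIV_def
proof (rule LIM_I)
  fix r :: real assume "0 < r"
  then obtain d where d: "d > 0" "\<And>u v. a \<le> u \<Longrightarrow> u \<le> x \<Longrightarrow> x \<le> v \<Longrightarrow> v \<le> b \<Longrightarrow> v - u < d
        \<Longrightarrow> \<bar>(H v - H u) - (v - u) * D\<bar> \<le> r/2 * (v - u)"
    using st[of "r/2"] by auto
  show "\<exists>s>0. \<forall>h. h \<noteq> 0 \<and> norm (h - 0) < s \<longrightarrow> norm ((H (x + h) - H x) / h - D) < r"
  proof (intro exI[of _ "min d (min (b - x) (x - a))"] conjI allI impI)
    show "0 < min d (min (b - x) (x - a))" using d x by auto
    fix h :: real assume h: "h \<noteq> 0 \<and> norm (h - 0) < min d (min (b - x) (x - a))"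
    have "\<bar>(H (x + h) - H x) - h * D\<bar> \<le> r/2 * \<bar>h\<bar>"
    proof (cases "h > 0")
      case True
      then show ?thesis using d(2)[of x "x + h"] h x by (auto simp: abs_if)
    next
      case False
      then have "\<bar>(H x - H (x + h)) - (- h) * D\<bar> \<le> r/2 * (- h)"
        using d(2)[of "x + h" x] h x by (auto simp: abs_if)
      then show ?thesis using False h by (simp add: abs_if split: if_splits)
    qed
    moreover have "\<bar>(H (x + h) - H x) / h - D\<bar> = \<bar>(H (x + h) - H x) - h * D\<bar> / \<bar>h\<bar>"
      using h by (simp add: field_simps flip: abs_divide)
    ultimately have "\<bar>(H (x + h) - H x) / h - D\<bar> \<le> r / 2"
      using h by (simp add: pos_divide_le_eq)
    then show "norm ((H (x + h) - H x) / h - D) < r" using \<open>0 < r\<close> by simp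
  qed
qed

corollary indefinite_integral_DERIV_ae:
  fixes k :: "real \<Rightarrow> real"
  assumes k: "k integrable_on {a..b}"
  obtains N where "negligible N"
    "\<And>x H. x \<in> {a<..<b} - N \<Longrightarrow> (\<And>u v. a \<le> u \<Longrightarrow> u \<le> v \<Longrightarrow> v \<le> b \<Longrightarrow> H v - H u = integral {u..v} k)
       \<Longrightarrow> (H has_real_derivative k x) (at x)"
proof -
  obtain N where N: "negligible N"
    "\<And>x e. x \<in> {a..b} - N \<Longrightarrow> 0 < e \<Longrightarrow> \<exists>d>0. \<forall>u v. a \<le> u \<and> u \<le> x \<and> x \<le> v \<and> v \<le> b \<and> v - u < d
        \<longrightarrow> \<bar>integral {u..v} k - (v - u) * k x\<bar> \<le> e * (v - u)"
    using indefinite_integral_straddle_derivative_ae[OF k] by blast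
  show ?thesis
  proof (rule that[OF N(1)])
    fix x H assume x: "x \<in> {a<..<b} - N"
      and H: "\<And>u v. a \<le> u \<Longrightarrow> u \<le> v \<Longrightarrow> v \<le> b \<Longrightarrow> H v - H u = integral {u..v} k"
    show "(H has_real_derivative k x) (at x)"
    proof (rule straddle_derivative_imp_DERIV[where a=a and b=b])
      fix e :: real assume "0 < e"
      then obtain d where d: "d > 0" "\<forall>u v. a \<le> u \<and> u \<le> x \<and> x \<le> v \<and> v \<le> b \<and> v - u < d
        \<longrightarrow> \<bar>integral {u..v} k - (v - u) * k x\<bar> \<le> e * (v - u)"
        using N(2)[of x e] x by auto
      show "\<exists>d>0. \<forall>u v. a \<le> u \<and> u \<le> x \<and> x \<le> v \<and> v \<le> b \<and> v - u < d
        \<longrightarrow> \<bar>(H v - H u) - (v - u) * k x\<bar> \<le> e * (v - u)"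
      proof (rule exI[of _ d], intro conjI allI impI; (elim conjE)?)
        fix u v assume uv: "a \<le> u" "u \<le> x" "x \<le> v" "v \<le> b" "v - u < d"
        then have "H v - H u = integral {u..v} k" by (intro H) auto
        then show "\<bar>(H v - H u) - (v - u) * k x\<bar> \<le> e * (v - u)" using d(2) uv by simp
      qed (fact d(1))
    qed (use x in auto)
  qed
qed

text \<open>
The Stieltjes measures of \<open>F1\<close> and \<open>F2\<close> add up to the measure with density \<open>k\<close>, because they do so on half-open
intervals; a null set of the sum is a null set of each summand.
\<close>

lemma absolutely_continuous_interval_measure_if_dominated:
  fixes F1 F2 k :: "real \<Rightarrow> real"
  assumes k: "k integrable_on {a..b}" and nn: "\<And>x. x \<in> {a..b} \<Longrightarrow> 0 \<le> k x" and ab: "a \<le> b"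
    and mono: "mono F1" "mono F2" and cont: "continuous_on UNIV F1" "continuous_on UNIV F2"
    and sum: "\<And>x y. x \<le> y \<Longrightarrow> (F1 y - F1 x) + (F2 y - F2 x) = integral {max a (min b x)..max a (min b y)} k"
  shows "absolutely_continuous lborel (interval_measure F1)"
proof -
  let ?M1 = "interval_measure F1" and ?M2 = "interval_measure F2"
  define S where "S = measure_of UNIV (sets borel) (\<lambda>A. emeasure ?M1 A + emeasure ?M2 A)"
  have setsS: "sets S = sets borel"
    unfolding S_def by (subst sets_measure_of) (auto simp: sets.sigma_sets_eq[of borel, simplified])
  have emS: "emeasure S A = emeasure ?M1 A + emeasure ?M2 A" if A: "A \<in> sets borel" for A
  proof (rule emeasure_measure_of[OF S_def])
    show "A \<in> sets S" using A setsS by simp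
    show "positive (sets S) (\<lambda>A. emeasure ?M1 A + emeasure ?M2 A)" by (simp add: positive_def)
    show "countably_additive (sets S) (\<lambda>A. emeasure ?M1 A + emeasure ?M2 A)"
    proof (rule countably_additiveI)
      fix A :: "nat \<Rightarrow> real set" assume "range A \<subseteq> sets S" "disjoint_family A"
      then show "(\<Sum>i. emeasure ?M1 (A i) + emeasure ?M2 (A i)) = emeasure ?M1 (\<Union> (range A)) + emeasure ?M2 (\<Union> (range A))"
        by (simp add: suminf_add[symmetric] suminf_emeasure setsS)
    qed
  qed auto
  have ka: "k absolutely_integrable_on {a..b}" by (rule nonnegative_absolutely_integrable_1[OF k nn])
  have kset: "set_borel_measurable lebesgue {a..b} k"
    using ka unfolding set_integrable_def set_borel_measurable_def by auto
  define D where "D = density lebesgue (\<lambda>x. ennreal (indicator {a..b} x *\<^sub>R k x))"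
  have Dmeas[measurable]: "(\<lambda>x. ennreal (indicator {a..b} x *\<^sub>R k x)) \<in> borel_measurable lebesgue"
    using kset unfolding set_borel_measurable_def by (rule measurable_compose) simp
  define Q where "Q = distr D borel (\<lambda>x. x)"
  have idD: "(\<lambda>x. x) \<in> measurable D borel" unfolding D_def measurable_density_eq1 by (rule measurable_completion) simp
  have emQ: "emeasure Q A = (\<integral>\<^sup>+x. ennreal (indicator {a..b} x *\<^sub>R k x) * indicator A x \<partial>lebesgue)" if A: "A \<in> sets borel" for A
  proof -
    have "emeasure Q A = emeasure D A"
      unfolding Q_def using A by (subst emeasure_distr[OF idD]) (simp_all add: D_def)
    also have "\<dots> = (\<integral>\<^sup>+x. ennreal (indicator {a..b} x *\<^sub>R k x) * indicator A x \<partial>lebesgue)"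
      unfolding D_def by (rule emeasure_density[OF Dmeas]) (use A in \<open>simp add: sets_completionI_sets\<close>)
    finally show ?thesis .
  qed
  let ?c = "\<lambda>x. max a (min b x)"
  have Ioc: "emeasure ?M1 {x<..y} = ennreal (F1 y - F1 x)" "emeasure ?M2 {x<..y} = ennreal (F2 y - F2 x)" if "x \<le> y" for x y
    using that mono cont
    by (auto intro!: emeasure_interval_measure_Ioc simp: mono_def continuous_on_eq_continuous_within continuous_at_imp_continuous_at_within)
  have eq: "emeasure S {x<..y} = emeasure Q {x<..y}" if xy: "x \<le> y" for x y
  proof -
    have kk: "k absolutely_integrable_on {?c x..?c y}"
      using ka by (rule set_integrable_subset) (use ab xy in auto)
    then have kki: "integrable lebesgue (\<lambda>t. indicator {?c x..?c y} t *\<^sub>R k t)" unfolding set_integrable_def .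
    have ioc: "{x<..y} \<in> sets borel" by simp
    have "emeasure Q {x<..y} = (\<integral>\<^sup>+t. ennreal (indicator {?c x..?c y} t *\<^sub>R k t) \<partial>lebesgue)"
      unfolding emQ[OF ioc]
    proof (rule nn_integral_cong_AE)
      have "AE t in lebesgue. t \<notin> {?c x, ?c y}"
        by (rule AE_not_in) (auto simp: negligible_iff_null_sets[symmetric])
      then show "AE t in lebesgue. ennreal (indicator {a..b} t *\<^sub>R k t) * indicator {x<..y} t = ennreal (indicator {?c x..?c y} t *\<^sub>R k t)"
        by eventually_elim (use xy ab in \<open>auto simp: indicator_def max_def min_def split: if_splits\<close>)
    qed
    also have "\<dots> = ennreal (\<integral>t. indicator {?c x..?c y} t *\<^sub>R k t \<partial>lebesgue)"
    proof (rule nn_integral_eq_integral[OF kki])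
      have "0 \<le> indicator {?c x..?c y} t *\<^sub>R k t" for t
        using nn[of t] ab xy by (auto simp: indicator_def max_def min_def split: if_splits)
      then show "AE t in lebesgue. 0 \<le> indicator {?c x..?c y} t *\<^sub>R k t" by (intro AE_I2)
    qed
    also have "(\<integral>t. indicator {?c x..?c y} t *\<^sub>R k t \<partial>lebesgue) = integral {?c x..?c y} k"
      using set_lebesgue_integral_eq_integral(2)[OF kk] by (simp add: set_lebesgue_integral_def)
    also have "\<dots> = (F1 y - F1 x) + (F2 y - F2 x)" using sum[OF xy] by simp
    also have "ennreal \<dots> = emeasure S {x<..y}"
      using Ioc[OF xy] emS[of "{x<..y}"] mono xy by (simp add: ennreal_plus[symmetric] mono_def del: ennreal_plus)
    finally show ?thesis by simp
  qed
  have SB: "sets (borel :: real measure) = sigma_sets UNIV (range (\<lambda>(x,y). {x<..y::real}))"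
    by (subst borel_sigma_sets_Ioc, rule sets_measure_of) simp
  have "S = Q"
  proof (rule measure_eqI_generator_eq[where \<Omega>=UNIV and E="range (\<lambda>(x,y). {x<..y::real})" and A="\<lambda>n. {-real n<..real n}"])
    show "Int_stable (range (\<lambda>(x,y). {x<..y::real}))"
    proof (rule Int_stableI, clarify)
      fix x y x' y' :: real
      have "{x<..y} \<inter> {x'<..y'} = (\<lambda>(x,y). {x<..y}) (max x x', min y y')" by auto
      then show "{x<..y} \<inter> {x'<..y'} \<in> range (\<lambda>(x,y). {x<..y})" by blast
    qed
    fix X assume "X \<in> range (\<lambda>(x,y). {x<..y::real})"
    then obtain x y where "X = {x<..y}" by auto
    then show "emeasure S X = emeasure Q X" using eq by (cases "x \<le> y") auto
  next
    show "sets S = sigma_sets UNIV (range (\<lambda>(x,y). {x<..y::real}))"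
      using SB by (simp add: setsS)
    show "sets Q = sigma_sets UNIV (range (\<lambda>(x,y). {x<..y::real}))"
      using SB by (simp add: Q_def)
    show "(\<Union>n. {-real n<..real n}) = UNIV"
    proof (intro set_eqI iffI UNIV_I)
      fix x :: real
      obtain n where "\<bar>x\<bar> < real n" using reals_Archimedean2 by blast
      then show "x \<in> (\<Union>n. {-real n<..real n})" by (auto intro!: exI[of _ n])
    qed
    show "emeasure S {- real n<..real n} \<noteq> \<infinity>" for n
      using Ioc[of "- real n" "real n"] emS[of "{- real n<..real n}"] by simp
  qed auto
  show ?thesis
    unfolding absolutely_continuous_def
  proof
    fix A assume A: "A \<in> null_sets (lborel :: real measure)"
    then have Ab: "A \<in> sets borel" and "A \<in> null_sets lebesgue" by (auto simp: null_sets_completionI)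
    then have "emeasure Q A = 0"
      unfolding emQ[OF Ab] by (intro nn_integral_null_set)
    then have "emeasure ?M1 A = 0" using emS[OF Ab] \<open>S = Q\<close> by simp
    then show "A \<in> null_sets ?M1" using Ab by auto
  qed
qed

text \<open>
With \<open>K\<close> the indefinite integral of \<open>k\<close>, both \<open>K + h\<close> and \<open>K - h\<close> increase. The Stieltjes measure of the first is absolutely
continuous, so it has a density by the Radon-Nikodym theorem, and \<open>h\<close> becomes a difference of two indefinite integrals.
\<close>

lemma integral_dominated_differentiable_ae:
  fixes h k :: "real \<Rightarrow> real"
  assumes k: "k integrable_on {a..b}" and nn: "\<And>x. x \<in> {a..b} \<Longrightarrow> 0 \<le> k x"
    and dom: "\<And>u v. a \<le> u \<Longrightarrow> u \<le> v \<Longrightarrow> v \<le> b \<Longrightarrow> \<bar>h v - h u\<bar> \<le> integral {u..v} k"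
  obtains N where "negligible N" "\<And>x. x \<in> {a<..<b} - N \<Longrightarrow> \<exists>D. (h has_real_derivative D) (at x)"
proof (cases "a < b")
  case False
  then show ?thesis by (intro that[of "{}"]) auto
next
  case True
  (* all functions are extended to the line by constants; h equals 2 F1 - K on the interval *)
  define c where "c x = max a (min b x)" for x
  define K where "K x = integral {a..c x} k" for x
  define F1 where "F1 x = (K x + h (c x)) / 2" for x
  define F2 where "F2 x = (K x - h (c x)) / 2" for x
  have c: "a \<le> c x" "c x \<le> b" "x \<le> y \<Longrightarrow> c x \<le> c y" "x \<in> {a..b} \<Longrightarrow> c x = x" for x y using True by (auto simp: c_def)
  have Kd: "K y - K x = integral {c x..c y} k" if "x \<le> y" for x y
    unfolding K_def by (rule integral_Icc_diff[OF k c(1) c(3)[OF that] c(2)])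
  have hd: "\<bar>h (c y) - h (c x)\<bar> \<le> K y - K x" if "x \<le> y" for x y
    using dom[of "c x" "c y"] c that Kd by auto
  have "F1 x \<le> F1 y \<and> F2 x \<le> F2 y" if "x \<le> y" for x y
  proof -
    have "h (c y) - h (c x) \<le> K y - K x" "h (c x) - h (c y) \<le> K y - K x" using hd[OF that] by auto
    then show ?thesis unfolding F1_def F2_def by simp
  qed
  then have mono: "mono F1" "mono F2" unfolding mono_def by auto
  have Kc: "continuous_on UNIV K"
    unfolding K_def
    by (rule continuous_on_compose2[OF indefinite_integral_continuous_1[OF k]])
       (use c in \<open>auto simp: c_def intro!: continuous_intros\<close>)
  have hc: "continuous_on UNIV (\<lambda>x. h (c x))"
    unfolding continuous_on_def
  proof
    fix x
    have "((\<lambda>y. \<bar>K y - K x\<bar>) \<longlongrightarrow> \<bar>K x - K x\<bar>) (at x)"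
      using Kc by (intro tendsto_intros) (auto simp: continuous_on_def)
    then have lim: "((\<lambda>y. \<bar>K y - K x\<bar>) \<longlongrightarrow> 0) (at x)" by simp
    have "((\<lambda>y. h (c y) - h (c x)) \<longlongrightarrow> 0) (at x)"
    proof (rule Lim_null_comparison[OF _ lim])
      have "\<bar>h (c y) - h (c x)\<bar> \<le> \<bar>K y - K x\<bar>" for y
        using hd[of x y] hd[of y x] by (cases "x \<le> y") auto
      then show "\<forall>\<^sub>F y in at x. norm (h (c y) - h (c x)) \<le> \<bar>K y - K x\<bar>" by simp
    qed
    then show "((\<lambda>x. h (c x)) \<longlongrightarrow> h (c x)) (at x within UNIV)" by (simp add: LIM_zero_iff)
  qed
  have cont: "continuous_on UNIV F1" "continuous_on UNIV F2"
    unfolding F1_def F2_def using Kc hc by (auto intro!: continuous_intros)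
  have ac: "absolutely_continuous lborel (interval_measure F1)"
  proof (rule absolutely_continuous_interval_measure_if_dominated[OF k nn _ mono cont])
    fix x y :: real assume "x \<le> y"
    have "F1 y - F1 x + (F2 y - F2 x) = K y - K x" by (simp add: F1_def F2_def field_simps)
    then show "F1 y - F1 x + (F2 y - F2 x) = integral {max a (min b x)..max a (min b y)} k"
      using Kd[OF \<open>x \<le> y\<close>] by (simp add: c_def)
  qed (use True in auto)
  obtain \<phi> where \<phi>[measurable]: "\<phi> \<in> borel_measurable lborel" and \<phi>d: "density lborel \<phi> = interval_measure F1"
    using sigma_finite_measure.Radon_Nikodym[OF sigma_finite_lborel ac] by auto
  have Ioc: "(\<integral>\<^sup>+t. \<phi> t * indicator {x<..y} t \<partial>lborel) = ennreal (F1 y - F1 x)" if "x \<le> y" for x y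
  proof -
    have "emeasure (interval_measure F1) {x<..y} = ennreal (F1 y - F1 x)"
      using that mono cont
      by (auto intro!: emeasure_interval_measure_Ioc simp: mono_def continuous_on_eq_continuous_within continuous_at_imp_continuous_at_within)
    then show ?thesis unfolding \<phi>d[symmetric] by (subst (asm) emeasure_density) auto
  qed
  define \<psi> where "\<psi> t = enn2real (\<phi> t)" for t
  have \<psi>m[measurable]: "\<psi> \<in> borel_measurable borel" unfolding \<psi>_def using \<phi> by simp
  have hi: "(\<psi> has_integral (F1 v - F1 u)) {u..v}" if uv: "u \<le> v" for u v
  proof -
    have "AE t in lborel. \<phi> t * indicator {u<..v} t \<noteq> \<infinity>"
      by (rule nn_integral_PInf_AE) (use Ioc[OF uv] in auto)
    then have "AE t in lborel. ennreal (\<psi> t * indicator {u<..v} t) = \<phi> t * indicator {u<..v} t"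
      by eventually_elim (auto simp: \<psi>_def indicator_def less_top)
    then have "(\<integral>\<^sup>+t. ennreal (\<psi> t * indicator {u<..v} t) \<partial>lborel) = (\<integral>\<^sup>+t. \<phi> t * indicator {u<..v} t \<partial>lborel)"
      by (rule nn_integral_cong_AE)
    also have "\<dots> = ennreal (F1 v - F1 u)" by (rule Ioc[OF uv])
    finally have "(\<integral>\<^sup>+t. ennreal (\<psi> t * indicator {u<..v} t) \<partial>lborel) = ennreal (F1 v - F1 u)" .
    then have "((\<lambda>t. \<psi> t * indicator {u<..v} t) has_integral (F1 v - F1 u)) UNIV"
      by (intro nn_integral_has_integral) (use mono uv in \<open>auto simp: \<psi>_def mono_def\<close>)
    then have "((\<lambda>t. if t \<in> {u<..v} then \<psi> t else 0) has_integral (F1 v - F1 u)) UNIV"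
      by (rule has_integral_eq[rotated]) (auto simp: indicator_def)
    then have "(\<psi> has_integral (F1 v - F1 u)) {u<..v}" by (simp only: has_integral_restrict_UNIV)
    moreover have "(\<psi> has_integral (F1 v - F1 u)) {u<..v} \<longleftrightarrow> (\<psi> has_integral (F1 v - F1 u)) {u..v}"
      by (rule has_integral_spike_set_eq; rule negligible_subset[of "{u}"]) auto
    ultimately show ?thesis by simp
  qed
  obtain N1 where N1: "negligible N1" "\<And>x H. x \<in> {a<..<b} - N1 \<Longrightarrow> (\<And>u v. a \<le> u \<Longrightarrow> u \<le> v \<Longrightarrow> v \<le> b \<Longrightarrow> H v - H u = integral {u..v} \<psi>)
       \<Longrightarrow> (H has_real_derivative \<psi> x) (at x)"
    using indefinite_integral_DERIV_ae[of \<psi> a b] hi[of a b] True by auto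
  obtain N2 where N2: "negligible N2" "\<And>x H. x \<in> {a<..<b} - N2 \<Longrightarrow> (\<And>u v. a \<le> u \<Longrightarrow> u \<le> v \<Longrightarrow> v \<le> b \<Longrightarrow> H v - H u = integral {u..v} k)
       \<Longrightarrow> (H has_real_derivative k x) (at x)"
    using indefinite_integral_DERIV_ae[OF k] by blast
  show ?thesis
  proof (rule that[of "N1 \<union> N2"])
    show "negligible (N1 \<union> N2)" using N1 N2 by simp
    fix x assume x: "x \<in> {a<..<b} - (N1 \<union> N2)"
    have "(F1 has_real_derivative \<psi> x) (at x)"
    proof (rule N1(2))
      show "F1 v - F1 u = integral {u..v} \<psi>" if "u \<le> v" for u v
        using integral_unique[OF hi[OF that]] by simp
    qed (use x in simp)
    moreover have "(K has_real_derivative k x) (at x)"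
    proof (rule N2(2))
      show "K v - K u = integral {u..v} k" if "a \<le> u" "u \<le> v" "v \<le> b" for u v
        using Kd[OF that(2)] c(4)[of u] c(4)[of v] that by simp
    qed (use x in simp)
    ultimately have "((\<lambda>t. 2 * F1 t - K t) has_real_derivative 2 * \<psi> x - k x) (at x)"
      by (auto intro!: derivative_eq_intros)
    then have "(h has_real_derivative 2 * \<psi> x - k x) (at x)"
    proof (rule has_field_derivative_transform_within_open[where S="{a<..<b}"])
      show "2 * F1 t - K t = h t" if "t \<in> {a<..<b}" for t using that c(4)[of t] unfolding F1_def by (simp add: add_divide_distrib)
    qed (use x in auto)
    then show "\<exists>D. (h has_real_derivative D) (at x)" by blast
  qed
qed

corollary integral_dominated_vector_differentiable_ae:
  fixes h :: "real \<Rightarrow> complex" and k :: "real \<Rightarrow> real"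
  assumes k: "k integrable_on {a..b}" and nn: "\<And>x. x \<in> {a..b} \<Longrightarrow> 0 \<le> k x"
    and dom: "\<And>u v. a \<le> u \<Longrightarrow> u \<le> v \<Longrightarrow> v \<le> b \<Longrightarrow> norm (h v - h u) \<le> integral {u..v} k"
  obtains N where "negligible N" "\<And>x. x \<in> {a<..<b} - N \<Longrightarrow> \<exists>D. (h has_vector_derivative D) (at x)"
proof -
  have dom2: "\<bar>Re (h v) - Re (h u)\<bar> \<le> integral {u..v} k" "\<bar>Im (h v) - Im (h u)\<bar> \<le> integral {u..v} k"
    if "a \<le> u" "u \<le> v" "v \<le> b" for u v
    using abs_Re_le_cmod[of "h v - h u"] abs_Im_le_cmod[of "h v - h u"] dom[OF that] by auto
  obtain N1 where N1: "negligible N1" "\<And>x. x \<in> {a<..<b} - N1 \<Longrightarrow> \<exists>D. ((\<lambda>t. Re (h t)) has_real_derivative D) (at x)"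
    using integral_dominated_differentiable_ae[OF k nn dom2(1)] by blast
  obtain N2 where N2: "negligible N2" "\<And>x. x \<in> {a<..<b} - N2 \<Longrightarrow> \<exists>D. ((\<lambda>t. Im (h t)) has_real_derivative D) (at x)"
    using integral_dominated_differentiable_ae[OF k nn dom2(2)] by blast
  show ?thesis
  proof (rule that[of "N1 \<union> N2"])
    show "negligible (N1 \<union> N2)" using N1 N2 by simp
    fix x assume "x \<in> {a<..<b} - (N1 \<union> N2)"
    then obtain D E where "((\<lambda>t. Re (h t)) has_real_derivative D) (at x)" "((\<lambda>t. Im (h t)) has_real_derivative E) (at x)"
      using N1(2)[of x] N2(2)[of x] by blast
    then have "((\<lambda>t. Complex (Re (h t)) (Im (h t))) has_vector_derivative Complex D E) (at x)"
      unfolding has_vector_derivative_complex_iff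
      by (simp add: has_real_derivative_iff_has_vector_derivative)
    then show "\<exists>D. (h has_vector_derivative D) (at x)" by auto
  qed
qed

section \<open>Absolutely continuous functions\<close>

text \<open>
A fundamental theorem of calculus for absolutely continuous functions, in the form of an inequality between increments.
Take a tagged division fine for a gauge that obeys the local bound at tags outside \<open>N\<close> and confines the intervals tagged
in \<open>N\<close> to an open set of small measure. The first kind adds up to at most the increment of \<open>\<kappa>\<close> plus an error; the second
kind contributes little by absolute continuity.
\<close>

lemma abs_continuous_increment_le:
  fixes h :: "real \<Rightarrow> complex" and \<kappa> :: "real \<Rightarrow> real"
  assumes ac: "abs_continuous_on_interval a b h" and ab: "a \<le> b" and N: "negligible N"
    and loc: "\<And>t e. t \<in> {a..b} - N \<Longrightarrow> 0 < e \<Longrightarrow>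
      \<exists>d>0. \<forall>u v. a \<le> u \<and> u \<le> t \<and> t \<le> v \<and> v \<le> b \<and> v - u < d \<longrightarrow> norm (h v - h u) \<le> \<kappa> v - \<kappa> u + e * (v - u)"
    and mono: "\<And>u v. a \<le> u \<Longrightarrow> u \<le> v \<Longrightarrow> v \<le> b \<Longrightarrow> \<kappa> u \<le> \<kappa> v"
  shows "norm (h b - h a) \<le> \<kappa> b - \<kappa> a"
proof (rule field_le_epsilon)
  fix e :: real assume e: "0 < e"
  define e1 where "e1 = e / 2 / (b - a + 1)"
  have e1: "0 < e1" "e1 * (b - a) \<le> e/2"
  proof -
    show "0 < e1" using e ab by (simp add: e1_def)
    have "(b - a) / (b - a + 1) \<le> 1" using ab by simp
    then have "e/2 * ((b - a) / (b - a + 1)) \<le> e/2 * 1" using e by (intro mult_left_mono) auto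
    then show "e1 * (b - a) \<le> e/2" by (simp add: e1_def)
  qed
  obtain \<delta> where \<delta>: "\<delta> > 0" "\<And>P :: (real \<times> real) set.
        finite P \<Longrightarrow> (\<forall>(u, v) \<in> P. a \<le> u \<and> u \<le> v \<and> v \<le> b) \<Longrightarrow>
        disjoint_family_on (\<lambda>(u, v). {u<..<v}) P \<Longrightarrow>
        (\<Sum>(u, v)\<in>P. v - u) < \<delta> \<Longrightarrow> (\<Sum>(u, v)\<in>P. norm (h v - h u)) < e/2"
  proof -
    have "e/2 > 0" using e by simp
    from ac[unfolded abs_continuous_on_interval_def, rule_format, OF this]
    show ?thesis by (elim exE conjE) (rule that, assumption, blast)
  qed
  have Nl: "N \<in> sets lebesgue" "N \<in> lmeasurable" using N negligible_imp_measurable by (auto simp: negligible_imp_sets)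
  obtain U where U: "open U" "N \<subseteq> U" "U - N \<in> lmeasurable" "emeasure lebesgue (U - N) < ennreal \<delta>"
    using sets_lebesgue_outer_open[OF Nl(1) \<delta>(1)] by blast
  have "U = (U - N) \<union> N" using U by auto
  then have Um: "U \<in> lmeasurable" using U(3) Nl(2) by (metis fmeasurable.Un)
  have "measure lebesgue (U - N) < \<delta>"
    using U(3,4) by (metis \<delta>(1) emeasure_eq_measure2 ennreal_less_iff measure_nonneg)
  moreover have "measure lebesgue U \<le> measure lebesgue (U - N) + measure lebesgue N"
    by (metis U(3) \<open>U = U - N \<union> N\<close> Nl(1) fmeasurableD measure_Un_le)
  ultimately have U\<delta>: "measure lebesgue U < \<delta>" using N negligible_imp_measure0 by force
  have "\<forall>t. \<exists>d>0. t \<in> {a..b} - N \<longrightarrow> (\<forall>u v. a \<le> u \<and> u \<le> t \<and> t \<le> v \<and> v \<le> b \<and> v - u < d \<longrightarrow> norm (h v - h u) \<le> \<kappa> v - \<kappa> u + e1 * (v - u))"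
    using loc[OF _ e1(1)] by (metis zero_less_one)
  then obtain d where d: "\<And>t. d t > 0" and dh: "\<And>t u v. t \<in> {a..b} - N \<Longrightarrow> a \<le> u \<Longrightarrow> u \<le> t \<Longrightarrow> t \<le> v \<Longrightarrow> v \<le> b
      \<Longrightarrow> v - u < d t \<Longrightarrow> norm (h v - h u) \<le> \<kappa> v - \<kappa> u + e1 * (v - u)"
    by metis
  (* intervals tagged in N must lie inside U; all others must be short enough for the local bound *)
  define g where "g t = (if t \<in> N then U else ball t (d t / 2))" for t
  have "gauge g" unfolding gauge_def g_def using U d by auto
  then obtain p where p: "p tagged_division_of {a..b}" "g fine p"
    using fine_division_exists_real by blast
  have K: "K = {Inf K..Sup K} \<and> x \<in> K \<and> a \<le> Inf K \<and> Inf K \<le> x \<and> x \<le> Sup K \<and> Sup K \<le> b \<and> K \<subseteq> g x" if xK: "(x,K) \<in> p" for x K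
  proof -
    obtain u v where uv: "K = {u..v}" using tagged_division_ofD(4)[OF p(1) xK] by (auto simp: cbox_interval)
    have x: "x \<in> K" "K \<subseteq> {a..b}" using tagged_division_ofD(2,3)[OF p(1) that] by auto
    have "K \<subseteq> g x" using p(2) that by (auto simp: fine_def)
    moreover have "Inf K = u" "Sup K = v" using x uv by auto
    ultimately show ?thesis using x uv by auto
  qed
  have finp: "finite p" using p by blast
  let ?D = "\<lambda>(x::real,K). norm (h (Sup K) - h (Inf K))"
  (* degenerate intervals contribute nothing and would spoil injectivity of the map to endpoints *)
  define q where "q = {(x,K)\<in>p. x \<in> N \<and> interior K \<noteq> {}}"
  have "norm (h b - h a) = norm (\<Sum>(x,K)\<in>p. h (Sup K) - h (Inf K))"
    using additive_tagged_division_1[OF ab p(1), of h] by simp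
  also have "\<dots> \<le> sum ?D p" by (rule order_trans[OF norm_sum]) (simp add: case_prod_unfold)
  also have "\<dots> = sum ?D q + sum ?D (p - q)"
    using finp by (subst sum.subset_diff[of q p]) (auto simp: q_def)
  also have "sum ?D (p - q) \<le> (\<Sum>(x,K)\<in>p-q. (\<kappa> (Sup K) - \<kappa> (Inf K)) + (e1 * Sup K - e1 * Inf K))"
  proof (rule sum_mono, clarify)
    fix x K assume xK: "(x,K) \<in> p" "(x,K) \<notin> q"
    note k = K[OF xK(1)]
    show "norm (h (Sup K) - h (Inf K)) \<le> \<kappa> (Sup K) - \<kappa> (Inf K) + (e1 * Sup K - e1 * Inf K)"
    proof (cases "x \<in> N")
      case True
      then have "interior K = {}" using xK by (auto simp: q_def)
      then have "interior {Inf K..Sup K} = {}" using k by metis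
      then have "{Inf K<..<Sup K} = {}" by (simp only: interior_atLeastAtMost_real)
      then have "Inf K = Sup K" using k by (auto simp: greaterThanLessThan_empty_iff)
      then show ?thesis by simp
    next
      case False
      then have sub: "{Inf K..Sup K} \<subseteq> ball x (d x / 2)" using k by (auto simp: g_def)
      have "Inf K \<in> ball x (d x / 2)" "Sup K \<in> ball x (d x / 2)" using k sub by (meson atLeastAtMost_iff order.trans order.refl subsetD)+
      then have "Sup K - Inf K < d x" unfolding mem_ball dist_real_def by linarith
      moreover have "x \<in> {a..b} - N" using False k by auto
      ultimately have "norm (h (Sup K) - h (Inf K)) \<le> \<kappa> (Sup K) - \<kappa> (Inf K) + e1 * (Sup K - Inf K)"
        using dh[of x "Inf K" "Sup K"] k by blast
      then show ?thesis by (simp add: algebra_simps)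
    qed
  qed
  also have "\<dots> \<le> (\<Sum>(x,K)\<in>p. (\<kappa> (Sup K) - \<kappa> (Inf K)) + (e1 * Sup K - e1 * Inf K))"
  proof (rule sum_mono2[OF finp])
    fix y assume "y \<in> p - (p - q)"
    then obtain x K' where y: "y = (x,K')" "(x,K') \<in> p" by (cases y) auto
    note k = K[OF y(2)]
    have "\<kappa> (Inf K') \<le> \<kappa> (Sup K')" using k by (intro mono) auto
    moreover have "e1 * Inf K' \<le> e1 * Sup K'" using k e1 by (intro mult_left_mono) auto
    ultimately show "0 \<le> (case y of (x, K) \<Rightarrow> \<kappa> (Sup K) - \<kappa> (Inf K) + (e1 * Sup K - e1 * Inf K))"
      unfolding y by simp
  qed auto
  also have "\<dots> = (\<kappa> b - \<kappa> a) + (e1 * b - e1 * a)"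
    using additive_tagged_division_1[OF ab p(1), of \<kappa>] additive_tagged_division_1[OF ab p(1), of "\<lambda>x. e1 * x"]
    by (simp add: sum.distrib case_prod_unfold)
  finally have 1: "norm (h b - h a) \<le> sum ?D q + (\<kappa> b - \<kappa> a) + e/2" using e1 by (simp add: algebra_simps)
  have qp: "q \<subseteq> p" by (auto simp: q_def)
  have finq: "finite q" using finp qp finite_subset by blast
  have eqK: "x = x' \<and> K = K'" if "(x,K) \<in> q" "(x',K') \<in> q" "K = K'" for x K x' K'
  proof (rule ccontr)
    assume "\<not> (x = x' \<and> K = K')"
    then have "interior K \<inter> interior K' = {}"
      using tagged_division_ofD(5)[OF p(1), of x K x' K'] that qp by auto
    then show False using that by (auto simp: q_def)
  qed
  define P where "P = (\<lambda>(x::real,K). (Inf K, Sup K)) ` q"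
  have Kq: "K = {Inf K..Sup K}" if "(x,K) \<in> q" for x K using K[of x K] that qp by auto
  have injP: "inj_on (\<lambda>(x::real,K). (Inf K, Sup K)) q"
  proof (rule inj_onI, clarify)
    fix x K x' K' assume a: "(x,K) \<in> q" "(x',K') \<in> q" "Inf K = Inf K'" "Sup K = Sup K'"
    then have "K = K'" using Kq[OF a(1)] Kq[OF a(2)] by metis
    then show "x = x' \<and> K = K'" using eqK a by blast
  qed
  have "(\<Sum>(u, v)\<in>P. norm (h v - h u)) < e/2"
  proof (rule \<delta>(2))
    show "finite P" using finq by (simp add: P_def)
    show "\<forall>(u, v) \<in> P. a \<le> u \<and> u \<le> v \<and> v \<le> b"
      unfolding P_def using K qp by fastforce
    show "disjoint_family_on (\<lambda>(u, v). {u<..<v}) P"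
      unfolding disjoint_family_on_def
    proof (intro ballI impI)
      fix m n assume mn: "m \<in> P" "n \<in> P" "m \<noteq> n"
      then obtain x K x' K' where x: "(x,K) \<in> q" "(x',K') \<in> q" "m = (Inf K, Sup K)" "n = (Inf K', Sup K')"
        by (auto simp: P_def)
      then have "interior K \<inter> interior K' = {}"
        using tagged_division_ofD(5)[OF p(1), of x K x' K'] qp mn by auto
      moreover have "interior K = {Inf K<..<Sup K}" "interior K' = {Inf K'<..<Sup K'}"
        using Kq[OF x(1)] Kq[OF x(2)] by (metis interior_atLeastAtMost_real)+
      ultimately show "(case m of (u, v) \<Rightarrow> {u<..<v}) \<inter> (case n of (u, v) \<Rightarrow> {u<..<v}) = {}"
        using x by simp
    qed
    have tq: "q tagged_partial_division_of {a..b}"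
      using p(1) qp tagged_partial_division_subset tagged_division_of_def by blast
    have "(\<Sum>(u, v)\<in>P. v - u) = (\<Sum>(x,K)\<in>q. Sup K - Inf K)"
      unfolding P_def by (subst sum.reindex[OF injP]) (auto simp: case_prod_unfold)
    also have "\<dots> = (\<Sum>y\<in>q. measure lebesgue (snd y))"
    proof (rule sum.cong[OF refl], clarify)
      fix x K assume a: "(x,K) \<in> q"
      then have "Inf K \<le> Sup K" using K[of x K] qp by auto
      then have "measure lebesgue {Inf K..Sup K} = Sup K - Inf K" by simp
      then show "Sup K - Inf K = measure lebesgue (snd (x,K))" using Kq[OF a] by simp
    qed
    also have "\<dots> = (\<Sum>K\<in>snd ` q. measure lebesgue K)"
      by (subst sum.reindex) (auto intro!: inj_onI dest: eqK)
    also have "\<dots> = measure lebesgue (\<Union>(snd ` q))"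
      using content_division partial_division_of_tagged_division[OF tq] by blast
    also have "\<dots> \<le> measure lebesgue U"
    proof (rule measure_mono_fmeasurable)
      show "\<Union>(snd ` q) \<subseteq> U"
      proof
        fix z assume "z \<in> \<Union>(snd ` q)"
        then obtain x K' where x: "(x,K') \<in> q" "z \<in> K'" by auto
        then show "z \<in> U" using K[of x K'] qp by (auto simp: g_def q_def)
      qed
      have "\<And>K. K \<in> snd ` q \<Longrightarrow> K \<in> sets lebesgue"
      proof -
        fix K' assume "K' \<in> snd ` q"
        then obtain x where "(x,K') \<in> q" by auto
        then have "K' = {Inf K'..Sup K'}" by (rule Kq)
        then show "K' \<in> sets lebesgue" by (metis atLeastAtMost_borel sets_completionI_sets sets_lborel)
      qed
      then show "\<Union>(snd ` q) \<in> sets lebesgue" using finq by (intro sets.finite_Union) auto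
    qed (fact Um)
    finally show "(\<Sum>(u, v)\<in>P. v - u) < \<delta>" using U\<delta> by simp
  qed
  moreover have "sum ?D q = (\<Sum>(u, v)\<in>P. norm (h v - h u))"
    unfolding P_def by (subst sum.reindex[OF injP]) (auto simp: case_prod_unfold)
  ultimately show "norm (h b - h a) \<le> \<kappa> b - \<kappa> a + e" using 1 by simp
qed

text \<open>
Truncating \<open>k\<close> at a high level \<open>n\<close> leaves a remainder of small integral, and the truncated part contributes at most \<open>n\<close>
times the total length of the intervals.
\<close>

lemma abs_continuous_if_integral_dominated:
  fixes h :: "real \<Rightarrow> complex" and k :: "real \<Rightarrow> real"
  assumes k: "k integrable_on {a..b}" and nn: "\<And>x. x \<in> {a..b} \<Longrightarrow> 0 \<le> k x"
    and dom: "\<And>u v. a \<le> u \<Longrightarrow> u \<le> v \<Longrightarrow> v \<le> b \<Longrightarrow> norm (h v - h u) \<le> integral {u..v} k"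
  shows "abs_continuous_on_interval a b h"
  unfolding abs_continuous_on_interval_def
proof (intro allI impI)
  fix e :: real assume e: "0 < e"
  have ka: "k absolutely_integrable_on {a..b}"
    by (rule nonnegative_absolutely_integrable_1[OF k nn])
  define m where "m n x = min (k x) (real n)" for n :: nat and x
  have mi: "m n integrable_on {a..b}" for n
    unfolding m_def by (rule absolutely_integrable_on_def[THEN iffD1, THEN conjunct1], rule absolutely_integrable_min_1[OF ka]) auto
  have "(\<lambda>n. integral {a..b} (m n)) \<longlonglongrightarrow> integral {a..b} k"
  proof (rule dominated_convergence(2)[OF mi k])
    show "norm (m n x) \<le> k x" if "x \<in> {a..b}" for n x using nn[OF that] by (auto simp: m_def)
    show "(\<lambda>n. m n x) \<longlonglongrightarrow> k x" if "x \<in> {a..b}" for x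
    proof (rule tendsto_eventually)
      obtain n0 where "k x \<le> real n0" using real_arch_simple by blast
      then show "\<forall>\<^sub>F n in sequentially. m n x = k x"
        unfolding m_def by (intro eventually_sequentiallyI[of n0]) auto
    qed
  qed
  then have "\<forall>\<^sub>F n in sequentially. dist (integral {a..b} (m n)) (integral {a..b} k) < e/2"
    using e by (intro tendstoD) auto
  then obtain n where n: "\<bar>integral {a..b} (m n) - integral {a..b} k\<bar> < e/2"
    unfolding dist_real_def by (meson eventually_sequentially order_refl)
  let ?r = "\<lambda>x. k x - m n x"
  have ri: "?r integrable_on {a..b}" using k mi by (rule integrable_diff)
  have "integral {a..b} ?r < e/2" using n k mi[of n] by (simp add: integral_diff abs_if split: if_splits)
  show "\<exists>\<delta>>0. \<forall>P. finite P \<and> (\<forall>(u, v)\<in>P. a \<le> u \<and> u \<le> v \<and> v \<le> b) \<and> disjoint_family_on (\<lambda>(u, v). {u<..<v}) P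
      \<and> (\<Sum>(u, v)\<in>P. v - u) < \<delta> \<longrightarrow> (\<Sum>(u, v)\<in>P. norm (h v - h u)) < e"
  proof (intro exI[of _ "e / 2 / (n + 1)"] conjI allI impI; (elim conjE)?)
    show "e / 2 / (n + 1) > 0" using e by simp
    fix P :: "(real \<times> real) set"
    assume P: "finite P" "\<forall>(u, v)\<in>P. a \<le> u \<and> u \<le> v \<and> v \<le> b" "disjoint_family_on (\<lambda>(u, v). {u<..<v}) P"
      "(\<Sum>(u, v)\<in>P. v - u) < e / 2 / (n + 1)"
    have sub: "{u..v} \<subseteq> {a..b}" "u \<le> v" "a \<le> u" "v \<le> b" if "(u,v) \<in> P" for u v using P(2) that by auto
    have "norm (h v - h u) \<le> integral {u..v} ?r + n * (v - u)" if "(u,v) \<in> P" for u v :: real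
    proof -
      note s = sub[OF that]
      have i: "k integrable_on {u..v}" "m n integrable_on {u..v}" using k mi s integrable_on_subinterval by blast+
      have "integral {u..v} (m n) \<le> integral {u..v} (\<lambda>x. real n)"
        by (rule integral_le) (use i in \<open>auto simp: m_def\<close>)
      also have "\<dots> = n * (v - u)" using s by simp
      finally show ?thesis using dom[of u v] s i by (simp add: integral_diff)
    qed
    then have "(\<Sum>(u, v)\<in>P. norm (h v - h u)) \<le> (\<Sum>(u, v)\<in>P. integral {u..v} ?r + n * (v - u))"
      by (intro sum_mono) auto
    also have "\<dots> = (\<Sum>(u, v)\<in>P. integral {u..v} ?r) + n * (\<Sum>(u, v)\<in>P. (v - u))"
      by (simp add: sum.distrib sum_distrib_left case_prod_unfold)
    also have "(\<Sum>(u, v)\<in>P. integral {u..v} ?r) \<le> integral {a..b} ?r"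
    proof -
      have "(?r has_integral (\<Sum>i\<in>P. integral ((\<lambda>(u,v). {u..v}) i) ?r)) (\<Union>i\<in>P. (\<lambda>(u,v). {u..v}) i)"
      proof (rule has_integral_UN[OF P(1)])
        fix i assume "i \<in> P"
        then show "(?r has_integral integral ((\<lambda>(u,v). {u..v}) i) ?r) ((\<lambda>(u,v). {u..v}) i)"
          using integrable_on_subinterval[OF ri sub(1)] by (cases i) (auto intro!: integrable_integral)
      next
        show "pairwise (\<lambda>i i'. negligible ((\<lambda>(u,v). {u..v}) i \<inter> (\<lambda>(u,v). {u..v}) i')) P"
        proof (rule pairwiseI)
          fix i i' assume i: "i \<in> P" "i' \<in> P" "i \<noteq> i'"
          obtain u v u' v' where eq: "i = (u,v)" "i' = (u',v')" by (cases i, cases i')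
          with i have a: "(u,v) \<in> P" "(u',v') \<in> P" "\<not> (u = u' \<and> v = v')" by auto
          then have "{u<..<v} \<inter> {u'<..<v'} = {}"
            using P(3) unfolding disjoint_family_on_def by fastforce
          then have "{u..v} \<inter> {u'..v'} \<subseteq> {u,v,u',v'}"
            by (auto simp: disjoint_iff)
          then have "negligible ({u..v} \<inter> {u'..v'})"
            by (rule negligible_subset[rotated]) simp
          then show "negligible ((\<lambda>(u,v). {u..v}) i \<inter> (\<lambda>(u,v). {u..v}) i')" by (simp add: eq)
        qed
      qed
      then have "(\<Sum>(u, v)\<in>P. integral {u..v} ?r) = integral (\<Union>i\<in>P. (\<lambda>(u,v). {u..v}) i) ?r"
        and i: "?r integrable_on (\<Union>i\<in>P. (\<lambda>(u,v). {u..v}) i)"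
        by (auto simp: integral_unique case_prod_unfold)
      then have "(\<Sum>(u, v)\<in>P. integral {u..v} ?r) = integral (\<Union>i\<in>P. (\<lambda>(u,v). {u..v}) i) ?r" by simp
      also have "\<dots> \<le> integral {a..b} ?r"
      proof (rule integral_subset_le[OF _ i ri])
        show "(\<Union>i\<in>P. (\<lambda>(u,v). {u..v}) i) \<subseteq> {a..b}"
        proof (rule UN_least)
          fix i assume "i \<in> P"
          then show "(\<lambda>(u,v). {u..v}) i \<subseteq> {a..b}" using sub(1) by (cases i) auto
        qed
      qed (auto simp: m_def)
      finally show ?thesis .
    qed
    also have "n * (\<Sum>(u, v)\<in>P. (v - u)) \<le> n * (e / 2 / (n + 1))"
      using P(4) by (intro mult_left_mono) auto
    also have "\<dots> \<le> e/2" using e by (simp add: field_simps)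
    finally show "(\<Sum>(u, v)\<in>P. norm (h v - h u)) < e" using \<open>integral {a..b} ?r < e/2\<close> by simp
  qed
qed

lemma abs_continuous_imp_continuous_on:
  assumes "abs_continuous_on_interval a b h"
  shows "continuous_on {a..b} h"
  unfolding continuous_on_iff
proof (intro ballI allI impI)
  fix x and e :: real assume x: "x \<in> {a..b}" and "0 < e"
  from assms[unfolded abs_continuous_on_interval_def, rule_format, OF \<open>0 < e\<close>]
  obtain \<delta> where \<delta>: "\<delta> > 0" "\<And>P :: (real \<times> real) set. finite P \<and> (\<forall>(u, v) \<in> P. a \<le> u \<and> u \<le> v \<and> v \<le> b) \<and>
        disjoint_family_on (\<lambda>(u, v). {u<..<v}) P \<and> (\<Sum>(u, v)\<in>P. v - u) < \<delta> \<Longrightarrow> (\<Sum>(u, v)\<in>P. norm (h v - h u)) < e"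
    by blast
  have A: "norm (h v - h u) < e" if "a \<le> u" "u \<le> v" "v \<le> b" "v - u < \<delta>" for u v
    using \<delta>(2)[of "{(u,v)}"] that by (simp add: disjoint_family_on_def)
  have "dist (h y) (h x) < e" if "y \<in> {a..b}" "dist y x < \<delta>" for y
    using that x A[of x y] A[of y x] by (cases "y \<le> x") (auto simp: dist_norm norm_minus_commute)
  then show "\<exists>d>0. \<forall>y\<in>{a..b}. dist y x < d \<longrightarrow> dist (h y) (h x) < e" using \<delta>(1) by blast
qed

text \<open>
Absolute continuity passes to any function whose increments are controlled by those of absolutely continuous
functions; sums and compositions with locally Lipschitz functions are covered at once.
\<close>

lemma abs_continuous_combine:
  assumes p: "abs_continuous_on_interval a b p" and q: "abs_continuous_on_interval a b q" and C: "0 \<le> C"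
    and h: "\<And>u v. a \<le> u \<Longrightarrow> u \<le> v \<Longrightarrow> v \<le> b \<Longrightarrow> norm (h v - h u) \<le> C * norm (p v - p u) + norm (q v - q u)"
  shows "abs_continuous_on_interval a b h"
  unfolding abs_continuous_on_interval_def
proof (intro allI impI)
  fix e :: real assume e: "0 < e"
  then have e1: "0 < e / 2 / (C + 1)" and e2: "0 < e / 2" using C by auto
  from p[unfolded abs_continuous_on_interval_def, rule_format, OF e1]
  obtain \<delta>1 where \<delta>1: "\<delta>1 > 0" "\<And>P :: (real \<times> real) set. finite P \<and> (\<forall>(u, v) \<in> P. a \<le> u \<and> u \<le> v \<and> v \<le> b) \<and>
        disjoint_family_on (\<lambda>(u, v). {u<..<v}) P \<and> (\<Sum>(u, v)\<in>P. v - u) < \<delta>1 \<Longrightarrow> (\<Sum>(u, v)\<in>P. norm (p v - p u)) < e / 2 / (C + 1)"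
    by blast
  from q[unfolded abs_continuous_on_interval_def, rule_format, OF e2]
  obtain \<delta>2 where \<delta>2: "\<delta>2 > 0" "\<And>P :: (real \<times> real) set. finite P \<and> (\<forall>(u, v) \<in> P. a \<le> u \<and> u \<le> v \<and> v \<le> b) \<and>
        disjoint_family_on (\<lambda>(u, v). {u<..<v}) P \<and> (\<Sum>(u, v)\<in>P. v - u) < \<delta>2 \<Longrightarrow> (\<Sum>(u, v)\<in>P. norm (q v - q u)) < e / 2"
    by blast
  show "\<exists>\<delta>>0. \<forall>P. finite P \<and> (\<forall>(u, v) \<in> P. a \<le> u \<and> u \<le> v \<and> v \<le> b) \<and>
        disjoint_family_on (\<lambda>(u, v). {u<..<v}) P \<and> (\<Sum>(u, v)\<in>P. v - u) < \<delta> \<longrightarrow> (\<Sum>(u, v)\<in>P. norm (h v - h u)) < e"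
  proof (intro exI[of _ "min \<delta>1 \<delta>2"] conjI allI impI)
    show "0 < min \<delta>1 \<delta>2" using \<delta>1 \<delta>2 by simp
    fix P :: "(real \<times> real) set"
    assume P: "finite P \<and> (\<forall>(u, v) \<in> P. a \<le> u \<and> u \<le> v \<and> v \<le> b) \<and>
        disjoint_family_on (\<lambda>(u, v). {u<..<v}) P \<and> (\<Sum>(u, v)\<in>P. v - u) < min \<delta>1 \<delta>2"
    have P1: "(\<Sum>(u, v)\<in>P. norm (p v - p u)) < e / 2 / (C + 1)" by (rule \<delta>1(2)) (use P in simp)
    have P2: "(\<Sum>(u, v)\<in>P. norm (q v - q u)) < e / 2" by (rule \<delta>2(2)) (use P in simp)
    have "(\<Sum>(u, v)\<in>P. norm (h v - h u)) \<le> (\<Sum>(u, v)\<in>P. C * norm (p v - p u) + norm (q v - q u))"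
    proof (rule sum_mono)
      fix i assume "i \<in> P"
      then obtain u v where "i = (u,v)" "a \<le> u" "u \<le> v" "v \<le> b" using P by (cases i) auto
      then show "(case i of (u, v) \<Rightarrow> norm (h v - h u)) \<le> (case i of (u, v) \<Rightarrow> C * norm (p v - p u) + norm (q v - q u))"
        using h by simp
    qed
    also have "\<dots> = C * (\<Sum>(u, v)\<in>P. norm (p v - p u)) + (\<Sum>(u, v)\<in>P. norm (q v - q u))"
      by (simp add: sum.distrib sum_distrib_left case_prod_unfold)
    also have "C * (\<Sum>(u, v)\<in>P. norm (p v - p u)) \<le> C * (e / 2 / (C + 1))"
      using P1 C by (intro mult_left_mono) auto
    also have "\<dots> = e / 2 * (C / (C + 1))" by simp
    also have "\<dots> \<le> e / 2 * 1" using e C by (intro mult_left_mono) auto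
    finally show "(\<Sum>(u, v)\<in>P. norm (h v - h u)) < e" using P2 by simp
  qed
qed

text \<open>
A bound for the increments over intervals that contain \<open>t\<close>, not only over those with \<open>t\<close> as an endpoint.
\<close>

lemma has_vector_derivative_straddle:
  fixes h :: "real \<Rightarrow> complex"
  assumes h: "(h has_vector_derivative D) (at t within {a..b})" and t: "t \<in> {a..b}" and e: "0 < e"
  shows "\<exists>d>0. \<forall>u v. a \<le> u \<and> u \<le> t \<and> t \<le> v \<and> v \<le> b \<and> v - u < d \<longrightarrow> norm (h v - h u) \<le> norm D * (v - u) + e * (v - u)"
proof -
  obtain d where d: "d > 0" "\<And>y. y \<in> {a..b} \<Longrightarrow> norm (y - t) < d \<Longrightarrow> norm (h y - h t - (y - t) *\<^sub>R D) \<le> e * norm (y - t)"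
    using h[unfolded has_vector_derivative_def has_derivative_within_alt] e by blast
  have "norm (h v - h u) \<le> norm D * (v - u) + e * (v - u)" if "a \<le> u" "u \<le> t" "t \<le> v" "v \<le> b" "v - u < d" for u v
  proof -
    have v: "norm (h v - h t - (v - t) *\<^sub>R D) \<le> e * (v - t)" using d(2)[of v] that by simp
    have u: "norm (h u - h t - (u - t) *\<^sub>R D) \<le> e * (t - u)" using d(2)[of u] that by simp
    have "h v - h u = (h v - h t - (v - t) *\<^sub>R D) - (h u - h t - (u - t) *\<^sub>R D) + (v - u) *\<^sub>R D"
      by (simp add: algebra_simps)
    also have "norm \<dots> \<le> norm (h v - h t - (v - t) *\<^sub>R D) + norm (h u - h t - (u - t) *\<^sub>R D) + norm ((v - u) *\<^sub>R D)"
      by (rule order_trans[OF norm_triangle_ineq add_right_mono[OF norm_triangle_ineq4]])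
    also have "\<dots> \<le> e * (v - t) + e * (t - u) + (v - u) * norm D" using u v that by simp
    finally show ?thesis by (simp add: algebra_simps)
  qed
  then show ?thesis using d(1) by blast
qed

lemma abs_continuous_derivative_bound:
  assumes ac: "abs_continuous_on_interval a b h" and ab: "a \<le> b" and N: "negligible N"
    and k: "k integrable_on {a..b}" "\<And>x. x \<in> {a..b} \<Longrightarrow> 0 \<le> k x"
    and D: "\<And>t. t \<in> {a..b} - N \<Longrightarrow> \<exists>D. (h has_vector_derivative D) (at t within {a..b}) \<and> norm D \<le> k t"
  shows "norm (h b - h a) \<le> integral {a..b} k"
proof -
  obtain N1 where N1: "negligible N1"
    "\<And>x e. x \<in> {a..b} - N1 \<Longrightarrow> 0 < e \<Longrightarrow> \<exists>d>0. \<forall>u v. a \<le> u \<and> u \<le> x \<and> x \<le> v \<and> v \<le> b \<and> v - u < d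
        \<longrightarrow> \<bar>integral {u..v} k - (v - u) * k x\<bar> \<le> e * (v - u)"
    by (rule indefinite_integral_straddle_derivative_ae[OF k(1)]) (rule that)
  note Kd = integral_Icc_diff[OF k(1)]
  have "norm (h b - h a) \<le> integral {a..b} k - integral {a..a} k"
  proof (rule abs_continuous_increment_le[OF ac ab, of "N \<union> N1"])
    show "negligible (N \<union> N1)" using N N1(1) by simp
    show "integral {a..u} k \<le> integral {a..v} k" if "a \<le> u" "u \<le> v" "v \<le> b" for u v
    proof -
      have "0 \<le> integral {u..v} k" by (rule integral_nonneg) (use k integrable_on_subinterval[OF k(1)] that in auto)
      then show ?thesis using Kd[OF that] by simp
    qed
    fix t e :: real assume t: "t \<in> {a..b} - (N \<union> N1)" and e: "0 < e"
    obtain D where D: "(h has_vector_derivative D) (at t within {a..b})" "norm D \<le> k t" using assms(6)[of t] t by blast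
    obtain d1 where d1: "d1 > 0" "\<forall>u v. a \<le> u \<and> u \<le> t \<and> t \<le> v \<and> v \<le> b \<and> v - u < d1 \<longrightarrow> norm (h v - h u) \<le> norm D * (v - u) + e/2 * (v - u)"
      using has_vector_derivative_straddle[OF D(1), of "e/2"] t e by auto
    obtain d2 where d2: "d2 > 0" "\<forall>u v. a \<le> u \<and> u \<le> t \<and> t \<le> v \<and> v \<le> b \<and> v - u < d2
        \<longrightarrow> \<bar>integral {u..v} k - (v - u) * k t\<bar> \<le> e/2 * (v - u)"
      using N1(2)[of t "e/2"] t e by auto
    show "\<exists>d>0. \<forall>u v. a \<le> u \<and> u \<le> t \<and> t \<le> v \<and> v \<le> b \<and> v - u < d \<longrightarrow>
       norm (h v - h u) \<le> integral {a..v} k - integral {a..u} k + e * (v - u)"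
    proof (rule exI[of _ "min d1 d2"], intro conjI allI impI)
      show "0 < min d1 d2" using d1 d2 by simp
      fix u v assume uv: "a \<le> u \<and> u \<le> t \<and> t \<le> v \<and> v \<le> b \<and> v - u < min d1 d2"
      have 1: "norm (h v - h u) \<le> norm D * (v - u) + e/2 * (v - u)" using d1(2) uv by simp
      have 2: "\<bar>integral {u..v} k - (v - u) * k t\<bar> \<le> e/2 * (v - u)" using d2(2) uv by simp
      have 3: "norm D * (v - u) \<le> k t * (v - u)" using D(2) uv by (intro mult_right_mono) auto
      have 4: "integral {a..v} k - integral {a..u} k = integral {u..v} k" using uv by (intro Kd) auto
      have 5: "e * (v - u) = e/2 * (v - u) + e/2 * (v - u)" by (simp add: field_simps)
      have 6: "(v - u) * k t - integral {u..v} k \<le> e/2 * (v - u)" using 2 by (simp only: abs_le_iff) linarith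
      have 7: "k t * (v - u) = (v - u) * k t" by (rule mult.commute)
      from 1 3 6 show "norm (h v - h u) \<le> integral {a..v} k - integral {a..u} k + e * (v - u)"
        unfolding 4 5 7 by linarith
    qed
  qed
  then show ?thesis by simp
qed

corollary abs_continuous_zero_derivative:
  assumes "abs_continuous_on_interval a b h" "a \<le> b" "negligible N"
    and "\<And>t. t \<in> {a..b} - N \<Longrightarrow> (h has_vector_derivative 0) (at t within {a..b})"
  shows "h b = h a"
  using abs_continuous_derivative_bound[OF assms(1-3), of "\<lambda>_. 0"] assms(4) by force

section \<open>Null sets and the classes \<open>L\<^sup>d\<close>\<close>

lemma AE_lebesgue_on_iff_negligible:
  assumes "S \<in> sets lebesgue"
  shows "(AE x in lebesgue_on S. P x) \<longleftrightarrow> (\<exists>N. negligible N \<and> (\<forall>x\<in>S - N. P x))"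
proof -
  have "(AE x in lebesgue_on S. P x) \<longleftrightarrow> (AE x in lebesgue. x \<in> S \<longrightarrow> P x)"
    using assms by (intro AE_restrict_space_iff) simp
  also have "\<dots> \<longleftrightarrow> (\<exists>N. negligible N \<and> (\<forall>x\<in>S - N. P x))"
  proof
    assume "AE x in lebesgue. x \<in> S \<longrightarrow> P x"
    then obtain N where "N \<in> null_sets lebesgue" "{x \<in> space lebesgue. \<not> (x \<in> S \<longrightarrow> P x)} \<subseteq> N"
      unfolding eventually_ae_filter by blast
    then show "\<exists>N. negligible N \<and> (\<forall>x\<in>S - N. P x)"
      by (intro exI[of _ N]) (auto simp: negligible_iff_null_sets)
  next
    assume "\<exists>N. negligible N \<and> (\<forall>x\<in>S - N. P x)"
    then obtain N where N: "negligible N" "\<forall>x\<in>S - N. P x" by blast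
    show "AE x in lebesgue. x \<in> S \<longrightarrow> P x"
      by (rule AE_I'[of N]) (use N in \<open>auto simp: negligible_iff_null_sets\<close>)
  qed
  finally show ?thesis .
qed

lemma interval_sets_lebesgue:
  fixes E :: "real set"
  shows "is_interval E \<Longrightarrow> E \<in> sets lebesgue"
  using real_interval_borel_measurable sets_completionI_sets by (metis sets_lborel)

lemma enn2real_ge_1:
  assumes "1 \<le> d" "d \<noteq> \<infinity>"
  shows "1 \<le> enn2real d"
  using enn2real_mono[OF assms(1)] assms(2) by (simp add: top.not_eq_extremum)

lemma in_Ld_imp_integrable:
  assumes d: "1 \<le> d" and k: "in_Ld d T k"
  shows "integrable (lebesgue_on {0..T}) k"
proof -
  interpret finite_measure "lebesgue_on {0..T}" by (rule finite_measure_lebesgue_on) simp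
  have km: "k \<in> borel_measurable (lebesgue_on {0..T})" using k by (simp add: in_Ld_def)
  show ?thesis
  proof (cases "d = \<infinity>")
    case True
    then obtain C where C: "AE x in lebesgue_on {0..T}. \<bar>k x\<bar> \<le> C" using k by (auto simp: in_Ld_def)
    show ?thesis
    proof (rule Bochner_Integration.integrable_bound[OF _ km])
      show "integrable (lebesgue_on {0..T}) (\<lambda>x. C)" by (rule integrable_const)
      show "AE x in lebesgue_on {0..T}. norm (k x) \<le> norm C" using C by eventually_elim auto
    qed
  next
    case False
    then have i: "integrable (lebesgue_on {0..T}) (\<lambda>x. \<bar>k x\<bar> powr enn2real d)" using k by (simp add: in_Ld_def)
    have "\<bar>k x\<bar> \<le> 1 + \<bar>k x\<bar> powr enn2real d" for x
    proof (cases "\<bar>k x\<bar> \<le> 1")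
      case False
      then have "\<bar>k x\<bar> powr 1 \<le> \<bar>k x\<bar> powr enn2real d"
        using enn2real_ge_1[OF d \<open>d \<noteq> \<infinity>\<close>] by (intro powr_mono) auto
      then show ?thesis using False by simp
    qed (simp add: add_increasing2)
    then show ?thesis
      by (intro Bochner_Integration.integrable_bound[OF Bochner_Integration.integrable_add[OF integrable_const[of 1] i] km])
         (auto simp: add_nonneg_nonneg)
  qed
qed

lemma in_Ld_divide:
  assumes "in_Ld d T k" "0 < c"
  shows "in_Ld d T (\<lambda>x. k x / c)"
proof -
  have m: "(\<lambda>x. k x / c) \<in> borel_measurable (lebesgue_on {0..T})" using assms by (auto simp: in_Ld_def)
  show ?thesis
  proof (cases "d = \<infinity>")
    case True
    then obtain C where C: "AE x in lebesgue_on {0..T}. \<bar>k x\<bar> \<le> C" using assms by (auto simp: in_Ld_def)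
    have "AE x in lebesgue_on {0..T}. \<bar>k x / c\<bar> \<le> C / c"
      using C by eventually_elim (use assms(2) in \<open>auto simp: divide_right_mono\<close>)
    then show ?thesis using m True by (auto simp: in_Ld_def)
  next
    case False
    have "\<bar>k x / c\<bar> powr enn2real d = \<bar>k x\<bar> powr enn2real d / c powr enn2real d" for x
      using assms(2) by (simp add: powr_divide)
    then show ?thesis using m False assms(1) by (simp add: in_Ld_def)
  qed
qed

section \<open>Divided differences of holomorphic functions\<close>

lemma continuous_on_Times_if_equicontinuous:
  fixes f :: "'a::metric_space \<Rightarrow> 'b::metric_space \<Rightarrow> 'c::metric_space"
  assumes cont: "\<And>x. x \<in> U \<Longrightarrow> continuous_on V (f x)"
    and equi: "\<And>x y e. x \<in> U \<Longrightarrow> y \<in> V \<Longrightarrow> 0 < e \<Longrightarrow>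
      \<exists>d>0. \<forall>x'\<in>U. \<forall>y'\<in>V. dist x' x < d \<longrightarrow> dist y' y < d \<longrightarrow> dist (f x' y') (f x y') < e"
  shows "continuous_on (U \<times> V) (\<lambda>(x, y). f x y)"
  unfolding continuous_on_iff
proof (intro ballI allI impI)
  fix p and e :: real assume p: "p \<in> U \<times> V" and e: "0 < e"
  obtain x y where xy: "p = (x,y)" "x \<in> U" "y \<in> V" using p by auto
  obtain d1 where d1: "d1 > 0" "\<forall>x'\<in>U. \<forall>y'\<in>V. dist x' x < d1 \<longrightarrow> dist y' y < d1 \<longrightarrow> dist (f x' y') (f x y') < e/2"
    using equi[OF xy(2,3), of "e/2"] e by auto
  have "\<forall>e>0. \<exists>d>0. \<forall>y'\<in>V. dist y' y < d \<longrightarrow> dist (f x y') (f x y) < e"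
    using cont[OF xy(2)] xy(3) unfolding continuous_on_iff by simp
  then obtain d2 where d2: "d2 > 0" "\<forall>y'\<in>V. dist y' y < d2 \<longrightarrow> dist (f x y') (f x y) < e/2"
    using e by (meson half_gt_zero)
  show "\<exists>d>0. \<forall>p'\<in>U \<times> V. dist p' p < d \<longrightarrow> dist (case p' of (x, y) \<Rightarrow> f x y) (case p of (x, y) \<Rightarrow> f x y) < e"
  proof (intro exI[of _ "min d1 d2"] conjI ballI impI)
    show "0 < min d1 d2" using d1 d2 by simp
    fix p' assume p': "p' \<in> U \<times> V" "dist p' p < min d1 d2"
    obtain x' y' where x': "p' = (x',y')" "x' \<in> U" "y' \<in> V" using p' by auto
    have "dist x' x < min d1 d2" "dist y' y < min d1 d2"
      using p'(2) dist_fst_le[of p' p] dist_snd_le[of p' p] unfolding x'(1) xy(1) by auto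
    then have "dist (f x' y') (f x y') < e/2" "dist (f x y') (f x y) < e/2" using d1(2) d2(2) x' by auto
    then show "dist (case p' of (x, y) \<Rightarrow> f x y) (case p of (x, y) \<Rightarrow> f x y) < e"
      using dist_triangle[of "f x' y'" "f x y" "f x y'"] by (simp add: x' xy)
  qed
qed

definition divided_difference :: "(complex \<Rightarrow> complex) \<Rightarrow> complex \<Rightarrow> complex \<Rightarrow> complex" where
  "divided_difference g a b = (if a = b then deriv g a else (g a - g b) / (a - b))"

lemma divided_difference_diag [simp]: "divided_difference g a a = deriv g a"
  by (simp add: divided_difference_def)

lemma divided_difference_mult: "(a - b) * divided_difference g a b = g a - g b"
  by (simp add: divided_difference_def)

lemma divided_difference_neq_0:
  assumes "g holomorphic_on S" "open S" "inj_on g S" "a \<in> S" "b \<in> S"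
  shows "divided_difference g a b \<noteq> 0"
  using holomorphic_injective_imp_regular[OF assms(1-4)] assms(3-5)
  by (auto simp: divided_difference_def inj_on_def)

lemma divided_difference_Cauchy:
  assumes g: "g holomorphic_on ball 0 1" and R: "0 < R" "R < 1" and ab: "a \<in> ball 0 R" "b \<in> ball 0 R"
  shows "divided_difference g a b =
     1 / (2 * of_real pi * \<i>) * contour_integral (circlepath 0 R) (\<lambda>\<zeta>. g \<zeta> / ((\<zeta> - a) * (\<zeta> - b)))"
proof -
  have "cball 0 R \<subseteq> ball (0::complex) 1" "ball 0 R \<subseteq> ball (0::complex) 1" using R by auto
  then have cont: "continuous_on (cball 0 R) g" and hol: "g holomorphic_on ball 0 R"
    using holomorphic_on_subset[OF g] holomorphic_on_imp_continuous_on by blast+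
  show ?thesis
  proof (cases "a = b")
    case True
    have "deriv g a = 1 / (2 * of_real pi * \<i>) * contour_integral (circlepath 0 R) (\<lambda>u. g u / (u-a)^2)"
      by (rule DERIV_imp_deriv, rule Cauchy_derivative_integral_circlepath(2)[OF cont hol ab(1)])
    then show ?thesis using True by (simp add: power2_eq_square)
  next
    case False
    have "((\<lambda>\<zeta>. (g \<zeta> / (\<zeta> - a) - g \<zeta> / (\<zeta> - b)) / (a - b)) has_contour_integral
        (2 * of_real pi * \<i> * g a - 2 * of_real pi * \<i> * g b) / (a - b)) (circlepath 0 R)"
      using ab cont hol
      by (intro has_contour_integral_div has_contour_integral_diff Cauchy_integral_circlepath) auto
    then have "((\<lambda>\<zeta>. g \<zeta> / ((\<zeta> - a) * (\<zeta> - b))) has_contour_integral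
        (2 * of_real pi * \<i> * g a - 2 * of_real pi * \<i> * g b) / (a - b)) (circlepath 0 R)"
    proof (rule has_contour_integral_eq)
      fix \<zeta> assume "\<zeta> \<in> path_image (circlepath 0 R)"
      then have "\<zeta> \<noteq> a" "\<zeta> \<noteq> b" using ab R by auto
      then show "(g \<zeta> / (\<zeta> - a) - g \<zeta> / (\<zeta> - b)) / (a - b) = g \<zeta> / ((\<zeta> - a) * (\<zeta> - b))"
        using False by (simp add: divide_simps) (simp add: algebra_simps)
    qed
    then have "contour_integral (circlepath 0 R) (\<lambda>\<zeta>. g \<zeta> / ((\<zeta> - a) * (\<zeta> - b)))
       = 2 * of_real pi * \<i> * ((g a - g b) / (a - b))"
      by (subst contour_integral_unique, assumption) (simp add: algebra_simps diff_divide_distrib)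
    then show ?thesis using False by (simp add: divided_difference_def)
  qed
qed

text \<open>
Off the diagonal the continuity is clear; the diagonal is reached through Cauchy's integral formula, which expresses
the divided difference by one integral over a circle whose integrand is jointly continuous.
\<close>

lemma continuous_on_divided_difference:
  fixes F :: "'t::topological_space \<Rightarrow> complex \<Rightarrow> complex"
  assumes F: "continuous_on (E \<times> ball 0 1) (\<lambda>(t, z). F t z)"
    and hol: "\<And>t. t \<in> E \<Longrightarrow> F t holomorphic_on ball 0 1"
  shows "continuous_on (E \<times> ball 0 1 \<times> ball 0 1) (\<lambda>(t, a, b). divided_difference (F t) a b)"
proof -
  have R: "continuous_on (E \<times> ball 0 R \<times> ball 0 R) (\<lambda>(t, a, b). divided_difference (F t) a b)"
    if "0 < R" "R < 1" for R
  proof -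
    let ?U = "E \<times> ball (0::complex) R \<times> ball (0::complex) R"
    let ?c = "\<lambda>s::real. R * exp (2 * of_real pi * \<i> * of_real s) :: complex"
    let ?I = "\<lambda>(t,a,b) s. F t (?c s) / ((?c s - a) * (?c s - b)) * (2 * pi * \<i> * R * exp (2 * of_real pi * \<i> * s))"
    have nc: "norm (?c s) = R" for s using that by (simp add: norm_mult)
    have ne: "?c s \<noteq> a" if "norm a < R" for a s using nc[of s] that by auto
    have "continuous_on (?U \<times> cbox 0 1) (\<lambda>(x, s). ?I x s)"
    proof -
      have "continuous_on (?U \<times> cbox (0::real) 1) (\<lambda>x. (\<lambda>(t,z). F t z) (fst (fst x), ?c (snd x)))"
        by (rule continuous_on_compose2[OF F]) (use nc that in \<open>auto intro!: continuous_intros\<close>)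
      then have "continuous_on (?U \<times> cbox (0::real) 1) (\<lambda>x. F (fst (fst x)) (?c (snd x)))" by simp
      then have "continuous_on (?U \<times> cbox (0::real) 1) (\<lambda>x. F (fst (fst x)) (?c (snd x))
         / ((?c (snd x) - fst (snd (fst x))) * (?c (snd x) - snd (snd (fst x))))
         * (2 * pi * \<i> * R * exp (2 * of_real pi * \<i> * of_real (snd x))))"
        by (intro continuous_intros) (use ne in auto)
      then show ?thesis by (simp add: case_prod_unfold)
    qed
    then have "continuous_on ?U (\<lambda>x. integral (cbox 0 1) (?I x))"
      by (rule integral_continuous_on_param)
    then have "continuous_on ?U (\<lambda>x. 1 / (2 * of_real pi * \<i>) * integral (cbox 0 1) (?I x))"
      by (intro continuous_intros)
    then show ?thesis
    proof (rule continuous_on_eq)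
      fix x assume "x \<in> ?U"
      then obtain t a b where x: "x = (t,a,b)" "t \<in> E" "a \<in> ball 0 R" "b \<in> ball 0 R" by auto
      show "1 / (2 * of_real pi * \<i>) * integral (cbox 0 1) (?I x) = (case x of (t, a, b) \<Rightarrow> divided_difference (F t) a b)"
        unfolding x(1) prod.case divided_difference_Cauchy[OF hol[OF x(2)] that x(3,4)] contour_integral_integral
        unfolding vector_derivative_circlepath by (simp add: circlepath)
    qed
  qed
  show ?thesis
    unfolding continuous_on_def
  proof
    fix x assume "x \<in> E \<times> ball (0::complex) 1 \<times> ball (0::complex) 1"
    then obtain t a b where x: "x = (t,a,b)" "t \<in> E" "norm a < 1" "norm b < 1" by auto
    define R where "R = (1 + max (norm a) (norm b)) / 2"
    have R01: "0 < R" "R < 1" "norm a < R" "norm b < R" using x norm_ge_zero[of a] unfolding R_def max_def by (auto split: if_splits simp del: norm_ge_zero)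
    let ?O = "UNIV \<times> ball (0::complex) R \<times> ball (0::complex) R"
    have "((\<lambda>(t, a, b). divided_difference (F t) a b) \<longlongrightarrow> (case x of (t, a, b) \<Rightarrow> divided_difference (F t) a b))
       (at x within E \<times> ball 0 R \<times> ball 0 R)"
      using R[OF R01(1,2)] x R01 unfolding continuous_on_def by auto
    moreover have "at x within E \<times> ball 0 R \<times> ball 0 R = at x within E \<times> ball 0 1 \<times> ball 0 1"
      by (rule at_within_nhd[of _ ?O]) (use x R01 in \<open>auto intro!: open_Times\<close>)
    ultimately show "((\<lambda>(t, a, b). divided_difference (F t) a b) \<longlongrightarrow> (case x of (t, a, b) \<Rightarrow> divided_difference (F t) a b))
       (at x within E \<times> ball 0 1 \<times> ball 0 1)" by simp
  qed
qed

lemma continuous_on_divided_difference_fixed: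
  assumes H: "H holomorphic_on unit_disc"
  shows "continuous_on (unit_disc \<times> unit_disc) (\<lambda>(a, b). divided_difference H a b)"
proof -
  have dd: "continuous_on (UNIV \<times> ball 0 1 \<times> ball 0 1) (\<lambda>(t::real, a, b). divided_difference H a b)"
  proof (rule continuous_on_divided_difference)
    have "continuous_on (UNIV \<times> ball 0 1) (\<lambda>x::real \<times> complex. H (snd x))"
      by (rule continuous_on_compose2[OF holomorphic_on_imp_continuous_on[OF H] continuous_on_snd]) (auto intro: continuous_intros)
    then show "continuous_on (UNIV \<times> ball 0 1) (\<lambda>(t::real, z). H z)" by (simp add: case_prod_unfold)
  qed (rule H)
  have "continuous_on (unit_disc \<times> unit_disc) (\<lambda>p. (\<lambda>(t::real, a, b). divided_difference H a b) (0, p))"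
    by (rule continuous_on_compose2[OF dd]) (auto intro!: continuous_intros)
  then show ?thesis by (simp add: case_prod_unfold)
qed

lemma divided_difference_tendsto:
  fixes F :: "real \<Rightarrow> complex \<Rightarrow> complex"
  assumes F: "continuous_on (E \<times> ball 0 1) (\<lambda>(t, z). F t z)"
    and hol: "\<And>t. t \<in> E \<Longrightarrow> F t holomorphic_on ball 0 1"
    and t: "t \<in> E" and z: "z \<in> ball 0 1"
    and lim: "(\<tau> \<longlongrightarrow> t) L" "(a \<longlongrightarrow> z) L" "(b \<longlongrightarrow> z) L" and E: "\<forall>\<^sub>F x in L. \<tau> x \<in> E"
  shows "((\<lambda>x. divided_difference (F (\<tau> x)) (a x) (b x)) \<longlongrightarrow> deriv (F t) z) L"
proof -
  have "((\<lambda>x. (\<lambda>(t, a, b). divided_difference (F t) a b) (\<tau> x, a x, b x)) \<longlongrightarrow> (\<lambda>(t, a, b). divided_difference (F t) a b) (t, z, z)) L"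
  proof (rule continuous_on_tendsto_compose[OF continuous_on_divided_difference[OF F hol]])
    show "((\<lambda>x. (\<tau> x, a x, b x)) \<longlongrightarrow> (t, z, z)) L" by (intro tendsto_Pair lim)
    have "\<forall>\<^sub>F x in L. a x \<in> ball 0 1" "\<forall>\<^sub>F x in L. b x \<in> ball 0 1"
      using topological_tendstoD[OF lim(2) open_ball z] topological_tendstoD[OF lim(3) open_ball z] by auto
    with E show "\<forall>\<^sub>F x in L. (\<tau> x, a x, b x) \<in> E \<times> ball 0 1 \<times> ball 0 1"
      by eventually_elim auto
  qed (use t z in auto)
  then show ?thesis by simp
qed

lemma divided_difference_bounded:
  assumes F: "continuous_on (E \<times> unit_disc) (\<lambda>(t, z). F t z)"
    and hol: "\<And>t. t \<in> E \<Longrightarrow> F t holomorphic_on unit_disc"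
    and E': "compact E'" "E' \<subseteq> E" and K: "compact K" "K \<subseteq> unit_disc"
  obtains M where "0 < M" "\<And>t a b. t \<in> E' \<Longrightarrow> a \<in> K \<Longrightarrow> b \<in> K \<Longrightarrow> norm (divided_difference (F t) a b) \<le> M"
proof -
  have "continuous_on (E' \<times> K \<times> K) (\<lambda>(t, a, b). divided_difference (F t) a b)"
    by (rule continuous_on_subset[OF continuous_on_divided_difference[OF F hol]]) (use E' K in \<open>auto simp del: mem_ball\<close>)
  moreover have "compact (E' \<times> K \<times> K)" by (intro compact_Times E' K)
  ultimately have "bounded ((\<lambda>(t, a, b). divided_difference (F t) a b) ` (E' \<times> K \<times> K))"
    by (intro compact_imp_bounded compact_continuous_image)
  then obtain M where M: "0 < M" "\<And>x. x \<in> E' \<times> K \<times> K \<Longrightarrow> norm ((\<lambda>(t, a, b). divided_difference (F t) a b) x) \<le> M"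
    unfolding bounded_pos by auto
  have "norm (divided_difference (F t) a b) \<le> M" if "t \<in> E'" "a \<in> K" "b \<in> K" for t a b
    using M(2)[of "(t,a,b)"] that by simp
  then show ?thesis by (rule that[OF M(1)])
qed

lemma divided_difference_bounded_below:
  fixes F :: "real \<Rightarrow> complex \<Rightarrow> complex"
  assumes F: "continuous_on (E \<times> unit_disc) (\<lambda>(t, z). F t z)"
    and hol: "\<And>t. t \<in> E \<Longrightarrow> F t holomorphic_on unit_disc"
    and inj: "\<And>t. t \<in> E \<Longrightarrow> inj_on (F t) unit_disc"
    and E': "compact E'" "E' \<subseteq> E" and K: "compact K" "K \<subseteq> unit_disc"
  obtains m where "0 < m" "\<And>t a b. t \<in> E' \<Longrightarrow> a \<in> K \<Longrightarrow> b \<in> K \<Longrightarrow> m \<le> norm (divided_difference (F t) a b)"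
proof (cases "E' \<times> K \<times> K = {}")
  case True
  then show ?thesis by (intro that[of 1]) auto
next
  case False
  let ?d = "\<lambda>x. norm ((\<lambda>(t, a, b). divided_difference (F t) a b) x)"
  have "continuous_on (E' \<times> K \<times> K) ?d"
    by (rule continuous_on_norm, rule continuous_on_subset[OF continuous_on_divided_difference[OF F hol]]) (use E' K in \<open>auto simp del: mem_ball\<close>)
  moreover have "compact (E' \<times> K \<times> K)" by (intro compact_Times E' K)
  ultimately obtain x where x: "x \<in> E' \<times> K \<times> K" "\<And>y. y \<in> E' \<times> K \<times> K \<Longrightarrow> ?d x \<le> ?d y"
    using continuous_attains_inf[of "E' \<times> K \<times> K" ?d] False by blast
  obtain t a b where eq: "x = (t,a,b)" "t \<in> E" "a \<in> unit_disc" "b \<in> unit_disc" using x(1) E' K by (cases x) blast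
  have "divided_difference (F t) a b \<noteq> 0"
    by (rule divided_difference_neq_0[OF hol open_ball inj]) (use eq in auto)
  then have "0 < ?d x" by (simp add: eq)
  moreover have "?d x \<le> norm (divided_difference (F t) a b)" if "t \<in> E'" "a \<in> K" "b \<in> K" for t a b
    using x(2)[of "(t,a,b)"] that by simp
  ultimately show ?thesis by (rule that)
qed

lemma has_vector_derivative_complex_quotient_iff:
  fixes h :: "real \<Rightarrow> complex"
  shows "(h has_vector_derivative D) (at t within S) \<longleftrightarrow>
     ((\<lambda>s. (h s - h t) / complex_of_real (s - t)) \<longlongrightarrow> D) (at t within S)"
proof -
  have "(h has_vector_derivative D) (at t within S) \<longleftrightarrow>
     ((\<lambda>s. (1 / norm (s - t)) *\<^sub>R (h s - (h t + (s - t) *\<^sub>R D))) \<longlongrightarrow> 0) (at t within S)"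
    unfolding has_vector_derivative_def has_derivative_within by (simp add: bounded_linear_scaleR_left)
  also have "\<dots> \<longleftrightarrow> ((\<lambda>s. norm ((1 / norm (s - t)) *\<^sub>R (h s - (h t + (s - t) *\<^sub>R D)))) \<longlongrightarrow> 0) (at t within S)"
    by (simp only: tendsto_norm_zero_iff)
  also have "\<dots> \<longleftrightarrow> ((\<lambda>s. norm ((h s - h t) / complex_of_real (s - t) - D)) \<longlongrightarrow> 0) (at t within S)"
  proof (rule filterlim_cong[OF refl refl])
    have "norm ((1 / norm (s - t)) *\<^sub>R (h s - (h t + (s - t) *\<^sub>R D))) = norm ((h s - h t) / complex_of_real (s - t) - D)"
      if "s \<noteq> t" for s
    proof -
      have "(h s - h t) / complex_of_real (s - t) - D = (h s - (h t + (s - t) *\<^sub>R D)) / complex_of_real (s - t)"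
        using that by (simp add: field_simps scaleR_conv_of_real)
      then show ?thesis by (simp only: norm_divide norm_scaleR norm_of_real) (simp add: divide_inverse mult.commute)
    qed
    then show "\<forall>\<^sub>F s in at t within S. norm ((1 / norm (s - t)) *\<^sub>R (h s - (h t + (s - t) *\<^sub>R D))) = norm ((h s - h t) / complex_of_real (s - t) - D)"
      by (auto simp: eventually_at_filter)
  qed
  also have "\<dots> \<longleftrightarrow> ((\<lambda>s. (h s - h t) / complex_of_real (s - t)) \<longlongrightarrow> D) (at t within S)"
    by (simp only: tendsto_norm_zero_iff LIM_zero_iff)
  finally show ?thesis .
qed

text \<open>
The chain rule for \<open>s \<mapsto> F s (u s)\<close> under a derivative of \<open>F\<close> in time at the single point \<open>u t\<close>. This works because the
increment is split as \<open>F s (u s) - F s (u t)\<close> plus \<open>F s (u t) - F t (u t)\<close>, and the first part is \<open>u s - u t\<close> times a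
divided difference that tends to \<open>deriv (F t) (u t)\<close>.
\<close>

lemma has_vector_derivative_along_curve:
  fixes F :: "real \<Rightarrow> complex \<Rightarrow> complex"
  assumes F: "continuous_on (E \<times> ball 0 1) (\<lambda>(t, z). F t z)"
    and hol: "\<And>t. t \<in> E \<Longrightarrow> F t holomorphic_on ball 0 1"
    and t: "t \<in> E" and ut: "u t \<in> ball 0 1"
    and u: "(u has_vector_derivative u') (at t within E)"
    and q: "((\<lambda>s. F s (u t)) has_vector_derivative q) (at t within E)"
  shows "((\<lambda>s. F s (u s)) has_vector_derivative deriv (F t) (u t) * u' + q) (at t within E)"
  unfolding has_vector_derivative_complex_quotient_iff
proof -
  have "(u \<longlongrightarrow> u t) (at t within E)"
    using has_vector_derivative_continuous[OF u] by (simp add: continuous_within)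
  then have dd: "((\<lambda>s. divided_difference (F s) (u s) (u t)) \<longlongrightarrow> deriv (F t) (u t)) (at t within E)"
    by (intro divided_difference_tendsto[OF F hol t ut]) (auto simp: eventually_at_filter tendsto_ident_at)
  have "((\<lambda>s. divided_difference (F s) (u s) (u t) * ((u s - u t) / complex_of_real (s - t))
       + (F s (u t) - F t (u t)) / complex_of_real (s - t)) \<longlongrightarrow> deriv (F t) (u t) * u' + q) (at t within E)"
    using u q unfolding has_vector_derivative_complex_quotient_iff by (intro tendsto_intros dd)
  moreover have "divided_difference (F s) (u s) (u t) * ((u s - u t) / complex_of_real (s - t))
       + (F s (u t) - F t (u t)) / complex_of_real (s - t) = (F s (u s) - F t (u t)) / complex_of_real (s - t)" for s
    using divided_difference_mult[of "u s" "u t" "F s"] by (simp add: add_divide_distrib[symmetric] mult.commute)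
  ultimately show "((\<lambda>s. (F s (u s) - F t (u t)) / complex_of_real (s - t)) \<longlongrightarrow> deriv (F t) (u t) * u' + q) (at t within E)"
    by simp
qed

lemma abs_continuous_along_curve:
  assumes F: "continuous_on ({a..b} \<times> unit_disc) (\<lambda>(t, z). F t z)"
    and hol: "\<And>t. t \<in> {a..b} \<Longrightarrow> F t holomorphic_on unit_disc"
    and u: "abs_continuous_on_interval a b u" "u ` {a..b} \<subseteq> unit_disc"
    and k: "k integrable_on {a..b}" "\<And>x. x \<in> {a..b} \<Longrightarrow> 0 \<le> k x"
    and dom: "\<And>z s t. z \<in> u ` {a..b} \<Longrightarrow> a \<le> s \<Longrightarrow> s \<le> t \<Longrightarrow> t \<le> b \<Longrightarrow> norm (F t z - F s z) \<le> integral {s..t} k"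
  shows "abs_continuous_on_interval a b (\<lambda>s. F s (u s))"
proof -
  have K: "compact (u ` {a..b})"
    by (rule compact_continuous_image[OF abs_continuous_imp_continuous_on[OF u(1)]]) simp
  obtain M where M: "0 < M" "\<And>t x y. t \<in> {a..b} \<Longrightarrow> x \<in> u ` {a..b} \<Longrightarrow> y \<in> u ` {a..b} \<Longrightarrow> norm (divided_difference (F t) x y) \<le> M"
    by (rule divided_difference_bounded[OF F hol compact_Icc order_refl K u(2)]) blast+
  define q where "q t = complex_of_real (integral {a..t} k)" for t
  have qd: "norm (q t - q s) = integral {s..t} k" if "a \<le> s" "s \<le> t" "t \<le> b" for s t
  proof -
    have "q t - q s = complex_of_real (integral {s..t} k)"
      unfolding q_def using integral_Icc_diff[OF k(1) that] by (simp flip: of_real_diff)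
    moreover have "0 \<le> integral {s..t} k"
      by (rule integral_nonneg) (use k integrable_on_subinterval[OF k(1)] that in auto)
    ultimately show ?thesis by simp
  qed
  have q: "abs_continuous_on_interval a b q"
    by (rule abs_continuous_if_integral_dominated[OF k]) (simp_all add: qd)
  show ?thesis
  proof (rule abs_continuous_combine[OF u(1) q less_imp_le[OF M(1)]])
    fix s t assume st: "a \<le> s" "s \<le> t" "t \<le> b"
    then have mem: "s \<in> {a..b}" "t \<in> {a..b}" "u s \<in> u ` {a..b}" "u t \<in> u ` {a..b}" by auto
    have "F t (u t) - F s (u s) = (u t - u s) * divided_difference (F t) (u t) (u s) + (F t (u s) - F s (u s))"
      by (simp add: divided_difference_mult)
    also have "norm \<dots> \<le> norm (u t - u s) * norm (divided_difference (F t) (u t) (u s)) + norm (F t (u s) - F s (u s))"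
      by (metis norm_mult norm_triangle_ineq)
    also have "\<dots> \<le> norm (u t - u s) * M + norm (q t - q s)"
      using M(2)[OF mem(2,4,3)] dom[OF mem(3) st] qd[OF st] by (intro add_mono mult_left_mono) auto
    finally show "norm (F t (u t) - F s (u s)) \<le> M * norm (u t - u s) + norm (q t - q s)" by (simp add: mult.commute)
  qed
qed

text \<open>
Hurwitz' theorem for a continuous family: on a small circle around \<open>w\<close> the values of \<open>F s - z s\<close> stay away from zero,
while at the centre they are smaller, so the minimum principle produces a zero inside.
\<close>

lemma solution_of_nearby_equation:
  fixes F :: "real \<Rightarrow> complex \<Rightarrow> complex"
  assumes F: "continuous_on (E \<times> ball 0 1) (\<lambda>(t, z). F t z)"
    and hol: "\<And>t. t \<in> E \<Longrightarrow> F t holomorphic_on ball 0 1"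
    and inj: "inj_on (F t) (ball 0 1)" and t: "t \<in> E" and w: "w \<in> ball 0 1"
    and z: "(z \<longlongrightarrow> F t w) (at t within E)" and e: "0 < e"
  shows "\<forall>\<^sub>F s in at t within E. \<exists>v\<in>ball 0 1. dist w v < e \<and> F s v = z s"
proof -
  obtain r where r: "0 < r" "r < e" "cball w r \<subseteq> ball 0 1"
  proof -
    obtain r0 where "r0 > 0" "cball w r0 \<subseteq> ball 0 1" using w open_contains_cball[of "ball (0::complex) 1"] open_ball by blast
    then show ?thesis using e by (intro that[of "min r0 (e/2)"]) auto
  qed
  have contF: "continuous_on (cball w r) (F s)" if "s \<in> E" for s
    using holomorphic_on_imp_continuous_on[OF hol[OF that]] r(3) continuous_on_subset by blast
  have "\<exists>m>0. \<forall>v\<in>sphere w r. m \<le> norm (F t v - F t w)"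
  proof -
    have "continuous_on (sphere w r) (\<lambda>v. norm (F t v - F t w))"
      using contF[OF t] by (intro continuous_intros) (auto intro: continuous_on_subset)
    then obtain v0 where v0: "v0 \<in> sphere w r" "\<And>v. v \<in> sphere w r \<Longrightarrow> norm (F t v0 - F t w) \<le> norm (F t v - F t w)"
      using continuous_attains_inf[of "sphere w r" "\<lambda>v. norm (F t v - F t w)"] r by auto
    have "v0 \<noteq> w" using v0(1) r by auto
    moreover have "v0 \<in> ball 0 1" using v0(1) r(3) by auto
    ultimately have "F t v0 \<noteq> F t w" using inj w by (auto simp: inj_on_def)
    then show ?thesis using v0 by (intro exI[of _ "norm (F t v0 - F t w)"]) auto
  qed
  then obtain m where m: "m > 0" "\<And>v. v \<in> sphere w r \<Longrightarrow> m \<le> norm (F t v - F t w)" by blast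
  (* with the error m/5 the centre value is below 2m/5 and the values on the circle are at least 3m/5 *)
  obtain X0 where X0: "t \<in> X0" "open X0" "\<forall>s\<in>X0 \<inter> E. \<forall>v\<in>cball w r. dist (F s v) (F t v) \<le> m/5"
  proof -
    have c: "continuous_on (E \<times> cball w r) (\<lambda>(t, z). F t z)" by (rule continuous_on_subset[OF F]) (use r in auto)
    show ?thesis
      by (rule continuous_on_prod_compactE[OF c compact_cball t, of "m/5"]) (use m that in auto)
  qed
  have "\<forall>\<^sub>F s in at t within E. s \<in> X0 \<and> s \<in> E"
    using X0 by (auto simp: eventually_at_topological)
  moreover have "\<forall>\<^sub>F s in at t within E. dist (z s) (F t w) < m/5"
    using z m by (intro tendstoD) auto
  ultimately show ?thesis
  proof eventually_elim
    case (elim s)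
    have near: "norm (F s v - F t v) \<le> m/5" if "v \<in> cball w r" for v using X0(3) elim that by (auto simp: dist_norm)
    have zs: "norm (z s - F t w) < m/5" using elim by (simp add: dist_norm)
    have w1: "norm (F s w - z s) < 2*m/5"
      using near[of w] zs norm_triangle_ineq4[of "F s w - F t w" "z s - F t w"] r by (auto simp: algebra_simps)
    obtain v where "v \<in> ball w r" "F s v - z s = 0"
    proof (rule holomorphic_contract_to_zero[of w r "\<lambda>v. F s v - z s"])
      show "continuous_on (cball w r) (\<lambda>v. F s v - z s)" using contF elim by (intro continuous_intros) auto
      show "(\<lambda>v. F s v - z s) holomorphic_on ball w r"
        using holomorphic_on_subset[OF hol[of s], of "ball w r"] elim r(3) ball_subset_cball[of w r]
        by (intro holomorphic_intros) blast
      fix v assume v: "norm (w - v) = r"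
      then have "v \<in> sphere w r" by (simp add: dist_norm)
      then have "m \<le> norm (F t v - F t w)" by (rule m)
      also have "F t v - F t w = (F s v - z s) - (F s v - F t v) + (z s - F t w)" by simp
      also have "norm \<dots> \<le> norm (F s v - z s) + norm (F s v - F t v) + norm (z s - F t w)"
        using norm_triangle_ineq4[of "F s v - z s" "F s v - F t v"]
          norm_triangle_ineq[of "(F s v - z s) - (F s v - F t v)" "z s - F t w"] by linarith
      also have "\<dots> \<le> norm (F s v - z s) + m/5 + m/5" using near[of v] zs v by (simp add: dist_norm)
      finally show "norm (F s w - z s) < norm (F s v - z s)" using w1 m by linarith
    qed (use r in auto)
    moreover from this have "v \<in> unit_disc" using r(3) ball_subset_cball by blast
    ultimately show ?case using r by (intro bexI[of _ v]) auto
  qed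
qed

section \<open>Holomorphic families dominated by an integral\<close>

text \<open>
The regularity condition of a decreasing Loewner chain with an integrable dominating function, for an arbitrary family; solutions of the Loewner-Kufarev
equation satisfy it as well.
\<close>

definition integrally_dominated :: "real \<Rightarrow> (real \<Rightarrow> complex \<Rightarrow> complex) \<Rightarrow> bool" where
  "integrally_dominated T F \<longleftrightarrow>
     (\<forall>K. compact K \<and> K \<subseteq> unit_disc \<longrightarrow>
        (\<exists>k. k integrable_on {0..T} \<and> (\<forall>x\<in>{0..T}. 0 \<le> k x) \<and>
             (\<forall>z\<in>K. \<forall>u v. 0 \<le> u \<and> u \<le> v \<and> v \<le> T \<longrightarrow> norm (F v z - F u z) \<le> integral {u..v} k)))"

lemma holomorphic_bounded_Lipschitz:
  assumes q: "q holomorphic_on S" "cball z0 (2 * r) \<subseteq> S" "0 < r"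
    and B: "\<And>z. z \<in> cball z0 (2 * r) \<Longrightarrow> norm (q z) \<le> B"
    and z: "z \<in> cball z0 r"
  shows "norm (q z - q z0) \<le> B / r * norm (z - z0)"
proof (rule field_differentiable_bound[of "cball z0 r" q "deriv q"])
  have cont: "continuous_on (cball z0 (2*r)) q"
    using q holomorphic_on_imp_continuous_on continuous_on_subset by blast
  have hol: "q holomorphic_on ball z0 (2*r)" using q holomorphic_on_subset ball_subset_cball by blast
  fix x assume x: "x \<in> cball z0 r"
  have sub: "cball x r \<subseteq> cball z0 (2*r)"
  proof
    fix y assume "y \<in> cball x r"
    then show "y \<in> cball z0 (2*r)" using x dist_triangle[of z0 y x] by (auto simp: dist_commute)
  qed
  have sub': "ball x r \<subseteq> ball z0 (2*r)"
  proof
    fix y assume "y \<in> ball x r"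
    then show "y \<in> ball z0 (2*r)" using x dist_triangle[of z0 y x] by (auto simp: dist_commute)
  qed
  have "x \<in> ball z0 (2*r)" using x q(3) by auto
  then show "(q has_field_derivative deriv q x) (at x within cball z0 r)"
    by (rule holomorphic_derivI[OF hol open_ball])
  have "norm ((deriv ^^ 1) q x) \<le> fact 1 * B / r ^ 1"
  proof (rule Cauchy_inequality)
    show "q holomorphic_on ball x r" "continuous_on (cball x r) q"
      using sub sub' hol cont holomorphic_on_subset continuous_on_subset by blast+
    show "norm (q y) \<le> B" if "norm (x - y) = r" for y
    proof -
      have "y \<in> cball x r" using that by (simp add: dist_norm)
      then show ?thesis using sub B by blast
    qed
  qed (fact q(3))
  then show "norm (deriv q x) \<le> B / r" by simp
qed (use z q(3) in auto)

text \<open>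
The null set collects the bad times of the dominating integrals over an exhaustion by compact discs and those of the
functions \<open>t \<mapsto> F t a\<close> for \<open>a\<close> in a countable dense set. At any other time the difference quotients are locally bounded,
hence locally equi-Lipschitz, and converge on the dense set. Montel's theorem provides a holomorphic limit along a
sequence, and equicontinuity shows that it is the limit at every point.
\<close>

lemma dominated_holomorphic_family_differentiable_ae:
  assumes T: "0 < T" and hol: "\<And>t. 0 \<le> t \<Longrightarrow> t \<le> T \<Longrightarrow> F t holomorphic_on unit_disc"
    and dom: "integrally_dominated T F"
  obtains N where "negligible N"
    "\<And>t. t \<in> {0<..<T} - N \<Longrightarrow> \<exists>q. q holomorphic_on unit_disc \<and>
        (\<forall>z\<in>unit_disc. ((\<lambda>s. F s z) has_vector_derivative q z) (at t))"
proof -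
  (* an exhaustion of the disc by compact discs *)
  define K where "K n = cball (0::complex) (real n / (real n + 1))" for n :: nat
  have Kc: "compact (K n)" "K n \<subseteq> unit_disc" for n
  proof -
    show "compact (K n)" unfolding K_def by (rule compact_cball)
    have n: "real n / (real n + 1) < 1" by simp
    show "K n \<subseteq> unit_disc"
    proof
      fix z assume "z \<in> K n"
      then have "norm z \<le> real n / (real n + 1)" by (simp add: K_def)
      with n have "norm z < 1" by linarith
      then show "z \<in> unit_disc" by simp
    qed
  qed
  then have "\<exists>k. k integrable_on {0..T} \<and> (\<forall>x\<in>{0..T}. 0 \<le> k x) \<and>
             (\<forall>z\<in>K n. \<forall>u v. 0 \<le> u \<and> u \<le> v \<and> v \<le> T \<longrightarrow> norm (F v z - F u z) \<le> integral {u..v} k)" for n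
    using dom[unfolded integrally_dominated_def, rule_format, OF conjI, of "K n"] by blast
  then obtain k where k: "\<And>n. k n integrable_on {0..T}" "\<And>n x. x \<in> {0..T} \<Longrightarrow> 0 \<le> k n x"
    "\<And>n. \<forall>z\<in>K n. \<forall>u v. 0 \<le> u \<and> u \<le> v \<and> v \<le> T \<longrightarrow> norm (F v z - F u z) \<le> integral {u..v} (k n)"
    by metis
  have kF: "norm (F v z - F u z) \<le> integral {u..v} (k n)" if "z \<in> K n" "0 \<le> u" "u \<le> v" "v \<le> T" for n z u v
    by (rule k(3)[rule_format, of z n]) (use that in simp_all)
  have Kex: "\<exists>n. r \<le> real n / (real n + 1)" if "r < 1" for r :: real
  proof -
    obtain n where "r / (1 - r) < real n" using reals_Archimedean2 by blast
    then have "r < real n * (1 - r)" using that by (simp add: pos_divide_less_eq)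
    then have "r * (real n + 1) \<le> real n" by (simp add: distrib_left right_diff_distrib mult.commute)
    then have "r \<le> real n / (real n + 1)" by (subst pos_le_divide_eq) auto
    then show ?thesis by (rule exI)
  qed
  define DN where "DN n N \<longleftrightarrow> negligible N \<and> (\<forall>x H. x \<in> {0<..<T} - N \<longrightarrow> (\<forall>u v. 0 \<le> u \<longrightarrow> u \<le> v \<longrightarrow> v \<le> T \<longrightarrow> H v - H u = integral {u..v} (k n))
       \<longrightarrow> (H has_real_derivative k n x) (at x))" for n N
  have "\<exists>N. DN n N" for n
    by (rule indefinite_integral_DERIV_ae[OF k(1)[of n]]) (unfold DN_def, blast)
  then obtain N1 where DN: "\<And>n. DN n (N1 n)" by metis
  have N1: "negligible (N1 n)" for n using DN[of n] by (simp add: DN_def)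
  have N1d: "(H has_real_derivative k n x) (at x)"
    if "x \<in> {0<..<T} - N1 n" "\<And>u v. 0 \<le> u \<Longrightarrow> u \<le> v \<Longrightarrow> v \<le> T \<Longrightarrow> H v - H u = integral {u..v} (k n)" for n x H
    using DN[of n, unfolded DN_def, THEN conjunct2, rule_format, OF that(1), of H] that(2) by simp
  obtain D0 :: "complex set" where D0: "countable D0" "\<And>X. open X \<Longrightarrow> X \<noteq> {} \<Longrightarrow> \<exists>d\<in>D0. d \<in> X"
    by (rule countable_dense_setE) blast
  define A where "A = D0 \<inter> unit_disc"
  have A: "countable A" "A \<subseteq> unit_disc" using D0 by (auto simp: A_def)
  have "\<exists>N. negligible N \<and> (\<forall>x\<in>{0<..<T} - N. \<exists>D. ((\<lambda>s. F s a) has_vector_derivative D) (at x))" if a: "a \<in> A" for a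
  proof -
    have "a \<in> unit_disc" using a A(2) by blast
    then obtain n where "norm a \<le> real n / (real n + 1)" using Kex[of "norm a"] by auto
    then have "a \<in> K n" by (simp add: K_def)
    then have kd: "norm (F v a - F u a) \<le> integral {u..v} (k n)" if "0 \<le> u" "u \<le> v" "v \<le> T" for u v
      by (rule kF) (use that in simp_all)
    obtain N where "negligible N" "\<And>x. x \<in> {0<..<T} - N \<Longrightarrow> \<exists>D. ((\<lambda>s. F s a) has_vector_derivative D) (at x)"
    proof (rule integral_dominated_vector_differentiable_ae[OF k(1) k(2) kd])
      fix N assume a: "negligible N" "\<And>x. x \<in> {0<..<T} - N \<Longrightarrow> \<exists>D. ((\<lambda>s. F s a) has_vector_derivative D) (at x)"
      show thesis by (rule that[OF a])
    qed
    then show ?thesis by (intro exI[of _ N]) simp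
  qed
  then obtain N2 where N2: "\<And>a. a \<in> A \<Longrightarrow> negligible (N2 a)"
    "\<And>a x. a \<in> A \<Longrightarrow> x \<in> {0<..<T} - N2 a \<Longrightarrow> \<exists>D. ((\<lambda>s. F s a) has_vector_derivative D) (at x)"
    by metis
  define N where "N = (\<Union>n. N1 n) \<union> (\<Union>a\<in>A. N2 a)"
  have "negligible (\<Union>n. N1 n)" using N1 negligible_countable_Union[of "range N1"] by auto
  moreover have "negligible (\<Union>a\<in>A. N2 a)" using N2(1) A negligible_countable_Union[of "N2 ` A"] by auto
  ultimately have negN: "negligible N" by (simp add: N_def)
  show ?thesis
  proof (rule that[OF negN])
    fix t assume t: "t \<in> {0<..<T} - N"
    define q where "q s z = (F s z - F t z) / complex_of_real (s - t)" for s z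
    define H where "H n s = integral {0..s} (k n)" for n s
    have Hd: "H n v - H n u = integral {u..v} (k n)" if "0 \<le> u" "u \<le> v" "v \<le> T" for n u v
      unfolding H_def by (rule integral_Icc_diff[OF k(1) that])
    have "(H n has_real_derivative k n t) (at t)" for n
      by (rule N1d) (use t Hd in \<open>simp_all add: N_def\<close>)
    then have Hq: "((\<lambda>s. (H n s - H n t) / (s - t)) \<longlongrightarrow> k n t) (at t)" for n
      by (simp add: has_field_derivative_iff)
    have qH: "norm (q s z) \<le> (H n s - H n t) / (s - t)" if "z \<in> K n" "0 \<le> s" "s \<le> T" for s z n
    proof (cases "t \<le> s")
      case True
      have "norm (q s z) = norm (F s z - F t z) / (s - t)" using True by (simp add: q_def norm_divide del: of_real_diff)
      also have "\<dots> \<le> (H n s - H n t) / (s - t)"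
        using kF[OF that(1), of t s] Hd[of t s n] True that t by (intro divide_right_mono) auto
      finally show ?thesis .
    next
      case False
      have "norm (q s z) = norm (F s z - F t z) / (t - s)" using False by (simp add: q_def norm_divide norm_minus_commute del: of_real_diff)
      also have "\<dots> \<le> (H n t - H n s) / (t - s)"
        using kF[OF that(1), of s t] Hd[of s t n] False that t by (intro divide_right_mono) (auto simp: norm_minus_commute)
      also have "\<dots> = (H n s - H n t) / (s - t)" using False by (simp add: divide_simps) (simp add: algebra_simps)
      finally show ?thesis .
    qed
    have evT: "\<forall>\<^sub>F s in at t. 0 \<le> s \<and> s \<le> T \<and> s \<noteq> t"
    proof -
      have "\<forall>\<^sub>F s in at t. s \<in> {0<..<T}" using t by (intro eventually_at_in_open') auto
      then show ?thesis by (auto simp: eventually_at_filter elim: eventually_mono)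
    qed
    have holq: "q s holomorphic_on unit_disc" if "0 \<le> s" "s \<le> T" "s \<noteq> t" for s
      unfolding q_def using hol that t by (intro holomorphic_intros) auto
    (* some sequence of admissible times different from t that tends to t, as required by Montel's theorem *)
    define sq where "sq j = t + (T - t) / (real j + 2)" for j :: nat
    have sqb: "0 \<le> sq j" "sq j \<le> T" "sq j \<noteq> t" for j
    proof -
      have p: "0 < (T - t) / (real j + 2)" using t by simp
      have "(T - t) / (real j + 2) \<le> (T - t) / 1" using t by (intro divide_left_mono) auto
      with p t show "0 \<le> sq j" "sq j \<le> T" "sq j \<noteq> t" by (auto simp: sq_def)
    qed
    have sqlim: "filterlim sq (at t) sequentially"
    proof (rule filterlim_atI)
      have "(\<lambda>j. (T - t) / real (j + 2)) \<longlonglongrightarrow> 0"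
        by (rule LIMSEQ_ignore_initial_segment[OF lim_const_over_n])
      from tendsto_add[OF tendsto_const this, of t]
      have "(\<lambda>j. t + (T - t) / (real j + 2)) \<longlonglongrightarrow> t" by (simp add: add.commute)
      then show "sq \<longlonglongrightarrow> t" unfolding sq_def .
    qed (use sqb in auto)
    have "\<exists>B. \<forall>h\<in>range (\<lambda>j. q (sq j)). \<forall>z\<in>C. norm (h z) \<le> B" if C: "compact C" "C \<subseteq> unit_disc" for C
    proof -
      have "\<exists>r<1. C \<subseteq> cball 0 r"
      proof (cases "C = {}")
        case False
        then obtain z where "z \<in> C" "\<And>y. y \<in> C \<Longrightarrow> norm y \<le> norm z"
          using continuous_attains_sup[OF C(1) False, of norm] by (auto intro: continuous_intros)
        then show ?thesis using C(2) by (intro exI[of _ "norm z"]) auto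
      qed (auto intro: exI[of _ 0])
      then obtain r n where "C \<subseteq> cball 0 r" "r \<le> real n / (real n + 1)" using Kex by blast
      then have CK: "C \<subseteq> K n" by (auto simp: K_def)
      have "(\<lambda>j. (H n (sq j) - H n t) / (sq j - t)) \<longlonglongrightarrow> k n t"
        by (rule filterlim_compose[OF Hq sqlim])
      then have "Bseq (\<lambda>j. (H n (sq j) - H n t) / (sq j - t))"
        by (rule convergent_imp_Bseq[OF convergentI])
      then obtain B where B: "\<And>j. norm ((H n (sq j) - H n t) / (sq j - t)) \<le> B" unfolding Bseq_def by blast
      have "norm (q (sq j) z) \<le> B" if "z \<in> C" for j z
      proof -
        have "norm (q (sq j) z) \<le> (H n (sq j) - H n t) / (sq j - t)"
          by (rule qH) (use CK that sqb in auto)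
        also have "\<dots> \<le> norm ((H n (sq j) - H n t) / (sq j - t))" by (simp only: real_norm_def abs_ge_self)
        also have "\<dots> \<le> B" by (rule B)
        finally show ?thesis .
      qed
      then show ?thesis by blast
    qed
    note bdd = this
    have hq: "h holomorphic_on unit_disc" if "h \<in> range (\<lambda>j. q (sq j))" for h
      using that holq[OF sqb] by auto
    obtain g r where g: "g holomorphic_on unit_disc" "strict_mono (r :: nat \<Rightarrow> nat)"
          "\<And>x. x \<in> unit_disc \<Longrightarrow> ((\<lambda>n. q (sq (r n)) x) \<longlonglongrightarrow> g x)"
      by (rule Montel[OF open_ball hq bdd order_refl]) (assumption | rule that)+
    have qA: "((\<lambda>s. q s a) \<longlongrightarrow> g a) (at t)" if a: "a \<in> A" for a
    proof -
      obtain D where D: "((\<lambda>s. q s a) \<longlongrightarrow> D) (at t)"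
        using N2(2)[OF a, of t] t a unfolding N_def has_vector_derivative_complex_quotient_iff q_def by auto
      have "(\<lambda>n. q (sq (r n)) a) \<longlonglongrightarrow> D"
        by (rule filterlim_compose[OF D], rule filterlim_compose[OF sqlim filterlim_subseq[OF g(2)]])
      then have "D = g a" using g(3)[of a] a A LIMSEQ_unique by blast
      then show ?thesis using D by simp
    qed
    have "((\<lambda>s. q s z) \<longlongrightarrow> g z) (at t)" if z: "z \<in> unit_disc" for z
    proof (rule tendstoI)
      fix e :: real assume e: "0 < e"
      define \<rho> where "\<rho> = (1 - norm z) / 4"
      have \<rho>: "0 < \<rho>" "norm z + 2 * \<rho> < 1"
      proof -
        have "norm z < 1" using z by simp
        then show "0 < \<rho>" "norm z + 2 * \<rho> < 1" unfolding \<rho>_def by (simp_all add: field_simps)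
      qed
      obtain n where n: "norm z + 2 * \<rho> \<le> real n / (real n + 1)" using Kex[OF \<rho>(2)] by blast
      have sub: "cball z (2 * \<rho>) \<subseteq> K n"
      proof
        fix y assume "y \<in> cball z (2*\<rho>)"
        then show "y \<in> K n" using n norm_triangle_ineq2[of y z] by (auto simp: K_def dist_norm norm_minus_commute)
      qed
      define B where "B = \<bar>k n t\<bar> + 1"
      have B: "B > 0" by (simp add: B_def)
      have "\<forall>\<^sub>F s in at t. (H n s - H n t) / (s - t) < B"
        by (rule order_tendstoD(2)[OF Hq]) (simp add: B_def)
      with evT have bd: "\<forall>\<^sub>F s in at t. q s holomorphic_on unit_disc \<and> (\<forall>y\<in>cball z (2*\<rho>). norm (q s y) \<le> B)"
      proof eventually_elim
        case (elim s)
        then show ?case using holq[of s] qH[of _ n s] sub by fastforce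
      qed
      obtain \<eta> where \<eta>: "\<eta> > 0" "\<And>y. y \<in> unit_disc \<Longrightarrow> dist y z < \<eta> \<Longrightarrow> dist (g y) (g z) < e/3"
        using holomorphic_on_imp_continuous_on[OF g(1)] z e unfolding continuous_on_iff by (metis zero_less_divide_iff zero_less_numeral)
      define \<delta> where "\<delta> = min (min \<eta> \<rho>) (e * \<rho> / (3 * B))"
      have \<delta>: "\<delta> > 0" using \<eta> \<rho> e B by (simp add: \<delta>_def)
      have "z \<in> ball z \<delta> \<inter> unit_disc" using z \<delta> by simp
      then have "ball z \<delta> \<inter> unit_disc \<noteq> {}" by blast
      then obtain a where a: "a \<in> D0" "a \<in> ball z \<delta>" "a \<in> unit_disc" using D0(2)[of "ball z \<delta> \<inter> unit_disc"] by auto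
      then have aA: "a \<in> A" by (simp add: A_def)
      have d: "norm (a - z) < \<eta>" "norm (a - z) < \<rho>" "norm (a - z) < e * \<rho> / (3 * B)"
        using a(2) by (auto simp: \<delta>_def dist_norm norm_minus_commute)
      have "\<forall>\<^sub>F s in at t. dist (q s a) (g a) < e/3" using qA[OF aA] e by (intro tendstoD) auto
      with bd show "\<forall>\<^sub>F s in at t. dist (q s z) (g z) < e"
      proof eventually_elim
        case (elim s)
        have "norm (q s a - q s z) \<le> B / \<rho> * norm (a - z)"
          by (rule holomorphic_bounded_Lipschitz[where S=unit_disc]) (use elim sub Kc(2)[of n] \<rho> d in \<open>auto simp: dist_norm norm_minus_commute\<close>)
        also have "\<dots> \<le> B / \<rho> * (e * \<rho> / (3 * B))" using d(3) B \<rho> by (intro mult_left_mono) auto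
        also have "\<dots> = e/3" using B \<rho> by (simp add: field_simps)
        finally have "dist (q s z) (q s a) \<le> e/3" by (simp add: dist_norm norm_minus_commute)
        moreover have "dist (g a) (g z) < e/3" using \<eta>(2)[of a] a(3) d(1) by (simp add: dist_norm)
        ultimately show ?case
          using elim dist_triangle[of "q s z" "g z" "q s a"] dist_triangle[of "q s a" "g z" "g a"] by linarith
      qed
    qed
    then show "\<exists>q. q holomorphic_on unit_disc \<and> (\<forall>z\<in>unit_disc. ((\<lambda>s. F s z) has_vector_derivative q z) (at t))"
      using g(1) unfolding has_vector_derivative_complex_quotient_iff q_def by (intro exI[of _ g]) auto
  qed
qed

text \<open>
Lets a relation that holds at each point for almost every time be upgraded to one that holds for almost every time
at all points.
\<close>

lemma countable_determining_set:
  "\<exists>A. countable A \<and> A \<subseteq> unit_disc \<and> (\<forall>p q. p holomorphic_on unit_disc \<longrightarrow> q holomorphic_on unit_disc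
      \<longrightarrow> (\<forall>a\<in>A. p a = q a) \<longrightarrow> (\<forall>z\<in>unit_disc. p z = q z))"
proof -
  obtain D0 :: "complex set" where D0: "countable D0" "\<And>X. open X \<Longrightarrow> X \<noteq> {} \<Longrightarrow> \<exists>d\<in>D0. d \<in> X"
    by (rule countable_dense_setE) blast
  show ?thesis
  proof (intro exI[of _ "D0 \<inter> unit_disc"] conjI allI impI ballI)
    fix p q :: "complex \<Rightarrow> complex" and z
    assume pq: "p holomorphic_on unit_disc" "q holomorphic_on unit_disc" and eq: "\<forall>a\<in>D0 \<inter> unit_disc. p a = q a" and z: "z \<in> unit_disc"
    show "p z = q z"
    proof (rule ccontr)
      assume ne: "p z \<noteq> q z"
      have "continuous_on unit_disc (\<lambda>w. p w - q w)"
        using pq by (intro continuous_intros holomorphic_on_imp_continuous_on)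
      then have "open ((\<lambda>w. p w - q w) -` (- {0}) \<inter> unit_disc)"
        by (intro continuous_on_open_vimage[OF open_ball, THEN iffD1, rule_format]) auto
      moreover have "z \<in> (\<lambda>w. p w - q w) -` (- {0}) \<inter> unit_disc" using ne z by simp
      ultimately obtain a where "a \<in> D0" "a \<in> (\<lambda>w. p w - q w) -` (- {0}) \<inter> unit_disc" using D0(2) by blast
      then have "a \<in> D0 \<inter> unit_disc" "p a \<noteq> q a" by auto
      then show False using eq by blast
    qed
  qed (use D0(1) in auto)
qed

section \<open>Infinitesimal generators from limits of self-maps of the disc\<close>

text \<open>
The Schwarz lemma applied to \<open>\<phi>\<close> followed by the disc automorphism that sends \<open>\<phi> 0\<close> to \<open>0\<close>.
\<close>

lemma disc_self_map_displacement:
  assumes hol: "\<phi> holomorphic_on ball 0 1" and im: "\<phi> ` ball 0 1 \<subseteq> ball 0 1" and z: "z \<in> ball 0 1"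
  shows "norm (\<phi> z - \<phi> 0) \<le> norm z * norm (1 - cnj (\<phi> 0) * \<phi> z)"
proof -
  have lt: "norm (\<phi> w) < 1" if "norm w < 1" for w
    using im that by (auto simp: image_subset_iff)
  have a: "norm (\<phi> 0) < 1" by (rule lt) simp
  let ?\<psi> = "\<lambda>w. Moebius_function 0 (\<phi> 0) (\<phi> w)"
  have "(Moebius_function 0 (\<phi> 0) \<circ> \<phi>) holomorphic_on ball 0 1"
    by (rule holomorphic_on_compose_gen[OF hol Moebius_function_holomorphic[OF a] im])
  then have "norm (?\<psi> z) \<le> norm z"
    using z lt a by (intro Schwarz_Lemma(1)) (auto simp: o_def Moebius_function_norm_lt_1 Moebius_function_eq_zero)
  then have "norm (\<phi> z - \<phi> 0) / norm (1 - cnj (\<phi> 0) * \<phi> z) \<le> norm z"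
    by (simp add: Moebius_function_def norm_divide norm_mult)
  moreover have "1 - cnj (\<phi> 0) * \<phi> z \<noteq> 0"
  proof
    assume "1 - cnj (\<phi> 0) * \<phi> z = 0"
    then have "norm (cnj (\<phi> 0) * \<phi> z) = 1" by (metis eq_iff_diff_eq_0 norm_one)
    moreover have "norm (\<phi> 0) * norm (\<phi> z) < 1 * 1"
      using a lt[of z] z by (intro mult_strict_mono) auto
    ultimately show False by (simp add: norm_mult)
  qed
  ultimately show ?thesis by (simp add: pos_divide_le_eq)
qed

lemma norm_add_power2: "(norm (a + b :: complex))\<^sup>2 = (norm a)\<^sup>2 + 2 * Re (cnj a * b) + (norm b)\<^sup>2"
  unfolding cmod_power2 by (simp add: power2_eq_square algebra_simps)

text \<open>
The infinitesimal Schwarz-Pick inequality: square the previous estimate for \<open>\<phi> = id + h q\<close>, cancel \<open>|z|\<^sup>2\<close>,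
divide by \<open>h\<close> and let \<open>h\<close> tend to zero.
\<close>

lemma disc_generator_inequality:
  assumes hol: "\<And>n. \<phi> n holomorphic_on unit_disc" and im: "\<And>n. \<phi> n ` unit_disc \<subseteq> unit_disc"
    and h: "\<And>n. 0 < h n" "h \<longlonglongrightarrow> 0"
    and H: "\<And>z. z \<in> unit_disc \<Longrightarrow> (\<lambda>n. (\<phi> n z - z) / complex_of_real (h n)) \<longlonglongrightarrow> H z"
    and z: "z \<in> unit_disc"
  shows "Re (cnj z * H z) \<le> (1 - (norm z)\<^sup>2) * Re (cnj z * H 0)"
proof -
  define q where "q n = (\<phi> n z - z) / complex_of_real (h n)" for n
  define p where "p n = (\<phi> n 0 - 0) / complex_of_real (h n)" for n
  have \<phi>z: "\<phi> n z = z + h n * q n" and \<phi>0: "\<phi> n 0 = h n * p n" for n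
    using h(1)[of n] by (auto simp: q_def p_def)
  have q: "q \<longlonglongrightarrow> H z" using H[OF z] unfolding q_def .
  have p: "p \<longlonglongrightarrow> H 0" using H[of 0] unfolding p_def by simp
  have hc: "(\<lambda>n. complex_of_real (h n)) \<longlonglongrightarrow> 0" using tendsto_of_real[OF h(2)] by simp
  have \<phi>l: "(\<lambda>n. \<phi> n z) \<longlonglongrightarrow> z" unfolding \<phi>z using tendsto_add[OF tendsto_const tendsto_mult[OF hc q], of z] by simp
  have le: "2 * Re (cnj z * (q n - p n)) + h n * (norm (q n - p n))\<^sup>2
      \<le> (norm z)\<^sup>2 * (- 2 * Re (cnj (p n) * \<phi> n z) + h n * (norm (cnj (p n) * \<phi> n z))\<^sup>2)" for n
  proof -
    let ?h = "h n"
    have e1: "\<phi> n z - \<phi> n 0 = z + ?h * (q n - p n)" unfolding \<phi>z \<phi>0 by (simp add: algebra_simps)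
    have e2: "1 - cnj (\<phi> n 0) * \<phi> n z = 1 + - (?h * (cnj (p n) * \<phi> n z))" unfolding \<phi>0 by simp
    have "norm (z + ?h * (q n - p n)) \<le> norm z * norm (1 + - (?h * (cnj (p n) * \<phi> n z)))"
      using disc_self_map_displacement[OF hol[of n] im[of n] z] unfolding e1 e2 .
    then have "(norm (z + ?h * (q n - p n)))\<^sup>2 \<le> (norm z * norm (1 + - (?h * (cnj (p n) * \<phi> n z))))\<^sup>2"
      by (rule power_mono) simp
    also have "\<dots> = (norm z)\<^sup>2 * (norm (1 + - (?h * (cnj (p n) * \<phi> n z))))\<^sup>2" by (rule power_mult_distrib)
    finally have "(norm z)\<^sup>2 + 2 * Re (cnj z * (?h * (q n - p n))) + (norm (?h * (q n - p n)))\<^sup>2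
       \<le> (norm z)\<^sup>2 * ((norm (1::complex))\<^sup>2 + 2 * Re (cnj 1 * - (?h * (cnj (p n) * \<phi> n z))) + (norm (- (?h * (cnj (p n) * \<phi> n z))))\<^sup>2)"
      unfolding norm_add_power2 .
    moreover have "Re (cnj z * (?h * (q n - p n))) = ?h * Re (cnj z * (q n - p n))"
      by (simp add: algebra_simps)
    moreover have "(norm (?h * (q n - p n)))\<^sup>2 = ?h * (?h * (norm (q n - p n))\<^sup>2)"
      by (simp add: norm_mult power_mult_distrib power2_eq_square)
    moreover have "Re (cnj 1 * - (?h * (cnj (p n) * \<phi> n z))) = - (?h * Re (cnj (p n) * \<phi> n z))"
      by (simp add: algebra_simps)
    moreover have "(norm (- (?h * (cnj (p n) * \<phi> n z))))\<^sup>2 = ?h * (?h * (norm (cnj (p n) * \<phi> n z))\<^sup>2)"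
      by (simp add: norm_mult power_mult_distrib power2_eq_square)
    ultimately have "?h * (2 * Re (cnj z * (q n - p n)) + h n * (norm (q n - p n))\<^sup>2)
      \<le> ?h * ((norm z)\<^sup>2 * (- 2 * Re (cnj (p n) * \<phi> n z) + h n * (norm (cnj (p n) * \<phi> n z))\<^sup>2))"
      by (simp add: algebra_simps)
    then show ?thesis using h(1)[of n] by (simp only: mult_le_cancel_left_pos)
  qed
  have l1: "(\<lambda>n. 2 * Re (cnj z * (q n - p n)) + h n * (norm (q n - p n))\<^sup>2)
      \<longlonglongrightarrow> 2 * Re (cnj z * (H z - H 0)) + 0 * (norm (H z - H 0))\<^sup>2"
    by (intro tendsto_intros q p h(2))
  have l2: "(\<lambda>n. (norm z)\<^sup>2 * (- 2 * Re (cnj (p n) * \<phi> n z) + h n * (norm (cnj (p n) * \<phi> n z))\<^sup>2))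
      \<longlonglongrightarrow> (norm z)\<^sup>2 * (- 2 * Re (cnj (H 0) * z) + 0 * (norm (cnj (H 0) * z))\<^sup>2)"
    by (intro tendsto_intros p h(2) \<phi>l)
  have "2 * Re (cnj z * (H z - H 0)) \<le> (norm z)\<^sup>2 * (- 2 * Re (cnj (H 0) * z))"
    using LIMSEQ_le[OF l1 l2] le by simp
  moreover have "Re (cnj (H 0) * z) = Re (cnj z * H 0)" by (simp add: algebra_simps)
  moreover have "Re (cnj z * (H z - H 0)) = Re (cnj z * H z) - Re (cnj z * H 0)" by (simp add: algebra_simps)
  ultimately show ?thesis by (simp add: algebra_simps)
qed

text \<open>
Picard iteration. Measured with the weight \<open>exp (2 * L * t)\<close> each step is a contraction by the factor \<open>1/2\<close>, whatever
the length of the time interval.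
\<close>

lemma Picard_Lindelof_global:
  fixes X :: "complex \<Rightarrow> complex"
  assumes L: "0 < L" "\<And>a b. norm (X a - X b) \<le> L * norm (a - b)" and T: "0 \<le> T"
  obtains u where "u 0 = z" "\<And>t. t \<in> {0..T} \<Longrightarrow> (u has_vector_derivative X (u t)) (at t within {0..T})"
proof -
  define P :: "nat \<Rightarrow> real \<Rightarrow> complex" where "P = rec_nat (\<lambda>t. z) (\<lambda>n p t. z + integral {0..t} (\<lambda>s. X (p s)))"
  have P0: "P 0 = (\<lambda>t. z)" and PS: "P (Suc n) = (\<lambda>t. z + integral {0..t} (\<lambda>s. X (P n s)))" for n
    by (simp_all add: P_def)
  have Xc: "continuous_on UNIV X"
  proof (rule continuous_onI)
    fix x and e :: real assume "0 < e"
    have "dist (X x') (X x) \<le> e" if "dist x' x < e / L" for x'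
      using L(2)[of x' x] that L(1) by (simp add: dist_norm pos_less_divide_eq mult.commute)
    then show "\<exists>d>0. \<forall>x'\<in>UNIV. dist x' x < d \<longrightarrow> dist (X x') (X x) \<le> e"
      using \<open>0 < e\<close> L(1) by (intro exI[of _ "e / L"]) auto
  qed
  have comp: "continuous_on {0..T} (\<lambda>s. X (g s))" if "continuous_on {0..T} g" for g
    using continuous_on_compose2[OF Xc that] by simp
  have Pc: "continuous_on {0..T} (P n)" for n
  proof (induction n)
    case 0 then show ?case by (simp add: P0)
  next
    case (Suc n)
    have "(\<lambda>s. X (P n s)) integrable_on {0..T}" by (rule integrable_continuous_interval[OF comp[OF Suc]])
    then show ?case unfolding PS by (intro continuous_intros indefinite_integral_continuous_1)
  qed
  have sub: "continuous_on {0..t} g" if "continuous_on {0..T} g" "t \<in> {0..T}" for g :: "real \<Rightarrow> complex" and t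
    by (rule continuous_on_subset[OF that(1)]) (use that in auto)
  define C where "C = norm (X z) * T"
  have C: "0 \<le> C" using T by (simp add: C_def)
  have bound: "norm (P (Suc n) t - P n t) \<le> C * (1/2)^n * exp (2 * L * t)" if t: "t \<in> {0..T}" for n t
    using t
  proof (induction n arbitrary: t)
    case 0
    have "norm (P (Suc 0) t - P 0 t) = t * norm (X z)" using 0 by (simp add: P0 PS)
    also have "\<dots> \<le> C * 1" using 0 by (simp add: C_def mult.commute[of _ T] mult_right_mono)
    also have "\<dots> \<le> C * exp (2 * L * t)" using 0 L C by (intro mult_left_mono) auto
    finally show ?case by simp
  next
    case (Suc n)
    have c1: "continuous_on {0..t} (\<lambda>s. X (P (Suc n) s))" and c2: "continuous_on {0..t} (\<lambda>s. X (P n s))"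
      using sub[OF comp[OF Pc] Suc.prems] by blast+
    have "P (Suc (Suc n)) t - P (Suc n) t = integral {0..t} (\<lambda>s. X (P (Suc n) s) - X (P n s))"
      unfolding PS[of "Suc n"] PS[of n]
      using integral_diff[OF integrable_continuous_interval[OF c1] integrable_continuous_interval[OF c2]]
      by (simp add: PS)
    also have "norm \<dots> \<le> integral {0..t} (\<lambda>s. L * (C * (1/2)^n * exp (2 * L * s)))"
    proof (rule integral_norm_bound_integral)
      show "(\<lambda>s. X (P (Suc n) s) - X (P n s)) integrable_on {0..t}"
        by (intro integrable_continuous_interval continuous_intros c1 c2)
      show "(\<lambda>s. L * (C * (1/2)^n * exp (2 * L * s))) integrable_on {0..t}"
        by (intro integrable_continuous_interval continuous_intros)
      fix s assume s: "s \<in> {0..t}"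
      have "norm (X (P (Suc n) s) - X (P n s)) \<le> L * norm (P (Suc n) s - P n s)" by (rule L(2))
      also have "\<dots> \<le> L * (C * (1/2)^n * exp (2 * L * s))"
        using Suc.IH[of s] s Suc.prems L(1) by (intro mult_left_mono) auto
      finally show "norm (X (P (Suc n) s) - X (P n s)) \<le> L * (C * (1/2)^n * exp (2 * L * s))" .
    qed
    also have "integral {0..t} (\<lambda>s. L * (C * (1/2)^n * exp (2 * L * s)))
        = C * (1/2)^(Suc n) * exp (2 * L * t) - C * (1/2)^(Suc n) * exp (2 * L * 0)"
    proof (rule integral_unique, rule fundamental_theorem_of_calculus)
      show "0 \<le> t" using Suc.prems by simp
      show "((\<lambda>s. C * (1/2)^(Suc n) * exp (2 * L * s)) has_vector_derivative L * (C * (1/2)^n * exp (2 * L * s))) (at s within {0..t})" for s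
        unfolding has_real_derivative_iff_has_vector_derivative[symmetric]
        by (auto intro!: derivative_eq_intros)
    qed
    also have "\<dots> \<le> C * (1/2)^(Suc n) * exp (2 * L * t)" using C by simp
    finally show ?case .
  qed
  have "uniform_limit {0..T} (\<lambda>n t. \<Sum>i<n. P (Suc i) t - P i t) (\<lambda>t. suminf (\<lambda>i. P (Suc i) t - P i t)) sequentially"
  proof (rule Weierstrass_m_test)
    show "norm (P (Suc n) t - P n t) \<le> C * exp (2 * L * T) * (1/2)^n" if "t \<in> {0..T}" for n t
    proof -
      have "exp (2 * L * t) \<le> exp (2 * L * T)" using that L(1) by simp
      then have "C * (1/2)^n * exp (2 * L * t) \<le> C * (1/2)^n * exp (2 * L * T)" using C by (intro mult_left_mono) auto
      then show ?thesis using bound[OF that, of n] by (simp add: mult_ac)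
    qed
    show "summable (\<lambda>n. C * exp (2 * L * T) * (1/2)^n)" by (intro summable_mult summable_geometric) simp
  qed
  moreover have "(\<Sum>i<n. P (Suc i) t - P i t) = P n t - z" for n t
    using sum_lessThan_telescope[of "\<lambda>i. P i t" n] by (simp add: P0)
  ultimately have ul0: "uniform_limit {0..T} (\<lambda>n t. P n t - z) (\<lambda>t. suminf (\<lambda>i. P (Suc i) t - P i t)) sequentially" by simp
  define u where "u t = z + suminf (\<lambda>i. P (Suc i) t - P i t)" for t
  have ul: "uniform_limit {0..T} P u sequentially"
    using ul0 unfolding uniform_limit_iff u_def by (simp add: dist_norm diff_diff_eq)
  have uc: "continuous_on {0..T} u"
    by (rule uniform_limit_theorem[OF _ ul]) (use Pc in auto)
  have eq: "u t = z + integral {0..t} (\<lambda>s. X (u s))" if t: "t \<in> {0..T}" for t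
  proof -
    have lim: "(\<lambda>n. P n t) \<longlonglongrightarrow> u t" by (rule tendsto_uniform_limitI[OF ul t])
    have ulX: "uniform_limit {0..t} (\<lambda>n s. X (P n s)) (\<lambda>s. X (u s)) sequentially"
    proof (rule uniform_limitI)
      fix e :: real assume "0 < e"
      then have "\<forall>\<^sub>F n in sequentially. \<forall>s\<in>{0..T}. dist (P n s) (u s) < e / L"
        using L(1) by (intro uniform_limitD[OF ul]) simp
      then show "\<forall>\<^sub>F n in sequentially. \<forall>s\<in>{0..t}. dist (X (P n s)) (X (u s)) < e"
      proof (rule eventually_mono, intro ballI)
        fix n s assume a: "\<forall>s\<in>{0..T}. dist (P n s) (u s) < e / L" and s: "s \<in> {0..t}"
        have "s \<in> {0..T}" using s t by auto
        with a have "dist (P n s) (u s) < e / L" by blast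
        then have "L * norm (P n s - u s) < e" using L(1) by (simp add: dist_norm pos_less_divide_eq mult.commute)
        then show "dist (X (P n s)) (X (u s)) < e" using L(2)[of "P n s" "u s"] by (simp add: dist_norm)
      qed
    qed
    obtain I J where IJ: "\<And>n. ((\<lambda>s. X (P n s)) has_integral I n) (cbox 0 t)" "((\<lambda>s. X (u s)) has_integral J) (cbox 0 t)" "I \<longlonglongrightarrow> J"
    proof (rule uniform_limit_integral_cbox)
      show "uniform_limit (cbox 0 t) (\<lambda>n s. X (P n s)) (\<lambda>s. X (u s)) sequentially" using ulX by simp
      show "continuous_on (cbox 0 t) (\<lambda>s. X (P n s))" for n using sub[OF comp[OF Pc] t] by simp
    qed (use that in auto)
    have "I n = integral {0..t} (\<lambda>s. X (P n s))" for n using IJ(1)[of n] by (simp add: integral_unique)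
    then have "P (Suc n) t = z + I n" for n by (simp add: PS)
    moreover have "(\<lambda>n. P (Suc n) t) \<longlonglongrightarrow> u t" using lim by (rule LIMSEQ_Suc)
    ultimately have "(\<lambda>n. z + I n) \<longlonglongrightarrow> u t" by simp
    moreover have "(\<lambda>n. z + I n) \<longlonglongrightarrow> z + J" by (intro tendsto_intros IJ(3))
    ultimately have "u t = z + J" by (rule LIMSEQ_unique)
    then show ?thesis using IJ(2) by (simp add: integral_unique)
  qed
  show ?thesis
  proof (rule that[of u])
    show "u 0 = z" using eq[of 0] T by simp
    fix t assume t: "t \<in> {0..T}"
    have "((\<lambda>t. z + integral {0..t} (\<lambda>s. X (u s))) has_vector_derivative 0 + X (u t)) (at t within {0..T})"
      by (intro has_vector_derivative_add has_vector_derivative_const integral_has_vector_derivative[OF comp[OF uc] t])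
    from has_vector_derivative_transform[OF t eq this]
    show "(u has_vector_derivative X (u t)) (at t within {0..T})" by simp
  qed
qed

definition flow_line :: "(complex \<Rightarrow> complex) \<Rightarrow> complex \<Rightarrow> real \<Rightarrow> (real \<Rightarrow> complex) \<Rightarrow> bool" where
  "flow_line H z T u \<longleftrightarrow> u 0 = z \<and>
     (\<forall>t\<in>{0..T}. u t \<in> unit_disc \<and> (u has_vector_derivative H (u t)) (at t within {0..T}))"

lemma flow_line_continuous: "flow_line H z T u \<Longrightarrow> continuous_on {0..T} u"
  unfolding flow_line_def continuous_on_eq_continuous_within
  using has_vector_derivative_continuous by blast

lemma flow_line_subset: "flow_line H z T u \<Longrightarrow> S \<le> T \<Longrightarrow> flow_line H z S u"
  unfolding flow_line_def
  by (auto intro: has_vector_derivative_within_subset[where S="{0..T}"])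

lemma norm_power2_DERIV:
  assumes "(u has_vector_derivative D) (at t)"
  shows "((\<lambda>s. (norm (u s))\<^sup>2) has_real_derivative 2 * Re (cnj (u t) * D)) (at t)"
proof -
  have d: "((\<lambda>s. Re (u s)) has_real_derivative Re D) (at t)" "((\<lambda>s. Im (u s)) has_real_derivative Im D) (at t)"
    using assms unfolding has_vector_derivative_complex_iff by simp_all
  have "((\<lambda>s. (Re (u s))\<^sup>2 + (Im (u s))\<^sup>2) has_real_derivative 2 * Re (cnj (u t) * D)) (at t)"
    by (rule DERIV_cong[OF DERIV_add[OF DERIV_power[OF d(1)] DERIV_power[OF d(2)]]]) (simp add: algebra_simps)
  then show ?thesis by (simp add: cmod_power2)
qed

text \<open>
The inequality says that \<open>(1 - |u|\<^sup>2) exp (2 |H 0| t)\<close> does not decrease along a solution \<open>u\<close>, so in bounded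
time a solution cannot approach the unit circle.
\<close>

lemma flow_line_norm_bound:
  assumes ineq: "\<And>z. z \<in> unit_disc \<Longrightarrow> Re (cnj z * H z) \<le> (1 - (norm z)\<^sup>2) * Re (cnj z * H 0)"
    and u: "flow_line H z T u" and T: "0 \<le> T"
  shows "(1 - (norm z)\<^sup>2) * exp (- 2 * norm (H 0) * T) \<le> 1 - (norm (u T))\<^sup>2"
proof -
  let ?c = "norm (H 0)"
  define y where "y s = (1 - (norm (u s))\<^sup>2) * exp (2 * ?c * s)" for s
  have "y 0 \<le> y T"
  proof (rule DERIV_nonneg_imp_increasing_open[OF T])
    show "continuous_on {0..T} y"
      unfolding y_def by (intro continuous_intros flow_line_continuous[OF u])
    fix s assume s: "0 < s" "s < T"
    have us: "u s \<in> unit_disc" "(u has_vector_derivative H (u s)) (at s within {0..T})"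
      using u s by (auto simp: flow_line_def)
    have "at s within {0..T} = at s" using s by (intro at_within_interior) simp
    with us have d: "(u has_vector_derivative H (u s)) (at s)" by simp
    let ?D = "(0 - 2 * Re (cnj (u s) * H (u s))) * exp (2 * ?c * s) + 2 * ?c * exp (2 * ?c * s) * (1 - (norm (u s))\<^sup>2)"
    have "(y has_real_derivative ?D) (at s)"
      unfolding y_def by (rule DERIV_mult DERIV_diff DERIV_const norm_power2_DERIV[OF d] | (auto intro!: derivative_eq_intros)[1])+
    moreover have "0 \<le> ?D"
    proof -
      have n1: "norm (u s) < 1" using us by simp
      then have n2: "0 \<le> 1 - (norm (u s))\<^sup>2" by (simp add: power_le_one)
      have "Re (cnj (u s) * H 0) \<le> norm (cnj (u s) * H 0)" by (rule complex_Re_le_cmod)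
      also have "\<dots> \<le> 1 * ?c" unfolding norm_mult complex_mod_cnj using n1 by (intro mult_right_mono) auto
      finally have "(1 - (norm (u s))\<^sup>2) * Re (cnj (u s) * H 0) \<le> (1 - (norm (u s))\<^sup>2) * ?c"
        using n2 by (intro mult_left_mono) auto
      with ineq[OF us(1)] have "Re (cnj (u s) * H (u s)) \<le> (1 - (norm (u s))\<^sup>2) * ?c" by linarith
      then have "0 \<le> exp (2 * ?c * s) * (2 * ((1 - (norm (u s))\<^sup>2) * ?c - Re (cnj (u s) * H (u s))))" by simp
      also have "\<dots> = ?D" by (simp add: algebra_simps)
      finally show ?thesis .
    qed
    ultimately show "\<exists>D. (y has_real_derivative D) (at s) \<and> 0 \<le> D" by blast
  qed
  then have "1 - (norm z)\<^sup>2 \<le> (1 - (norm (u T))\<^sup>2) * exp (2 * ?c * T)"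
    using u by (simp add: y_def flow_line_def)
  then have "(1 - (norm z)\<^sup>2) * exp (- 2 * ?c * T) \<le> (1 - (norm (u T))\<^sup>2) * exp (2 * ?c * T) * exp (- 2 * ?c * T)"
    by (intro mult_right_mono) auto
  also have "\<dots> = 1 - (norm (u T))\<^sup>2" by (simp add: mult.assoc flip: exp_add)
  finally show ?thesis .
qed

lemma holomorphic_Lipschitz_on_cball:
  assumes H: "H holomorphic_on unit_disc" and R: "R < 1"
  obtains L where "0 < L" "\<And>a b. a \<in> cball 0 R \<Longrightarrow> b \<in> cball 0 R \<Longrightarrow> norm (H a - H b) \<le> L * norm (a - b)"
proof -
  have sub: "cball 0 R \<subseteq> ball (0::complex) 1" using R by auto
  have "continuous_on (cball 0 R) (deriv H)"
    using holomorphic_on_imp_continuous_on[OF holomorphic_deriv[OF H open_ball]] sub continuous_on_subset by blast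
  then have "bounded (deriv H ` cball 0 R)"
    by (intro compact_imp_bounded compact_continuous_image) auto
  then obtain L where L: "0 < L" "\<And>x. x \<in> cball 0 R \<Longrightarrow> norm (deriv H x) \<le> L"
    unfolding bounded_pos by auto
  show ?thesis
  proof (rule that[OF L(1)])
    fix a b :: complex assume ab: "a \<in> cball 0 R" "b \<in> cball (0::complex) R"
    show "norm (H a - H b) \<le> L * norm (a - b)"
    proof (rule field_differentiable_bound[of "cball 0 R" H "deriv H"])
      fix x assume "x \<in> cball (0::complex) R"
      then have "x \<in> unit_disc" using sub by blast
      then show "(H has_field_derivative deriv H x) (at x within cball 0 R)"
        by (rule holomorphic_derivI[OF H open_ball])
    qed (use L ab in auto)
  qed
qed

text \<open>
Compose \<open>H\<close> with the projection onto a disc of radius \<open>R < 1\<close>. The result is Lipschitz on the whole plane, so a solution exists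
globally, and for a suitable \<open>R\<close> the norm bound shows that it never reaches the circle of radius \<open>R\<close>, inside of which
nothing has been changed.
\<close>

lemma flow_line_exists:
  assumes H: "H holomorphic_on unit_disc"
    and ineq: "\<And>z. z \<in> unit_disc \<Longrightarrow> Re (cnj z * H z) \<le> (1 - (norm z)\<^sup>2) * Re (cnj z * H 0)"
    and z: "z \<in> unit_disc" and T: "0 \<le> T"
  obtains u where "flow_line H z T u"
proof -
  (* half of the lower bound for 1 - |u|^2 along a solution, so that a solution cannot touch the circle of radius R *)
  define \<eta> where "\<eta> = (1 - (norm z)\<^sup>2) * exp (- 2 * norm (H 0) * T) / 2"
  have nz: "(norm z)\<^sup>2 < 1" using z by (simp add: power_less_one_iff)
  have \<eta>: "0 < \<eta>" "2 * \<eta> \<le> 1 - (norm z)\<^sup>2"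
    using nz T by (auto simp: \<eta>_def mult_left_le)
  define R where "R = sqrt (1 - \<eta>)"
  have "\<eta> < 1" using \<eta> zero_le_power2[of "norm z"] by linarith
  then have R: "0 < R" "R < 1" "R\<^sup>2 = 1 - \<eta>" using \<eta> by (auto simp: R_def)
  let ?p = "closest_point (cball (0::complex) R)"
  have p: "?p w \<in> cball 0 R" for w using R by (intro closest_point_in_set) auto
  have ps: "?p w = w" if "norm w \<le> R" for w using that by (intro closest_point_self) auto
  have pl: "norm (?p a - ?p b) \<le> norm (a - b)" for a b
    using closest_point_lipschitz[of "cball (0::complex) R" a b] R by (simp add: dist_norm)
  obtain L where L: "0 < L" "\<And>a b. a \<in> cball 0 R \<Longrightarrow> b \<in> cball 0 R \<Longrightarrow> norm (H a - H b) \<le> L * norm (a - b)"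
    using holomorphic_Lipschitz_on_cball[OF H R(2)] by blast
  have "norm (H (?p a) - H (?p b)) \<le> L * norm (a - b)" for a b
    by (rule order_trans[OF L(2)[OF p p] mult_left_mono[OF pl less_imp_le[OF L(1)]]])
  then obtain u where u: "u 0 = z" "\<And>t. t \<in> {0..T} \<Longrightarrow> (u has_vector_derivative H (?p (u t))) (at t within {0..T})"
    using Picard_Lindelof_global[of L "\<lambda>w. H (?p w)" T z] L(1) T by blast
  have uc: "continuous_on {0..T} u"
    using u(2) has_vector_derivative_continuous continuous_on_eq_continuous_within by blast
  have less: "norm (u t) < R" if t: "t \<in> {0..T}" for t
  proof (rule ccontr)
    assume "\<not> norm (u t) < R"
    (* up to the first time t1 at which the circle is reached, u solves the original equation *)
    define S where "S = {s\<in>{0..T}. R \<le> norm (u s)}"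
    have "S \<noteq> {}" using t \<open>\<not> norm (u t) < R\<close> by (auto simp: S_def)
    moreover have "closed S"
      unfolding S_def by (rule continuous_on_closed_Collect_le[OF continuous_on_const continuous_on_norm[OF uc] closed_atLeastAtMost])
    moreover have bb: "bdd_below S" by (intro bdd_belowI[of _ 0]) (auto simp: S_def)
    ultimately have "Inf S \<in> S" by (intro closed_contains_Inf)
    define t1 where "t1 = Inf S"
    have t1: "t1 \<in> {0..T}" "R \<le> norm (u t1)" using \<open>Inf S \<in> S\<close> by (auto simp: S_def t1_def)
    have before: "norm (u s) < R" if "0 \<le> s" "s < t1" for s
    proof (rule ccontr)
      assume "\<not> norm (u s) < R"
      then have "s \<in> S" using that t1 by (auto simp: S_def)
      then show False using cInf_lower[OF _ bb, of s] that by (simp add: t1_def)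
    qed
    have "norm z < R"
    proof -
      have "(norm z)\<^sup>2 < R\<^sup>2" using R(3) \<eta> by linarith
      then show ?thesis by (rule power2_less_imp_less) (use R(1) in simp)
    qed
    then have "0 < t1" using t1 u(1) by (cases "t1 = 0") auto
    have "norm (u t1) \<le> R"
    proof -
      have "(u \<longlongrightarrow> u t1) (at t1 within {0..T})" using uc t1 unfolding continuous_on_def by blast
      then have "(u \<longlongrightarrow> u t1) (at t1 within {0..<t1})" by (rule tendsto_within_subset) (use t1 in auto)
      moreover have "at t1 within {0..<t1} \<noteq> bot"
      proof -
        have "at t1 within {0..<t1} = at_left t1"
          by (rule at_within_nhd[of _ "{0<..}"]) (use \<open>0 < t1\<close> in auto)
        then show ?thesis by simp
      qed
      ultimately show ?thesis
        by (intro tendsto_upperbound[OF tendsto_norm]) (auto simp: eventually_at_filter intro!: always_eventually less_imp_le before)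
    qed
    have "flow_line H z t1 u"
      unfolding flow_line_def
    proof (intro conjI ballI)
      fix s assume s: "s \<in> {0..t1}"
      have "norm (u s) \<le> R" using before[of s] s \<open>norm (u t1) \<le> R\<close> by (cases "s = t1") auto
      then show "u s \<in> unit_disc" using R by simp
      have "s \<in> {0..T}" using s t1 by auto
      from u(2)[OF this] ps[OF \<open>norm (u s) \<le> R\<close>] have "(u has_vector_derivative H (u s)) (at s within {0..T})" by simp
      then show "(u has_vector_derivative H (u s)) (at s within {0..t1})"
        by (rule has_vector_derivative_within_subset) (use t1 in auto)
    qed (fact u(1))
    from flow_line_norm_bound[OF ineq this] \<open>0 < t1\<close>
    have "(1 - (norm z)\<^sup>2) * exp (- 2 * norm (H 0) * t1) \<le> 1 - (norm (u t1))\<^sup>2" by simp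
    moreover have "2 * \<eta> \<le> (1 - (norm z)\<^sup>2) * exp (- 2 * norm (H 0) * t1)"
      using t1 nz unfolding \<eta>_def by (auto intro!: mult_left_mono)
    moreover have "R\<^sup>2 \<le> (norm (u t1))\<^sup>2" using t1 R by (intro power_mono) auto
    ultimately show False using R(3) \<eta> by linarith
  qed
  show ?thesis
  proof (rule that[of u])
    show "flow_line H z T u"
      unfolding flow_line_def
    proof (intro conjI ballI)
      fix s assume s: "s \<in> {0..T}"
      have n: "norm (u s) < R" by (rule less[OF s])
      then show "u s \<in> unit_disc" using R by simp
      show "(u has_vector_derivative H (u s)) (at s within {0..T})" using u(2)[OF s] ps[of "u s"] n by simp
    qed (fact u(1))
  qed
qed

text \<open>
The difference of two solutions satisfies a linear equation whose coefficient is the divided difference of \<open>H\<close> along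
them, and such an equation is solved by an exponential. This single formula contains uniqueness, Lipschitz dependence
on the initial value, and, letting the initial values coalesce, complex differentiability.
\<close>

lemma flow_line_difference:
  assumes H: "H holomorphic_on unit_disc" and u: "flow_line H a T u" and v: "flow_line H b T v" and t: "t \<in> {0..T}"
  shows "continuous_on {0..T} (\<lambda>s. divided_difference H (v s) (u s))"
    and "v t - u t = (b - a) * exp (integral {0..t} (\<lambda>s. divided_difference H (v s) (u s)))"
proof -
  let ?A = "\<lambda>s. divided_difference H (v s) (u s)"
  have "continuous_on {0..T} (\<lambda>s. (\<lambda>(a, b). divided_difference H a b) (v s, u s))"
    by (rule continuous_on_compose2[OF continuous_on_divided_difference_fixed[OF H]])
       (use u v in \<open>auto intro!: continuous_intros flow_line_continuous simp: flow_line_def\<close>)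
  then show Ac: "continuous_on {0..T} ?A" by simp
  let ?E = "\<lambda>s. exp (- integral {0..s} ?A) * (v s - u s)"
  have "(?E has_vector_derivative 0) (at s within {0..T})" if s: "s \<in> {0..T}" for s
  proof -
    have du: "(u has_vector_derivative H (u s)) (at s within {0..T})" and dv: "(v has_vector_derivative H (v s)) (at s within {0..T})"
      using u v s by (auto simp: flow_line_def)
    have dI: "((\<lambda>s. integral {0..s} ?A) has_vector_derivative ?A s) (at s within {0..T})"
      by (rule integral_has_vector_derivative[OF Ac s])
    have "((\<lambda>s. - integral {0..s} ?A) has_vector_derivative - ?A s) (at s within {0..T})"
      by (rule has_vector_derivative_minus[OF dI])
    from field_vector_diff_chain_within[OF this, of exp "exp (- integral {0..s} ?A)"]
    have dE: "((\<lambda>s. exp (- integral {0..s} ?A)) has_vector_derivative - ?A s * exp (- integral {0..s} ?A)) (at s within {0..T})"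
      by (simp add: o_def DERIV_exp has_field_derivative_at_within)
    have "(?E has_vector_derivative exp (- integral {0..s} ?A) * (H (v s) - H (u s)) + - ?A s * exp (- integral {0..s} ?A) * (v s - u s)) (at s within {0..T})"
      by (rule has_vector_derivative_mult[OF dE has_vector_derivative_diff[OF dv du]])
    moreover have "exp (- integral {0..s} ?A) * (H (v s) - H (u s)) + - ?A s * exp (- integral {0..s} ?A) * (v s - u s) = 0"
      unfolding divided_difference_mult[of "v s" "u s" H, symmetric] by (simp add: algebra_simps)
    ultimately show ?thesis by simp
  qed
  then obtain c where c: "\<And>s. s \<in> {0..T} \<Longrightarrow> ?E s = c"
    using has_vector_derivative_zero_constant[of "{0..T}" ?E] by auto
  have "?E t = ?E 0" using c[OF t] c[of 0] t by simp
  also have "\<dots> = b - a" using u v by (simp add: flow_line_def)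
  finally have E: "?E t = b - a" .
  have "v t - u t = (exp (integral {0..t} ?A) * exp (- integral {0..t} ?A)) * (v t - u t)"
    by (simp only: exp_minus_inverse mult_1_left)
  also have "\<dots> = exp (integral {0..t} ?A) * (b - a)" by (simp only: mult.assoc E)
  finally show "v t - u t = (b - a) * exp (integral {0..t} ?A)" by (simp only: mult.commute)
qed

lemma flow_line_unique:
  assumes "H holomorphic_on unit_disc" "flow_line H z S u" "flow_line H z T v" "0 \<le> t" "t \<le> S" "t \<le> T"
  shows "u t = v t"
proof -
  have "flow_line H z t u" "flow_line H z t v" using assms flow_line_subset by blast+
  from flow_line_difference(2)[OF assms(1) this, of t] assms(4) show ?thesis by simp
qed

text \<open>
The quotient \<open>(\<phi> t w - \<phi> t z) / (w - z)\<close> is the exponential of an integral that depends continuously on \<open>w\<close>, up to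
and including \<open>w = z\<close>.
\<close>

lemma flow_holomorphic:
  assumes H: "H holomorphic_on unit_disc"
    and ineq: "\<And>z. z \<in> unit_disc \<Longrightarrow> Re (cnj z * H z) \<le> (1 - (norm z)\<^sup>2) * Re (cnj z * H 0)"
    and fl: "\<And>z T. z \<in> unit_disc \<Longrightarrow> 0 \<le> T \<Longrightarrow> flow_line H z T (\<lambda>t. \<phi> t z)"
    and t: "0 \<le> t"
  shows "\<phi> t holomorphic_on unit_disc"
proof -
  have "\<exists>D. (\<phi> t has_field_derivative D) (at z)" if z: "z \<in> unit_disc" for z
  proof -
    define r where "r = (1 + norm z) / 2"
    have r: "norm z < r" "r < 1" "0 < r" using z norm_ge_zero[of z] unfolding r_def by (auto simp del: norm_ge_zero)
    define U where "U = ball (0::complex) r"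
    have U: "U \<subseteq> unit_disc" "z \<in> U" "open U" using r by (auto simp: U_def)
    (* all solutions that start in U stay in this compact disc up to time t *)
    define R where "R = sqrt (1 - (1 - r\<^sup>2) * exp (- 2 * norm (H 0) * t))"
    have r2: "0 < 1 - r\<^sup>2" using r by (simp add: power_less_one_iff)
    have R1: "R < 1" using r2 by (simp add: R_def)
    have inR: "\<phi> s w \<in> cball 0 R" if w: "w \<in> U" and s: "s \<in> {0..t}" for s w
    proof -
      have wd: "w \<in> unit_disc" using w U by blast
      have "(1 - (norm w)\<^sup>2) * exp (- 2 * norm (H 0) * s) \<le> 1 - (norm (\<phi> s w))\<^sup>2"
        by (rule flow_line_norm_bound[OF ineq fl[OF wd]]) (use s in auto)
      moreover have "(1 - r\<^sup>2) * exp (- 2 * norm (H 0) * t) \<le> (1 - (norm w)\<^sup>2) * exp (- 2 * norm (H 0) * s)"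
      proof (rule mult_mono)
        have "(norm w)\<^sup>2 \<le> r\<^sup>2" using w by (intro power_mono) (auto simp: U_def)
        then show "1 - r\<^sup>2 \<le> 1 - (norm w)\<^sup>2" "0 \<le> 1 - (norm w)\<^sup>2" using r2 by linarith+
        show "exp (- 2 * norm (H 0) * t) \<le> exp (- 2 * norm (H 0) * s)" using s by (simp add: mult_left_mono)
      qed simp
      ultimately have "(norm (\<phi> s w))\<^sup>2 \<le> 1 - (1 - r\<^sup>2) * exp (- 2 * norm (H 0) * t)" by linarith
      then have "norm (\<phi> s w) \<le> R" unfolding R_def by (rule real_le_rsqrt)
      then show ?thesis by simp
    qed
    obtain L where L: "0 < L" "\<And>a b. a \<in> cball 0 R \<Longrightarrow> b \<in> cball 0 R \<Longrightarrow> norm (H a - H b) \<le> L * norm (a - b)"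
      using holomorphic_Lipschitz_on_cball[OF H R1] by blast
    have diff: "\<phi> s w - \<phi> s w' = (w - w') * exp (integral {0..s} (\<lambda>s. divided_difference H (\<phi> s w) (\<phi> s w')))"
      and ddc: "continuous_on {0..t} (\<lambda>s. divided_difference H (\<phi> s w) (\<phi> s w'))"
      if "w \<in> U" "w' \<in> U" "s \<in> {0..t}" for s w w'
    proof -
      have "w \<in> unit_disc" "w' \<in> unit_disc" using that U(1) by blast+
      from flow_line_difference[OF H fl[OF this(2) t] fl[OF this(1) t] that(3)]
      show "\<phi> s w - \<phi> s w' = (w - w') * exp (integral {0..s} (\<lambda>s. divided_difference H (\<phi> s w) (\<phi> s w')))"
        "continuous_on {0..t} (\<lambda>s. divided_difference H (\<phi> s w) (\<phi> s w'))" by simp_all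
    qed
    have ddb: "norm (divided_difference H a b) \<le> L" if "a \<in> cball 0 R" "b \<in> cball 0 R" "a \<noteq> b" for a b
      using L(2)[OF that(1,2)] that(3) by (simp add: divided_difference_def norm_divide pos_divide_le_eq)
    have Lip: "norm (\<phi> s w - \<phi> s w') \<le> norm (w - w') * exp (L * t)" if w: "w \<in> U" "w' \<in> U" and s: "s \<in> {0..t}" for s w w'
    proof (cases "w = w'")
      case False
      let ?I = "integral {0..s} (\<lambda>s. divided_difference H (\<phi> s w) (\<phi> s w'))"
      have "norm ?I \<le> L * (s - 0)"
      proof (rule integral_bound)
        show "0 \<le> s" using s by simp
        show "continuous_on {0..s} (\<lambda>s. divided_difference H (\<phi> s w) (\<phi> s w'))"
          by (rule continuous_on_subset[OF ddc[OF w s]]) (use s in auto)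
        fix x assume x: "x \<in> {0..s}"
        then have xt: "x \<in> {0..t}" using s by auto
        have "\<phi> x w \<noteq> \<phi> x w'" using diff[OF w xt] False by auto
        then show "norm (divided_difference H (\<phi> x w) (\<phi> x w')) \<le> L"
          using inR[OF w(1) xt] inR[OF w(2) xt] by (intro ddb)
      qed
      also have "\<dots> \<le> L * t" using s L(1) by simp
      finally have "norm ?I \<le> L * t" .
      then have "norm (exp ?I) \<le> exp (L * t)"
        by (rule order_trans[OF norm_exp, OF exp_le_cancel_iff[THEN iffD2]])
      then show ?thesis unfolding diff[OF w s] norm_mult by (intro mult_left_mono) auto
    qed simp
    have jc: "continuous_on (U \<times> {0..t}) (\<lambda>(w, s). \<phi> s w)"
    proof (rule continuous_on_Times_if_equicontinuous)
      fix w assume "w \<in> U"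
      then show "continuous_on {0..t} (\<lambda>s. \<phi> s w)" using flow_line_continuous[OF fl[of w t]] U t by blast
      fix y e :: real assume e: "0 < e"
      show "\<exists>d>0. \<forall>x'\<in>U. \<forall>y'\<in>{0..t}. dist x' w < d \<longrightarrow> dist y' y < d \<longrightarrow> dist (\<phi> y' x') (\<phi> y' w) < e"
      proof (intro exI[of _ "e / exp (L * t)"] conjI ballI impI)
        fix x' y' assume x: "x' \<in> U" "y' \<in> {0..t}" "dist x' w < e / exp (L * t)"
        have "norm (\<phi> y' x' - \<phi> y' w) \<le> norm (x' - w) * exp (L * t)" by (rule Lip[OF x(1) \<open>w \<in> U\<close> x(2)])
        also have "\<dots> < e" using x(3) by (simp add: dist_norm pos_less_divide_eq)
        finally show "dist (\<phi> y' x') (\<phi> y' w) < e" by (simp add: dist_norm)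
      qed (use e in simp)
    qed
    define I where "I w = integral {0..t} (\<lambda>s. divided_difference H (\<phi> s w) (\<phi> s z))" for w
    have "continuous_on U (\<lambda>w. integral (cbox 0 t) (\<lambda>s. divided_difference H (\<phi> s w) (\<phi> s z)))"
    proof (rule integral_continuous_on_param)
      have c1: "continuous_on (U \<times> {0..t}) (\<lambda>p. \<phi> (snd p) (fst p))"
        using jc by (simp add: case_prod_unfold)
      have c2: "continuous_on (U \<times> {0..t}) (\<lambda>p. \<phi> (snd p) z)"
        by (rule continuous_on_compose2[OF flow_line_continuous[OF fl[OF z t]] continuous_on_snd]) (auto intro: continuous_intros)
      have mem: "\<phi> s w \<in> ball 0 1" if "w \<in> U" "s \<in> {0..t}" for w s
        using inR[OF that] R1 by auto
      have "continuous_on (U \<times> cbox 0 t) (\<lambda>p. (\<lambda>(a, b). divided_difference H a b) (\<phi> (snd p) (fst p), \<phi> (snd p) z))"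
        by (rule continuous_on_compose2[OF continuous_on_divided_difference_fixed[OF H]]) (use mem U in \<open>auto intro!: continuous_on_Pair continuous_on_const c1 c2 simp del: mem_ball\<close>)
      then show "continuous_on (U \<times> cbox 0 t) (\<lambda>(w, s). divided_difference H (\<phi> s w) (\<phi> s z))" by (simp add: case_prod_unfold)
    qed
    then have "isCont I z" unfolding I_def using U by (simp add: continuous_on_eq_continuous_at)
    then have "((\<lambda>w. exp (I w)) \<longlongrightarrow> exp (I z)) (at z)" unfolding isCont_def by (intro tendsto_intros)
    then have "((\<lambda>w. (\<phi> t w - \<phi> t z) / (w - z)) \<longlongrightarrow> exp (I z)) (at z)"
    proof (rule Lim_transform_within_open[OF _ U(3,2)])
      fix w assume "w \<in> U" "w \<noteq> z"
      then show "exp (I w) = (\<phi> t w - \<phi> t z) / (w - z)"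
        using diff[of w z t] U(2) t by (simp add: I_def)
    qed
    then show ?thesis unfolding has_field_derivative_iff by blast
  qed
  then show ?thesis
    unfolding holomorphic_on_open[OF open_ball] by blast
qed

theorem infinitesimal_generator_if_disc_inequality:
  assumes H: "H holomorphic_on unit_disc"
    and ineq: "\<And>z. z \<in> unit_disc \<Longrightarrow> Re (cnj z * H z) \<le> (1 - (norm z)\<^sup>2) * Re (cnj z * H 0)"
  shows "infinitesimal_generator H"
proof -
  (* by uniqueness the value depends neither on the chosen solution nor on its horizon *)
  define \<phi> where "\<phi> t z = (SOME u. flow_line H z (t + 1) u) t" for t z
  have ex: "\<exists>u. flow_line H z T u" if "z \<in> unit_disc" "0 \<le> T" for z T
    by (rule flow_line_exists[OF H ineq that]) blast+
  have \<phi>: "\<phi> t z = u t" if "flow_line H z T u" "0 \<le> t" "t \<le> T" "z \<in> unit_disc" for t T u z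
  proof -
    have "flow_line H z (t + 1) (SOME u. flow_line H z (t + 1) u)"
      by (rule someI_ex[OF ex]) (use that in auto)
    from flow_line_unique[OF H this that(1,2) _ that(3)] show ?thesis by (simp add: \<phi>_def)
  qed
  have fl: "flow_line H z T (\<lambda>t. \<phi> t z)" if z: "z \<in> unit_disc" and T: "0 \<le> T" for z T
  proof -
    obtain u where u: "flow_line H z T u" using ex[OF z T] by blast
    have eq: "\<phi> s z = u s" if "s \<in> {0..T}" for s using \<phi>[OF u _ _ z, of s] that by simp
    show ?thesis
      unfolding flow_line_def
    proof (intro conjI ballI)
      show "\<phi> 0 z = z" using eq[of 0] T u by (simp add: flow_line_def)
      fix t assume t: "t \<in> {0..T}"
      show "\<phi> t z \<in> unit_disc" using u t eq[OF t] by (simp add: flow_line_def)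
      have "(u has_vector_derivative H (u t)) (at t within {0..T})" using u t by (simp add: flow_line_def)
      then show "((\<lambda>t. \<phi> t z) has_vector_derivative H (\<phi> t z)) (at t within {0..T})"
        unfolding eq[OF t] by (rule has_vector_derivative_transform[OF t, rotated]) (use eq in auto)
    qed
  qed
  have der: "((\<lambda>s. \<phi> s z) has_vector_derivative H (\<phi> t z)) (at t within {0..})" if "z \<in> unit_disc" "0 \<le> t" for z t
  proof -
    have "((\<lambda>s. \<phi> s z) has_vector_derivative H (\<phi> t z)) (at t within {0..t+1})"
      using fl[OF that(1), of "t+1"] that(2) by (simp add: flow_line_def)
    moreover have "at t within {0..t+1} = at t within {0..}"
      by (rule at_within_nhd[of _ "{..<t+1}"]) auto
    ultimately show ?thesis by simp
  qed
  have sg: "\<phi> t (\<phi> s z) = \<phi> (t + s) z" if st: "0 \<le> s" "0 \<le> t" and z: "z \<in> unit_disc" for s t z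
  proof -
    have f: "flow_line H z (t + s) (\<lambda>t. \<phi> t z)" by (rule fl) (use st z in auto)
    have d: "\<phi> s z \<in> unit_disc" using f st by (simp add: flow_line_def)
    have "flow_line H (\<phi> s z) t (\<lambda>\<tau>. \<phi> (\<tau> + s) z)"
      unfolding flow_line_def
    proof (intro conjI ballI)
      fix \<tau> assume \<tau>: "\<tau> \<in> {0..t}"
      then have \<tau>': "\<tau> + s \<in> {0..t+s}" using st by simp
      then show "\<phi> (\<tau> + s) z \<in> unit_disc" using f by (simp add: flow_line_def)
      have "((\<lambda>t. \<phi> t z) has_vector_derivative H (\<phi> (\<tau> + s) z)) (at (\<tau> + s) within {0..t+s})"
        using f \<tau>' by (simp add: flow_line_def)
      then have "((\<lambda>t. \<phi> t z) has_vector_derivative H (\<phi> (\<tau> + s) z)) (at (\<tau> + s) within (\<lambda>\<tau>. \<tau> + s) ` {0..t})"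
        by (rule has_vector_derivative_within_subset) (use st in auto)
      moreover have "((\<lambda>\<tau>. \<tau> + s) has_vector_derivative 1) (at \<tau> within {0..t})"
        by (auto intro!: derivative_eq_intros)
      ultimately show "((\<lambda>\<tau>. \<phi> (\<tau> + s) z) has_vector_derivative H (\<phi> (\<tau> + s) z)) (at \<tau> within {0..t})"
        using vector_diff_chain_within[of "\<lambda>\<tau>. \<tau> + s" 1 \<tau> "{0..t}" "\<lambda>t. \<phi> t z" "H (\<phi> (\<tau> + s) z)"] by (simp add: o_def)
    qed simp
    from \<phi>[OF this st(2) order_refl d] show ?thesis .
  qed
  have "one_parameter_semigroup \<phi>"
    unfolding one_parameter_semigroup_def
  proof (intro conjI allI impI ballI)
    fix t :: real assume "0 \<le> t"
    then show "\<phi> t holomorphic_on unit_disc" "\<phi> t ` unit_disc \<subseteq> unit_disc"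
      using flow_holomorphic[OF H ineq fl] fl[of _ t] by (auto simp: flow_line_def image_subset_iff simp del: mem_ball)
  next
    fix z :: complex assume z: "z \<in> unit_disc"
    then show z0: "\<phi> 0 z = z" using fl[of z 0] by (simp add: flow_line_def)
    have "((\<lambda>t. \<phi> t z) \<longlongrightarrow> \<phi> 0 z) (at 0 within {0..})"
      using has_vector_derivative_continuous[OF der[OF z order_refl]] by (simp add: continuous_within)
    then show "((\<lambda>t. \<phi> t z) \<longlongrightarrow> z) (at_right 0)"
      unfolding z0 by (rule tendsto_within_subset) auto
  qed (use sg in simp)
  then show ?thesis
    unfolding infinitesimal_generator_def using H der by blast
qed

corollary infinitesimal_generator_if_limit_of_self_maps:
  assumes "\<And>n. \<phi> n holomorphic_on unit_disc" "\<And>n. \<phi> n ` unit_disc \<subseteq> unit_disc"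
    and "\<And>n. 0 < h n" "h \<longlonglongrightarrow> 0" "H holomorphic_on unit_disc"
    and "\<And>z. z \<in> unit_disc \<Longrightarrow> (\<lambda>n. (\<phi> n z - z) / complex_of_real (h n)) \<longlonglongrightarrow> H z"
  shows "infinitesimal_generator H"
  using infinitesimal_generator_if_disc_inequality[OF assms(5)]
    disc_generator_inequality[OF assms(1-4) assms(6)] by blast

section \<open>Decreasing Loewner chains and their inverse functions\<close>

locale Loewner_chain =
  fixes d :: ennreal and f :: "real \<Rightarrow> complex \<Rightarrow> complex"
  assumes d: "1 \<le> d" and chain: "decreasing_Loewner_chain d f"
begin

abbreviation "\<Omega> \<equiv> chain_image f"

abbreviation "g \<equiv> chain_inverse f"

lemmas chain_conditions = chain[unfolded decreasing_Loewner_chain_def]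

lemma hol: "0 \<le> t \<Longrightarrow> f t holomorphic_on unit_disc"
  and self_map: "0 \<le> t \<Longrightarrow> f t ` unit_disc \<subseteq> unit_disc"
  and inj: "0 \<le> t \<Longrightarrow> inj_on (f t) unit_disc"
  using chain_conditions[THEN conjunct1, rule_format, of t] by blast+

lemma f_0: "z \<in> unit_disc \<Longrightarrow> f 0 z = z"
  by (rule chain_conditions[THEN conjunct2, THEN conjunct1, rule_format])

lemma nested: "0 \<le> s \<Longrightarrow> s \<le> t \<Longrightarrow> \<Omega> t \<subseteq> \<Omega> s"
  unfolding chain_image_def
  by (rule chain_conditions[THEN conjunct2, THEN conjunct2, THEN conjunct1, rule_format]) blast

lemma dominating_function:
  assumes K: "compact K" "K \<subseteq> unit_disc" and T: "0 < T"
  obtains k where "\<And>\<xi>. \<xi> \<in> {0..T} \<Longrightarrow> 0 \<le> k \<xi>" "in_Ld d T k" "k integrable_on {0..T}"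
    "\<And>z s t. z \<in> K \<Longrightarrow> 0 \<le> s \<Longrightarrow> s \<le> t \<Longrightarrow> t \<le> T \<Longrightarrow> norm (f t z - f s z) \<le> integral {s..t} k"
proof -
  obtain k where k: "\<forall>\<xi>\<in>{0..T}. 0 \<le> k \<xi>" "in_Ld d T k"
     "\<forall>z\<in>K. \<forall>s t. 0 \<le> s \<and> s \<le> t \<and> t \<le> T \<longrightarrow> cmod (f s z - f t z) \<le> (\<integral>\<xi>. k \<xi> \<partial>(lebesgue_on {s..t}))"
    using chain_conditions[THEN conjunct2, THEN conjunct2, THEN conjunct2, rule_format, of K T] K T by blast
  have "integrable (lebesgue_on {0..T}) k" by (rule in_Ld_imp_integrable[OF d k(2)])
  then have ka: "k absolutely_integrable_on {0..T}"
    unfolding set_integrable_def by (subst (asm) integrable_restrict_space) simp_all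
  show ?thesis
  proof (rule that[of k])
    show "k integrable_on {0..T}" using ka by (simp add: absolutely_integrable_on_def)
    fix z s t assume z: "z \<in> K" and st: "0 \<le> s" "s \<le> t" "t \<le> T"
    have "k absolutely_integrable_on {s..t}" by (rule set_integrable_subset[OF ka]) (use st in auto)
    then have "integrable (lebesgue_on {s..t}) k"
      unfolding set_integrable_def by (subst integrable_restrict_space) simp_all
    then have "(\<integral>\<xi>. k \<xi> \<partial>(lebesgue_on {s..t})) = integral {s..t} k" by (rule lebesgue_integral_eq_integral) simp
    then show "norm (f t z - f s z) \<le> integral {s..t} k"
      using k(3)[rule_format, OF z, of s t] st by (simp add: norm_minus_commute)
  qed (use k in auto)
qed

lemma dominated:
  assumes "0 < T" shows "integrally_dominated T f"
  unfolding integrally_dominated_def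
proof (intro allI impI, elim conjE)
  fix K :: "complex set" assume K: "compact K" "K \<subseteq> unit_disc"
  obtain k where "\<And>\<xi>. \<xi> \<in> {0..T} \<Longrightarrow> 0 \<le> k \<xi>" "in_Ld d T k" "k integrable_on {0..T}"
    "\<And>z s t. z \<in> K \<Longrightarrow> 0 \<le> s \<Longrightarrow> s \<le> t \<Longrightarrow> t \<le> T \<Longrightarrow> norm (f t z - f s z) \<le> integral {s..t} k"
    by (rule dominating_function[OF K assms]) blast
  then show "\<exists>k. k integrable_on {0..T} \<and> (\<forall>x\<in>{0..T}. 0 \<le> k x) \<and>
             (\<forall>z\<in>K. \<forall>u v. 0 \<le> u \<and> u \<le> v \<and> v \<le> T \<longrightarrow> norm (f v z - f u z) \<le> integral {u..v} k)"
    by (intro exI[of _ k]) simp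
qed

text \<open>
For \<open>z\<close> in a compact set the dependence on time is equicontinuous, since one integral dominates all increments.
\<close>

lemma joint_continuous: "continuous_on ({0..} \<times> unit_disc) (\<lambda>(t, z). f t z)"
proof (rule continuous_on_Times_if_equicontinuous)
  show "continuous_on unit_disc (f t)" if "t \<in> {0..}" for t
    using hol[of t] that by (intro holomorphic_on_imp_continuous_on) simp
  fix t :: real and z :: complex and e :: real assume t: "t \<in> {0..}" and z: "z \<in> unit_disc" and e: "0 < e"
  obtain r where r: "r > 0" "cball z r \<subseteq> unit_disc" using z open_contains_cball[of unit_disc] open_ball by blast
  have T: "0 < t + 1" using t by simp
  obtain k where k: "\<And>\<xi>. \<xi> \<in> {0..t+1} \<Longrightarrow> 0 \<le> k \<xi>" "in_Ld d (t+1) k" "k integrable_on {0..t+1}"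
    "\<And>z' s s'. z' \<in> cball z r \<Longrightarrow> 0 \<le> s \<Longrightarrow> s \<le> s' \<Longrightarrow> s' \<le> t+1 \<Longrightarrow> norm (f s' z' - f s z') \<le> integral {s..s'} k"
    by (rule dominating_function[OF compact_cball r(2) T]) blast
  let ?I = "\<lambda>s. integral {0..s} k"
  note Id = integral_Icc_diff[OF k(3)]
  have le: "norm (f s z' - f s' z') \<le> \<bar>?I s - ?I s'\<bar>" if "z' \<in> cball z r" "s \<in> {0..t+1}" "s' \<in> {0..t+1}" for z' s s'
    using k(4)[OF that(1), of s s'] k(4)[OF that(1), of s' s] Id[of s s'] Id[of s' s] that(2,3)
    by (cases "s \<le> s'") (simp_all add: norm_minus_commute)
  have "continuous_on {0..t+1} ?I" by (rule indefinite_integral_continuous_1[OF k(3)])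
  then obtain d1 where d1: "d1 > 0" "\<And>s. s \<in> {0..t+1} \<Longrightarrow> dist s t < d1 \<Longrightarrow> dist (?I s) (?I t) < e"
    using t e unfolding continuous_on_iff by (metis add_increasing2 atLeastAtMost_iff atLeast_iff less_add_one less_imp_le zero_le_one)
  show "\<exists>d>0. \<forall>x'\<in>{0..}. \<forall>y'\<in>unit_disc. dist x' t < d \<longrightarrow> dist y' z < d \<longrightarrow> dist (f x' y') (f t y') < e"
  proof (intro exI[of _ "min (min d1 1) r"] conjI ballI impI)
    fix x' y' assume x: "x' \<in> {0..}" "dist x' t < min (min d1 1) r" "dist y' z < min (min d1 1) r"
    then have "x' \<in> {0..t+1}" "t \<in> {0..t+1}" "y' \<in> cball z r" using t by (auto simp: dist_real_def dist_commute abs_less_iff)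
    then show "dist (f x' y') (f t y') < e" using le[of y' x' t] d1(2)[of x'] x(2) by (simp add: dist_norm)
  qed (use d1 r in auto)
qed

lemma deriv_neq_0: "0 \<le> t \<Longrightarrow> z \<in> unit_disc \<Longrightarrow> deriv (f t) z \<noteq> 0"
  by (rule holomorphic_injective_imp_regular[OF hol open_ball inj])

lemma g_in: "z \<in> \<Omega> t \<Longrightarrow> g t z \<in> unit_disc"
  and f_g: "z \<in> \<Omega> t \<Longrightarrow> f t (g t z) = z"
  unfolding chain_image_def chain_inverse_def by (rule inv_into_into f_inv_into_f, assumption)+

lemma g_f: "0 \<le> t \<Longrightarrow> z \<in> unit_disc \<Longrightarrow> g t (f t z) = z"
  unfolding chain_inverse_def by (rule inv_into_f_f[OF inj])

lemma f_in: "z \<in> unit_disc \<Longrightarrow> f t z \<in> \<Omega> t"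
  by (simp add: chain_image_def)

lemma Omega_0: "\<Omega> 0 = unit_disc"
  using f_0 by (auto simp: chain_image_def image_def simp del: mem_ball)

lemma g_0: "z \<in> unit_disc \<Longrightarrow> g 0 z = z"
  using g_f[of 0 z] f_0 by simp

lemma open_Omega: "0 \<le> t \<Longrightarrow> open (\<Omega> t)"
  unfolding chain_image_def by (rule open_mapping_thm3[OF hol open_ball inj])

lemma g_holomorphic: assumes "0 \<le> t" shows "g t holomorphic_on \<Omega> t"
proof -
  obtain g' where g': "g' holomorphic_on (f t ` unit_disc)" "\<And>z. z \<in> unit_disc \<Longrightarrow> g' (f t z) = z"
    by (rule holomorphic_has_inverse[OF hol[OF assms] open_ball inj[OF assms]]) blast
  have "g' w = g t w" if "w \<in> \<Omega> t" for w using g'(2)[OF g_in[OF that]] f_g[OF that] by simp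
  then show ?thesis using holomorphic_transform[OF g'(1)] by (simp add: chain_image_def)
qed

text \<open>
The times at which a point belongs to the image form a relatively open set, and the preimage moves continuously.
\<close>

lemma g_persists:
  assumes t: "0 \<le> t" and z: "z \<in> \<Omega> t" and e: "0 < e"
  shows "\<forall>\<^sub>F s in at t within {0..}. z \<in> \<Omega> s \<and> dist (g s z) (g t z) < e"
proof -
  have "\<forall>\<^sub>F s in at t within {0..}. \<exists>v\<in>unit_disc. dist (g t z) v < e \<and> f s v = z"
    by (rule solution_of_nearby_equation[OF joint_continuous _ inj[OF t]])
       (use t g_in[OF z] e in \<open>simp_all add: hol f_g[OF z]\<close>)
  moreover have "\<forall>\<^sub>F s in at t within {0..}. s \<in> {0..}" by (simp add: eventually_at_filter)
  ultimately show ?thesis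
  proof eventually_elim
    case (elim s)
    then obtain v where v: "v \<in> unit_disc" "dist (g t z) v < e" "f s v = z" by blast
    then have "g s z = v" using g_f[of s v] elim by simp
    then show ?case using v f_in[OF v(1), of s] by (simp add: dist_commute)
  qed
qed

lemma g_continuous:
  assumes "0 \<le> t" "z \<in> \<Omega> t"
  shows "((\<lambda>s. g s z) \<longlongrightarrow> g t z) (at t within {0..})"
proof (rule tendstoI)
  fix e :: real assume "0 < e"
  from g_persists[OF assms this] show "\<forall>\<^sub>F s in at t within {0..}. dist (g s z) (g t z) < e"
    by eventually_elim simp
qed

text \<open>
The interval from \<open>0\<close> to the exit time, described without a supremum; the two agree because the supremum is never
attained (\<open>lifetime_later\<close>).
\<close>

definition lifetime :: "complex \<Rightarrow> real set" where
  "lifetime z = {t. 0 \<le> t \<and> z \<in> \<Omega> t}"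

lemma lifetime_downward: "t \<in> lifetime z \<Longrightarrow> 0 \<le> s \<Longrightarrow> s \<le> t \<Longrightarrow> s \<in> lifetime z"
  using nested unfolding lifetime_def by blast

lemma lifetime_0: "z \<in> unit_disc \<Longrightarrow> 0 \<in> lifetime z"
  by (simp add: lifetime_def Omega_0 del: mem_ball)

lemma lifetime_later:
  assumes "t \<in> lifetime z" obtains t' where "t < t'" "t' \<in> lifetime z"
proof -
  have t: "0 \<le> t" "z \<in> \<Omega> t" using assms by (auto simp: lifetime_def)
  have "\<forall>\<^sub>F s in at t within {0..}. z \<in> \<Omega> s" using g_persists[OF t zero_less_one] by eventually_elim simp
  then have "\<forall>\<^sub>F s in at_right t. z \<in> \<Omega> s"
    by (rule filter_leD[OF at_le, rotated]) (use t in auto)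
  then obtain b where b: "b > t" "\<And>s. t < s \<Longrightarrow> s < b \<Longrightarrow> z \<in> \<Omega> s" unfolding eventually_at_right_field by blast
  show ?thesis by (rule that[of "(t + b)/2"]) (use b t in \<open>auto simp: lifetime_def\<close>)
qed

lemma half_line_exit_time: "half_line_upto (exit_time f z) = lifetime z"
proof (intro set_eqI iffI)
  fix t assume "t \<in> half_line_upto (exit_time f z)"
  then have t: "0 \<le> t" "ereal t < Sup (ereal ` lifetime z)" by (auto simp: half_line_upto_def exit_time_def lifetime_def)
  then obtain s where "s \<in> lifetime z" "t < s" by (auto simp: less_Sup_iff)
  then show "t \<in> lifetime z" using lifetime_downward t by simp
next
  fix t assume t: "t \<in> lifetime z"
  then obtain t' where "t < t'" "t' \<in> lifetime z" by (rule lifetime_later)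
  then have "ereal t < Sup (ereal ` lifetime z)" unfolding less_Sup_iff by auto
  then show "t \<in> half_line_upto (exit_time f z)"
    using t by (auto simp: half_line_upto_def exit_time_def lifetime_def)
qed

lemma is_interval_lifetime: "is_interval (lifetime z)"
proof -
  have "x \<in> lifetime z" if "a \<in> lifetime z" "b \<in> lifetime z" "a \<le> x" "x \<le> b" for a b x
    by (rule lifetime_downward[OF that(2) _ that(4)]) (use that in \<open>simp add: lifetime_def\<close>)
  then show ?thesis unfolding is_interval_1 by blast
qed

lemma at_within_lifetime:
  assumes "t \<in> lifetime z" shows "at t within lifetime z = at t within {0..}"
proof -
  obtain t' where t': "t < t'" "t' \<in> lifetime z" using lifetime_later[OF assms] by blast
  show ?thesis
  proof (rule at_within_nhd[of _ "{..<t'}"])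
    show "lifetime z \<inter> {..<t'} - {t} = {0..} \<inter> {..<t'} - {t}"
      using lifetime_downward[OF t'(2)] by (auto simp: lifetime_def)
  qed (use t' in auto)
qed

text \<open>
From \<open>f v (g v z) = f u (g u z)\<close> the increment of \<open>g\<close>, multiplied by a divided difference of \<open>f v\<close>, equals an increment
of \<open>f\<close> in time at the fixed point \<open>g u z\<close>; the divided differences are bounded below on compact sets.
\<close>

lemma g_locally_abs_continuous: "locally_abs_continuous_on (lifetime z) (\<lambda>t. g t z)"
  unfolding locally_abs_continuous_on_def
proof (intro allI impI, elim conjE)
  fix a b :: real assume ab: "a \<le> b" "{a..b} \<subseteq> lifetime z"
  have J: "0 \<le> t" "z \<in> \<Omega> t" if "t \<in> {a..b}" for t using ab that by (auto simp: lifetime_def)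
  have a0: "0 \<le> a" using J[of a] ab by simp
  have "continuous_on {a..b} (\<lambda>t. g t z)"
    unfolding continuous_on_def
  proof
    fix t assume t: "t \<in> {a..b}"
    show "((\<lambda>t. g t z) \<longlongrightarrow> g t z) (at t within {a..b})"
      by (rule tendsto_within_subset[OF g_continuous[OF J[OF t]]]) (use a0 in auto)
  qed
  then have K: "compact ((\<lambda>t. g t z) ` {a..b})" by (rule compact_continuous_image) simp
  have KD: "(\<lambda>t. g t z) ` {a..b} \<subseteq> unit_disc" using g_in J by blast
  obtain m where m: "0 < m" "\<And>t x y. t \<in> {a..b} \<Longrightarrow> x \<in> (\<lambda>t. g t z) ` {a..b} \<Longrightarrow> y \<in> (\<lambda>t. g t z) ` {a..b} \<Longrightarrow> m \<le> norm (divided_difference (f t) x y)"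
  proof (rule divided_difference_bounded_below[OF joint_continuous _ _ compact_Icc _ K KD])
    show "{a..b} \<subseteq> {0..}" using a0 by auto
  qed (use hol inj in auto)
  have T: "0 < b + 1" using a0 ab by simp
  obtain k where k: "\<And>\<xi>. \<xi> \<in> {0..b+1} \<Longrightarrow> 0 \<le> k \<xi>" "k integrable_on {0..b+1}"
    "\<And>w s t. w \<in> (\<lambda>t. g t z) ` {a..b} \<Longrightarrow> 0 \<le> s \<Longrightarrow> s \<le> t \<Longrightarrow> t \<le> b+1 \<Longrightarrow> norm (f t w - f s w) \<le> integral {s..t} k"
    by (rule dominating_function[OF K KD T]) blast
  show "abs_continuous_on_interval a b (\<lambda>t. g t z)"
  proof (rule abs_continuous_if_integral_dominated[where k="\<lambda>x. k x / m"])
    have "k integrable_on {a..b}" using k(2) by (rule integrable_on_subinterval) (use a0 in auto)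
    then show "(\<lambda>x. k x / m) integrable_on {a..b}" by (rule integrable_on_divide)
    show "0 \<le> k x / m" if "x \<in> {a..b}" for x using k(1)[of x] that a0 m(1) by simp
    fix u v assume uv: "a \<le> u" "u \<le> v" "v \<le> b"
    then have mem: "u \<in> {a..b}" "v \<in> {a..b}" "g u z \<in> (\<lambda>t. g t z) ` {a..b}" "g v z \<in> (\<lambda>t. g t z) ` {a..b}" by auto
    have "m * norm (g v z - g u z) \<le> norm (g v z - g u z) * norm (divided_difference (f v) (g v z) (g u z))"
      using m(2)[OF mem(2,4,3)] by (subst mult.commute) (rule mult_left_mono, simp_all)
    also have "\<dots> = norm (f v (g v z) - f v (g u z))" by (simp add: divided_difference_mult flip: norm_mult)
    also have "f v (g v z) = f u (g u z)" using f_g J(2)[OF mem(1)] J(2)[OF mem(2)] by simp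
    also have "norm (f u (g u z) - f v (g u z)) \<le> integral {u..v} k"
      using k(3)[OF mem(3), of u v] uv a0 by (simp add: norm_minus_commute)
    finally have "norm (g v z - g u z) \<le> integral {u..v} k / m" using m(1) by (simp add: pos_le_divide_eq mult.commute)
    then show "norm (g v z - g u z) \<le> integral {u..v} (\<lambda>x. k x / m)" by simp
  qed
qed

section \<open>The velocity field of a chain\<close>

text \<open>
The exceptional set contains the time \<open>0\<close>, so that at regular times all derivatives are two-sided; at exceptional times the
field is set to zero, which keeps it holomorphic in \<open>z\<close> at every time.
\<close>

definition velocity_field :: "(complex \<Rightarrow> real \<Rightarrow> complex) \<Rightarrow> real set \<Rightarrow> bool" where
  "velocity_field G N \<longleftrightarrow> N \<subseteq> {0..} \<and> negligible N \<and> 0 \<in> N \<and>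
     (\<forall>t\<ge>0. (\<lambda>z. G z t) holomorphic_on unit_disc) \<and> (\<forall>t\<in>N. \<forall>z. G z t = 0) \<and>
     (\<forall>t\<in>{0..} - N. \<forall>z\<in>unit_disc. ((\<lambda>s. f s z) has_vector_derivative deriv (f t) z * G z t) (at t))"

lemma velocity_field_exists: "\<exists>G N. velocity_field G N"
proof -
  have "\<exists>N. negligible N \<and> (\<forall>t\<in>{0<..<real n + 1} - N. \<exists>q. q holomorphic_on unit_disc \<and>
        (\<forall>z\<in>unit_disc. ((\<lambda>s. f s z) has_vector_derivative q z) (at t)))" for n :: nat
  proof -
    have T: "0 < real n + 1" by simp
    show ?thesis
    proof (rule dominated_holomorphic_family_differentiable_ae[OF T hol dominated[OF T]])
      fix N assume "negligible N" "\<And>t. t \<in> {0<..<real n + 1} - N \<Longrightarrow> \<exists>q. q holomorphic_on unit_disc \<and>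
        (\<forall>z\<in>unit_disc. ((\<lambda>s. f s z) has_vector_derivative q z) (at t))"
      then show ?thesis by (intro exI[of _ N]) simp
    qed
  qed
  then have "\<forall>n. \<exists>N. negligible N \<and> (\<forall>t\<in>{0<..<real n + 1} - N. \<exists>q. q holomorphic_on unit_disc \<and>
        (\<forall>z\<in>unit_disc. ((\<lambda>s. f s z) has_vector_derivative q z) (at t)))" by (rule allI)
  from choice[OF this] obtain Nn where Nn': "\<forall>n. negligible (Nn n) \<and> (\<forall>t\<in>{0<..<real n + 1} - Nn n. \<exists>q. q holomorphic_on unit_disc \<and>
        (\<forall>z\<in>unit_disc. ((\<lambda>s. f s z) has_vector_derivative q z) (at t)))" ..
  note Nn = Nn'[THEN spec, THEN conjunct1] Nn'[THEN spec, THEN conjunct2]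
  define N where "N = {0} \<union> ((\<Union>n. Nn n) \<inter> {0..})"
  have "negligible (\<Union>n. Nn n)" using negligible_countable_Union[of "range Nn"] Nn(1) by auto
  then have negN: "negligible N"
    unfolding N_def by (intro negligible_Un negligible_Int disjI1 disjI2) (auto intro: negligible_subset)
  have "\<exists>q. q holomorphic_on unit_disc \<and> (\<forall>z\<in>unit_disc. ((\<lambda>s. f s z) has_vector_derivative q z) (at t))"
    if t: "t \<in> {0..} - N" for t
  proof -
    obtain n where "t < real n" using reals_Archimedean2 by blast
    then have "t \<in> {0<..<real n + 1} - Nn n" using t by (auto simp: N_def less_le)
    then show ?thesis using Nn(2)[of n] by blast
  qed
  then obtain Q where Q: "\<And>t. t \<in> {0..} - N \<Longrightarrow> Q t holomorphic_on unit_disc"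
    "\<And>t z. t \<in> {0..} - N \<Longrightarrow> z \<in> unit_disc \<Longrightarrow> ((\<lambda>s. f s z) has_vector_derivative Q t z) (at t)"
    by metis
  define G where "G z t = (if t \<in> N then 0 else Q t z / deriv (f t) z)" for z t
  have "velocity_field G N"
    unfolding velocity_field_def
  proof (intro conjI allI impI ballI)
    show "N \<subseteq> {0..}" "0 \<in> N" by (auto simp: N_def)
    show "negligible N" by (rule negN)
    show "G z t = 0" if "t \<in> N" for z t using that by (simp add: G_def)
    show "(\<lambda>z. G z t) holomorphic_on unit_disc" if t: "0 \<le> t" for t
    proof (cases "t \<in> N")
      case False
      have "(\<lambda>z. Q t z / deriv (f t) z) holomorphic_on unit_disc"
        using Q(1)[of t] t False holomorphic_deriv[OF hol[OF t] open_ball] deriv_neq_0[OF t]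
        by (intro holomorphic_on_divide) auto
      then show ?thesis using False by (simp add: G_def)
    qed (simp add: G_def)
    fix t z assume tz: "t \<in> {0..} - N" "z \<in> unit_disc"
    then have "deriv (f t) z * G z t = Q t z" using deriv_neq_0[of t z] by (simp add: G_def del: mem_ball)
    then show "((\<lambda>s. f s z) has_vector_derivative deriv (f t) z * G z t) (at t)" using Q(2)[OF tz] by simp
  qed
  then show ?thesis by blast
qed

end

locale Loewner_chain_velocity = Loewner_chain +
  fixes G :: "complex \<Rightarrow> real \<Rightarrow> complex" and N :: "real set"
  assumes velocity_field: "velocity_field G N"
begin

lemma N_negligible: "negligible N" and N_subset: "N \<subseteq> {0..}" and zero_in_N: "0 \<in> N"
  and G_holomorphic: "0 \<le> t \<Longrightarrow> (\<lambda>z. G z t) holomorphic_on unit_disc"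
  and G_zero: "t \<in> N \<Longrightarrow> G z t = 0"
  and f_deriv: "t \<in> {0..} - N \<Longrightarrow> z \<in> unit_disc \<Longrightarrow> ((\<lambda>s. f s z) has_vector_derivative deriv (f t) z * G z t) (at t)"
  using velocity_field unfolding velocity_field_def by simp_all

lemma regular_time_pos: "t \<in> {0..} - N \<Longrightarrow> 0 < t"
  using zero_in_N by (cases "t = 0") auto

lemma at_within_pos: assumes "0 < t" shows "at t within {0..} = at (t::real)"
  using assms by (intro at_within_interior) (simp add: interior_Ici)

text \<open>
The implicit function argument: \<open>f s (g s z)\<close> does not depend on \<open>s\<close>, so the difference quotient of \<open>g\<close> in time is minus
that of \<open>f\<close> at the point \<open>g t z\<close>, divided by a divided difference of \<open>f s\<close>.
\<close>

lemma g_deriv: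
  assumes t: "t \<in> {0..} - N" and z: "z \<in> \<Omega> t"
  shows "((\<lambda>s. g s z) has_vector_derivative - G (g t z) t) (at t)"
  unfolding has_vector_derivative_complex_quotient_iff
proof -
  let ?w = "g t z"
  have t0: "0 \<le> t" using t by simp
  note at = at_within_pos[OF regular_time_pos[OF t]]
  have w: "?w \<in> unit_disc" by (rule g_in[OF z])
  have ev0: "\<forall>\<^sub>F s in at t. s \<in> {0..}"
    unfolding at[symmetric] by (simp add: eventually_at_filter)
  have glim: "((\<lambda>s. g s z) \<longlongrightarrow> ?w) (at t)" using g_continuous[OF t0 z] unfolding at .
  have dd: "((\<lambda>s. divided_difference (f s) (g s z) ?w) \<longlongrightarrow> deriv (f t) ?w) (at t)"
    by (rule divided_difference_tendsto[OF joint_continuous _ _ w _ glim]) (use t0 ev0 hol in \<open>auto intro: tendsto_ident_at\<close>)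
  have "((\<lambda>s. (f s ?w - f t ?w) / complex_of_real (s - t)) \<longlongrightarrow> deriv (f t) ?w * G ?w t) (at t)"
    using f_deriv[OF t w] unfolding has_vector_derivative_complex_quotient_iff .
  then have "((\<lambda>s. - ((f s ?w - f t ?w) / complex_of_real (s - t)) / divided_difference (f s) (g s z) ?w) \<longlongrightarrow> - (deriv (f t) ?w * G ?w t) / deriv (f t) ?w) (at t)"
    by (intro tendsto_divide tendsto_minus dd deriv_neq_0[OF t0 w])
  moreover have "- (deriv (f t) ?w * G ?w t) / deriv (f t) ?w = - G ?w t" using deriv_neq_0[OF t0 w] by simp
  moreover have "\<forall>\<^sub>F s in at t. - ((f s ?w - f t ?w) / complex_of_real (s - t)) / divided_difference (f s) (g s z) ?w = (g s z - ?w) / complex_of_real (s - t)"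
  proof -
    have "\<forall>\<^sub>F s in at t. z \<in> \<Omega> s" using g_persists[OF t0 z zero_less_one] unfolding at by eventually_elim simp
    with ev0 show ?thesis
    proof eventually_elim
      case (elim s)
      then have s: "0 \<le> s" by simp
      have nz: "divided_difference (f s) (g s z) ?w \<noteq> 0"
        by (rule divided_difference_neq_0[OF hol[OF s] open_ball inj[OF s] g_in[OF elim(2)] w])
      have "(g s z - ?w) * divided_difference (f s) (g s z) ?w = f t ?w - f s ?w"
        unfolding divided_difference_mult using f_g[OF elim(2)] f_g[OF z] by simp
      then have "f s ?w - f t ?w = - ((g s z - ?w) * divided_difference (f s) (g s z) ?w)" by simp
      then show ?case using nz by simp
    qed
  qed
  ultimately show "((\<lambda>s. (g s z - ?w) / complex_of_real (s - t)) \<longlongrightarrow> - G ?w t) (at t)"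
    using Lim_transform_eventually by force
qed

lemma subinterval: "is_interval (E::real set) \<Longrightarrow> 0 \<in> E \<Longrightarrow> t \<in> E \<Longrightarrow> {0..t} \<subseteq> E"
  using mem_is_interval_1_I[of E 0 t] by fastforce

section \<open>The ordinary differential equation\<close>

text \<open>
The conservation law behind uniqueness: the two terms of the chain rule for \<open>f s (u s)\<close> cancel.
\<close>

lemma ivp_solution_eq:
  assumes sol: "ivp_solution (\<lambda>w t. - G w t) z E u" and t: "t \<in> E"
  shows "f t (u t) = z"
proof -
  have E: "is_interval E" "E \<subseteq> {0..}" "0 \<in> E" "u ` E \<subseteq> unit_disc" "locally_abs_continuous_on E u" "u 0 = z"
    and ae: "AE t in lebesgue_on E. (u has_vector_derivative - G (u t) t) (at t within E)"
    using sol unfolding ivp_solution_def by auto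
  have t0: "0 \<le> t" using E(2) t by auto
  have sub: "{0..t} \<subseteq> E" by (rule subinterval[OF E(1,3) t])
  have ac: "abs_continuous_on_interval 0 t u" using E(5) sub t0 unfolding locally_abs_continuous_on_def by blast
  have im: "u ` {0..t} \<subseteq> unit_disc" using E(4) sub by blast
  have K: "compact (u ` {0..t})" by (rule compact_continuous_image[OF abs_continuous_imp_continuous_on[OF ac]]) simp
  obtain N' where N': "negligible N'" "\<forall>s\<in>E - N'. (u has_vector_derivative - G (u s) s) (at s within E)"
    using ae unfolding AE_lebesgue_on_iff_negligible[OF interval_sets_lebesgue[OF E(1)]] by blast
  have T: "0 < t + 1" using t0 by simp
  obtain k where k: "\<And>\<xi>. \<xi> \<in> {0..t+1} \<Longrightarrow> 0 \<le> k \<xi>" "k integrable_on {0..t+1}"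
    "\<And>w s s'. w \<in> u ` {0..t} \<Longrightarrow> 0 \<le> s \<Longrightarrow> s \<le> s' \<Longrightarrow> s' \<le> t+1 \<Longrightarrow> norm (f s' w - f s w) \<le> integral {s..s'} k"
    by (rule dominating_function[OF K im T]) blast
  have jc: "continuous_on ({0..t} \<times> unit_disc) (\<lambda>(t, z). f t z)"
    by (rule continuous_on_subset[OF joint_continuous]) auto
  have ho: "f s holomorphic_on unit_disc" if "s \<in> {0..t}" for s using hol that by simp
  have "abs_continuous_on_interval 0 t (\<lambda>s. f s (u s))"
  proof (rule abs_continuous_along_curve[OF jc ho ac im])
    show "k integrable_on {0..t}" by (rule integrable_on_subinterval[OF k(2)]) auto
    show "0 \<le> k x" if "x \<in> {0..t}" for x using k(1) that by simp
    show "norm (f s' w - f s w) \<le> integral {s..s'} k" if "w \<in> u ` {0..t}" "0 \<le> s" "s \<le> s'" "s' \<le> t" for w s s'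
      using k(3)[OF that(1-3)] that(4) by simp
  qed
  then have "f t (u t) = f 0 (u 0)"
  proof (rule abs_continuous_zero_derivative[OF _ t0, of _ "N \<union> N'"])
    show "negligible (N \<union> N')" using N_negligible N'(1) by simp
    fix s assume s: "s \<in> {0..t} - (N \<union> N')"
    then have sE: "s \<in> E - N'" "s \<in> {0..} - N" "s \<in> {0..t}" using sub by auto
    then have us: "u s \<in> unit_disc" using im by blast
    have du: "(u has_vector_derivative - G (u s) s) (at s within {0..t})"
      using N'(2)[rule_format, OF sE(1)] sub by (rule has_vector_derivative_within_subset)
    have "((\<lambda>s. f s (u s)) has_vector_derivative deriv (f s) (u s) * - G (u s) s + deriv (f s) (u s) * G (u s) s) (at s within {0..t})"
      by (rule has_vector_derivative_along_curve[OF jc ho sE(3) us du has_vector_derivative_at_within[OF f_deriv[OF sE(2) us]]])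
    then show "((\<lambda>s. f s (u s)) has_vector_derivative 0) (at s within {0..t})" by simp
  qed
  also have "\<dots> = z" using E(3,4,6) f_0 by auto
  finally show ?thesis .
qed

lemma ivp_solution_unique:
  assumes sol: "ivp_solution (\<lambda>w t. - G w t) z E u" and t: "t \<in> E"
  shows "t \<in> lifetime z" "u t = g t z"
proof -
  have t0: "0 \<le> t" and ut: "u t \<in> unit_disc" using sol t unfolding ivp_solution_def by auto
  note eq = ivp_solution_eq[OF sol t]
  show "t \<in> lifetime z" using f_in[OF ut, of t] t0 by (simp add: lifetime_def eq)
  show "u t = g t z" using g_f[OF t0 ut] by (simp add: eq)
qed

lemma ivp_solution_g:
  assumes z: "z \<in> unit_disc"
  shows "ivp_solution (\<lambda>w t. - G w t) z (lifetime z) (\<lambda>t. g t z)"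
  unfolding ivp_solution_def
proof (intro conjI)
  show "is_interval (lifetime z)" by (rule is_interval_lifetime)
  show "lifetime z \<subseteq> {0..}" by (auto simp: lifetime_def)
  show "0 \<in> lifetime z" by (rule lifetime_0[OF z])
  show "(\<lambda>t. g t z) ` lifetime z \<subseteq> unit_disc" using g_in by (auto simp: lifetime_def image_subset_iff simp del: mem_ball)
  show "locally_abs_continuous_on (lifetime z) (\<lambda>t. g t z)" by (rule g_locally_abs_continuous)
  show "g 0 z = z" by (rule g_0[OF z])
  have "((\<lambda>t. g t z) has_vector_derivative - G (g t z) t) (at t within lifetime z)" if "t \<in> lifetime z - N" for t
    by (rule has_vector_derivative_at_within[OF g_deriv]) (use that in \<open>auto simp: lifetime_def\<close>)
  then show "AE t in lebesgue_on (lifetime z). ((\<lambda>t. g t z) has_vector_derivative - G (g t z) t) (at t within lifetime z)"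
    unfolding AE_lebesgue_on_iff_negligible[OF interval_sets_lebesgue[OF is_interval_lifetime]] using N_negligible by blast
qed

lemma inverse_ode: "inverse_ode_statement f G N"
  unfolding inverse_ode_statement_def half_line_exit_time
proof (intro conjI ballI allI impI)
  fix t assume t: "t \<in> {0..} - N"
  then have t0: "0 \<le> t" by simp
  have lim: "filterlim (\<lambda>h. t + h) (at t within {0..}) (at 0 within {-t..})"
    unfolding filterlim_at
  proof (intro conjI)
    show "\<forall>\<^sub>F h in at 0 within {- t..}. t + h \<in> {0..} \<and> t + h \<noteq> t" by (simp add: eventually_at_filter)
    have "((\<lambda>h. t + h) \<longlongrightarrow> t + 0) (at 0 within {- t..})" by (intro tendsto_intros)
    then show "((\<lambda>h. t + h) \<longlongrightarrow> t) (at 0 within {- t..})" by simp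
  qed
  show "\<exists>g'. g' holomorphic_on \<Omega> t \<and> (\<forall>z\<in>\<Omega> t.
           (\<forall>\<^sub>F h in at 0 within {-t..}. z \<in> \<Omega> (t + h)) \<and>
           ((\<lambda>h. (g (t + h) z - g t z) / complex_of_real h) \<longlongrightarrow> g' z) (at 0 within {-t..}))"
  proof (intro exI[of _ "\<lambda>z. - G (g t z) t"] conjI ballI)
    have "((\<lambda>w. G w t) \<circ> g t) holomorphic_on \<Omega> t"
      by (rule holomorphic_on_compose_gen[OF g_holomorphic[OF t0] G_holomorphic[OF t0]]) (use g_in in blast)
    then show "(\<lambda>z. - G (g t z) t) holomorphic_on \<Omega> t" by (intro holomorphic_on_minus) (simp add: o_def)
    fix z assume z: "z \<in> \<Omega> t"
    have "\<forall>\<^sub>F s in at t within {0..}. z \<in> \<Omega> s" using g_persists[OF t0 z zero_less_one] by eventually_elim simp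
    then show "\<forall>\<^sub>F h in at 0 within {-t..}. z \<in> \<Omega> (t + h)" by (rule eventually_compose_filterlim[OF _ lim])
    have "((\<lambda>s. (g s z - g t z) / complex_of_real (s - t)) \<longlongrightarrow> - G (g t z) t) (at t within {0..})"
      using has_vector_derivative_at_within[OF g_deriv[OF t z], of "{0..}"]
      unfolding has_vector_derivative_complex_quotient_iff .
    from filterlim_compose[OF this lim]
    show "((\<lambda>h. (g (t + h) z - g t z) / complex_of_real h) \<longlongrightarrow> - G (g t z) t) (at 0 within {-t..})" by simp
  qed
next
  fix z :: complex assume z: "z \<in> unit_disc"
  show "maximal_ivp_solution (\<lambda>w t. - G w t) z (lifetime z) (\<lambda>t. g t z)"
    unfolding maximal_ivp_solution_def
  proof (intro conjI ivp_solution_g[OF z] notI)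
    assume "\<exists>T u. 0 < T \<and> ivp_solution (\<lambda>w t. - G w t) z (half_line_upto T) u \<and> lifetime z \<subset> half_line_upto T \<and> (\<forall>t\<in>lifetime z. u t = g t z)"
    then obtain T u where "ivp_solution (\<lambda>w t. - G w t) z (half_line_upto T) u" "lifetime z \<subset> half_line_upto T" by blast
    then show False using ivp_solution_unique(1) by blast
  qed
  fix E w assume max: "maximal_ivp_solution (\<lambda>w t. - G w t) z E w"
  then have sol: "ivp_solution (\<lambda>w t. - G w t) z E w" by (simp add: maximal_ivp_solution_def)
  have sub: "E \<subseteq> lifetime z" and eq: "\<And>t. t \<in> E \<Longrightarrow> w t = g t z" using ivp_solution_unique[OF sol] by auto
  show "E = lifetime z"
  proof (rule ccontr)
    assume "E \<noteq> lifetime z"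
    with sub have "E \<subset> half_line_upto (exit_time f z)" unfolding half_line_exit_time by blast
    moreover have "0 < exit_time f z"
      using lifetime_0[OF z] unfolding half_line_exit_time[symmetric] half_line_upto_def by (simp add: zero_ereal_def)
    ultimately show False
      using max ivp_solution_g[OF z] eq unfolding maximal_ivp_solution_def half_line_exit_time[symmetric] by auto
  qed
  show "w t = g t z" if "t \<in> E" for t by (rule eq[OF that])
next
  fix z t assume "z \<in> unit_disc" and t: "t \<in> lifetime z - N"
  show "((\<lambda>s. g s z) has_vector_derivative - G (g t z) t) (at t within lifetime z)"
    by (rule has_vector_derivative_at_within[OF g_deriv]) (use t in \<open>auto simp: lifetime_def\<close>)
qed

section \<open>The chain as a solution of the partial differential equation\<close>

lemma compose_deriv:
  assumes F0: "F0 holomorphic_on unit_disc" and t: "t \<in> {0..} - N" and z: "z \<in> unit_disc"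
  shows "((\<lambda>s. F0 (f s z)) has_vector_derivative deriv (\<lambda>x. F0 (f t x)) z * G z t) (at t)"
proof -
  have t0: "0 \<le> t" using t by simp
  have fz: "f t z \<in> unit_disc" using self_map[OF t0] z by blast
  have dF: "(F0 has_field_derivative deriv F0 (f t z)) (at (f t z))" by (rule holomorphic_derivI[OF F0 open_ball fz])
  have df: "(f t has_field_derivative deriv (f t) z) (at z)" by (rule holomorphic_derivI[OF hol[OF t0] open_ball z])
  have "deriv (\<lambda>x. F0 (f t x)) z = deriv F0 (f t z) * deriv (f t) z"
    by (rule DERIV_imp_deriv[OF DERIV_chain2[OF dF df]])
  then show ?thesis
    using field_vector_diff_chain_at[OF f_deriv[OF t z] dF] by (simp add: o_def mult_ac)
qed

lemma Loewner_Kufarev_compose: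
  assumes F0: "F0 holomorphic_on unit_disc"
  shows "Loewner_Kufarev_solution G {0..} (\<lambda>z t. F0 (f t z))"
  unfolding Loewner_Kufarev_solution_def
proof (intro conjI ballI)
  show "is_interval {0::real..}" by (rule is_interval_ci)
  have fD: "f t z \<in> unit_disc" if "0 \<le> t" "z \<in> unit_disc" for t z using self_map that by blast
  have "continuous_on (unit_disc \<times> {0..}) (\<lambda>p. F0 ((\<lambda>(t,z). f t z) (snd p, fst p)))"
  proof (rule continuous_on_compose2[OF holomorphic_on_imp_continuous_on[OF F0]])
    show "continuous_on (unit_disc \<times> {0..}) (\<lambda>p. (\<lambda>(t,z). f t z) (snd p, fst p))"
      by (rule continuous_on_compose2[OF joint_continuous]) (auto intro!: continuous_intros)
  qed (use fD in auto)
  then show "continuous_on (unit_disc \<times> {0..}) (\<lambda>(z, t). F0 (f t z))" by (simp add: case_prod_unfold)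
  show "(\<lambda>z. F0 (f t z)) holomorphic_on unit_disc" if "t \<in> {0..}" for t
    using holomorphic_on_compose_gen[OF hol F0, of t] self_map[of t] that by (simp add: o_def)
  fix z :: complex assume z: "z \<in> unit_disc"
  show "AE t in lebesgue_on {0..}. ((\<lambda>s. F0 (f s z)) has_vector_derivative deriv (\<lambda>x. F0 (f t x)) z * G z t) (at t within {0..})"
  proof (subst AE_lebesgue_on_iff_negligible)
    show "\<exists>N. negligible N \<and> (\<forall>t\<in>{0..} - N. ((\<lambda>s. F0 (f s z)) has_vector_derivative deriv (\<lambda>x. F0 (f t x)) z * G z t) (at t within {0..}))"
      using N_negligible has_vector_derivative_at_within[OF compose_deriv[OF F0 _ z]] by blast
  qed simp
  show "locally_abs_continuous_on {0..} (\<lambda>t. F0 (f t z))"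
    unfolding locally_abs_continuous_on_def
  proof (intro allI impI, elim conjE)
    fix a b :: real assume ab: "a \<le> b" "{a..b} \<subseteq> {0..}"
    then have a0: "0 \<le> a" by auto
    have "continuous_on {a..b} (\<lambda>s. (\<lambda>(t,z). f t z) (s, z))"
      by (rule continuous_on_compose2[OF joint_continuous]) (use ab z in \<open>auto intro!: continuous_intros\<close>)
    then have "continuous_on {a..b} (\<lambda>s. norm (f s z))" by (intro continuous_on_norm) simp
    then obtain s0 where s0: "s0 \<in> {a..b}" "\<And>s. s \<in> {a..b} \<Longrightarrow> norm (f s z) \<le> norm (f s0 z)"
      using continuous_attains_sup[of "{a..b}" "\<lambda>s. norm (f s z)"] ab(1) by auto
    have "norm (f s0 z) < 1" using fD[of s0 z] s0(1) a0 z by auto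
    then obtain L where L: "0 < L" "\<And>x y. x \<in> cball 0 (norm (f s0 z)) \<Longrightarrow> y \<in> cball 0 (norm (f s0 z)) \<Longrightarrow> norm (F0 x - F0 y) \<le> L * norm (x - y)"
      using holomorphic_Lipschitz_on_cball[OF F0] by blast
    have T: "0 < b + 1" using ab a0 by simp
    have Kz: "compact {z}" "{z} \<subseteq> unit_disc" using z by auto
    obtain k where k: "\<And>\<xi>. \<xi> \<in> {0..b+1} \<Longrightarrow> 0 \<le> k \<xi>" "k integrable_on {0..b+1}"
      "\<And>w s t. w \<in> {z} \<Longrightarrow> 0 \<le> s \<Longrightarrow> s \<le> t \<Longrightarrow> t \<le> b+1 \<Longrightarrow> norm (f t w - f s w) \<le> integral {s..t} k"
      by (rule dominating_function[OF Kz T]) blast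
    show "abs_continuous_on_interval a b (\<lambda>t. F0 (f t z))"
    proof (rule abs_continuous_if_integral_dominated[where k="\<lambda>x. L * k x"])
      have "k integrable_on {a..b}" using k(2) by (rule integrable_on_subinterval) (use a0 in auto)
      then show "(\<lambda>x. L * k x) integrable_on {a..b}" by (rule integrable_on_mult_right)
      show "0 \<le> L * k x" if "x \<in> {a..b}" for x using k(1)[of x] that a0 L(1) by simp
      fix u v assume uv: "a \<le> u" "u \<le> v" "v \<le> b"
      have "norm (F0 (f v z) - F0 (f u z)) \<le> L * norm (f v z - f u z)"
        by (rule L(2)) (use s0(2)[of u] s0(2)[of v] uv in simp_all)
      also have "\<dots> \<le> L * integral {u..v} k"
        using k(3)[of z u v] uv a0 L(1) by (intro mult_left_mono) simp_all
      finally show "norm (F0 (f v z) - F0 (f u z)) \<le> integral {u..v} (\<lambda>x. L * k x)" by simp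
    qed
  qed
qed simp

lemma chain_pde: "chain_pde_statement f G N"
  unfolding chain_pde_statement_def
proof (intro conjI ballI)
  show "Loewner_Kufarev_solution G {0..} (\<lambda>z t. f t z)"
    using Loewner_Kufarev_compose[OF holomorphic_on_ident] .
  show "f 0 z = z" if "z \<in> unit_disc" for z by (rule f_0[OF that])
  show "((\<lambda>s. f s z) has_vector_derivative deriv (f t) z * G z t) (at t within {0..})"
    if "t \<in> {0..} - N" "z \<in> unit_disc" for t z
    by (rule has_vector_derivative_at_within[OF f_deriv[OF that]])
qed

section \<open>The velocity field is a Herglotz vector field\<close>

lemma sequence_from_right: "filterlim (\<lambda>n. t + inverse (real (Suc n))) (at t) sequentially"
proof (rule filterlim_atI)
  show "(\<lambda>n. t + inverse (real (Suc n))) \<longlonglongrightarrow> t"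
    using tendsto_add[OF tendsto_const LIMSEQ_inverse_real_of_nat, of t] by simp
qed simp

lemma right_quotients_tendsto:
  assumes "t \<in> {0..} - N" "z \<in> unit_disc"
  shows "(\<lambda>n. (f (t + inverse (real (Suc n))) z - f t z) / complex_of_real (inverse (real (Suc n))))
    \<longlonglongrightarrow> deriv (f t) z * G z t"
  using filterlim_compose[OF f_deriv[OF assms, unfolded has_vector_derivative_complex_quotient_iff] sequence_from_right]
  by (simp only: add_diff_cancel_left')

lemma G_measurable:
  assumes z: "z \<in> unit_disc"
  shows "(\<lambda>t. G z t) \<in> borel_measurable (lebesgue_on {0..})"
proof -
  define h where "h n = inverse (real (Suc n))" for n
  have h: "0 < h n" "h \<longlonglongrightarrow> 0" for n unfolding h_def using LIMSEQ_inverse_real_of_nat by auto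
  define q where "q n t = (f (t + h n) z - f t z) / complex_of_real (h n) / deriv (f t) z" for n t
  have qc: "continuous_on {0..} (q n)" for n
  proof -
    have c1: "continuous_on {0..} (\<lambda>t. (\<lambda>(t,z). f t z) (t + h n, z))"
      by (rule continuous_on_compose2[OF joint_continuous]) (use z h(1)[of n] in \<open>auto intro!: continuous_intros\<close>)
    have c2: "continuous_on {0..} (\<lambda>t. (\<lambda>(t,z). f t z) (t, z))"
      by (rule continuous_on_compose2[OF joint_continuous]) (use z in \<open>auto intro!: continuous_intros\<close>)
    have "continuous_on {0..} (\<lambda>t. (\<lambda>(t, a, b). divided_difference (f t) a b) (t, z, z))"
      by (rule continuous_on_compose2[OF continuous_on_divided_difference[OF joint_continuous]]) (use z hol in \<open>auto intro!: continuous_intros\<close>)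
    then have c3: "continuous_on {0..} (\<lambda>t. deriv (f t) z)" by simp
    show ?thesis unfolding q_def
    proof (intro continuous_on_divide continuous_on_diff continuous_on_const c3 ballI)
      show "continuous_on {0..} (\<lambda>t. f (t + h n) z)" using c1 by simp
      show "continuous_on {0..} (\<lambda>t. f t z)" using c2 by simp
      show "complex_of_real (h n) \<noteq> 0" using h(1)[of n] by simp
      show "deriv (f t) z \<noteq> 0" if "t \<in> {0..}" for t using deriv_neq_0[OF _ z] that by simp
    qed
  qed
  have Nl: "N \<in> sets lebesgue" using N_negligible by (rule negligible_imp_sets)
  show "(\<lambda>t. G z t) \<in> borel_measurable (lebesgue_on {0..})"
  proof (rule borel_measurable_LIMSEQ_metric)
    fix n
    have m1: "q n \<in> borel_measurable (lebesgue_on {0..})"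
      by (rule continuous_imp_measurable_on_sets_lebesgue[OF qc]) simp
    have m2: "(\<lambda>t. indicator (- N) t :: real) \<in> borel_measurable (lebesgue_on {0..})"
      by (rule measurable_restrict_space1, rule borel_measurable_indicator)
         (use sets.compl_sets[OF Nl] in \<open>simp add: Compl_eq_Diff_UNIV\<close>)
    show "(\<lambda>t. indicator (- N) t *\<^sub>R q n t) \<in> borel_measurable (lebesgue_on {0..})"
      by (rule borel_measurable_scaleR[OF m2 m1])
  next
    fix t :: real assume "t \<in> space (lebesgue_on {0..})"
    then have t0: "0 \<le> t" by (simp add: space_restrict_space)
    show "(\<lambda>n. indicator (- N) t *\<^sub>R q n t) \<longlonglongrightarrow> G z t"
    proof (cases "t \<in> N")
      case True then show ?thesis using G_zero by simp
    next
      case False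
      then have t: "t \<in> {0..} - N" using t0 by simp
      have "(\<lambda>n. (f (t + h n) z - f t z) / complex_of_real (h n)) \<longlonglongrightarrow> deriv (f t) z * G z t"
        unfolding h_def by (rule right_quotients_tendsto[OF t z])
      then have "(\<lambda>n. (f (t + h n) z - f t z) / complex_of_real (h n) / deriv (f t) z) \<longlonglongrightarrow> deriv (f t) z * G z t / deriv (f t) z"
        by (rule tendsto_divide[OF _ tendsto_const deriv_neq_0[OF t0 z]])
      then show ?thesis using False deriv_neq_0[OF t0 z] by (simp add: q_def)
    qed
  qed
qed

text \<open>
At a regular time \<open>|deriv (f t) z * G z t|\<close> is at most \<open>k t\<close> by differentiation of the dominating integral, and \<open>|deriv (f t) z|\<close>
is bounded below on compact sets.
\<close>

lemma G_dominated:
  assumes K: "compact K" "K \<subseteq> unit_disc" and T: "0 < T"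
  shows "\<exists>k. (\<forall>t\<in>{0..T}. 0 \<le> k t) \<and> in_Ld d T k \<and> (\<forall>z\<in>K. AE t in lebesgue_on {0..T}. cmod (G z t) \<le> k t)"
proof -
  obtain k where k: "\<And>\<xi>. \<xi> \<in> {0..T} \<Longrightarrow> 0 \<le> k \<xi>" "in_Ld d T k" "k integrable_on {0..T}"
    "\<And>z s t. z \<in> K \<Longrightarrow> 0 \<le> s \<Longrightarrow> s \<le> t \<Longrightarrow> t \<le> T \<Longrightarrow> norm (f t z - f s z) \<le> integral {s..t} k"
    by (rule dominating_function[OF K T]) blast
  obtain m where m: "0 < m" "\<And>t a b. t \<in> {0..T} \<Longrightarrow> a \<in> K \<Longrightarrow> b \<in> K \<Longrightarrow> m \<le> norm (divided_difference (f t) a b)"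
    by (rule divided_difference_bounded_below[OF joint_continuous _ _ compact_Icc _ K, of 0 T]) (use hol inj in auto)
  obtain N1 where N1: "negligible N1"
    "\<And>x e. x \<in> {0..T} - N1 \<Longrightarrow> 0 < e \<Longrightarrow> \<exists>d>0. \<forall>u v. 0 \<le> u \<and> u \<le> x \<and> x \<le> v \<and> v \<le> T \<and> v - u < d
        \<longrightarrow> \<bar>integral {u..v} k - (v - u) * k x\<bar> \<le> e * (v - u)"
    by (rule indefinite_integral_straddle_derivative_ae[OF k(3)]) (rule that)
  have bound: "norm (G z t) \<le> k t / m" if z: "z \<in> K" and t: "t \<in> {0..T} - (N \<union> N1 \<union> {T})" for z t
  proof -
    have zD: "z \<in> unit_disc" using z K by blast
    have tN: "t \<in> {0..} - N" "0 \<le> t" "t < T" using t by auto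
    have lim: "((\<lambda>s. norm ((f s z - f t z) / complex_of_real (s - t))) \<longlongrightarrow> norm (deriv (f t) z * G z t)) (at_right t)"
      using has_vector_derivative_at_within[OF f_deriv[OF tN(1) zD], of "{t<..}"]
      unfolding has_vector_derivative_complex_quotient_iff by (rule tendsto_norm)
    have "norm (deriv (f t) z * G z t) \<le> k t"
    proof (rule field_le_epsilon)
      fix e :: real assume e: "0 < e"
      obtain d1 where d1: "d1 > 0" "\<forall>u v. 0 \<le> u \<and> u \<le> t \<and> t \<le> v \<and> v \<le> T \<and> v - u < d1
        \<longrightarrow> \<bar>integral {u..v} k - (v - u) * k t\<bar> \<le> e * (v - u)"
        using N1(2)[of t e] t e by auto
      have "\<forall>\<^sub>F s in at_right t. s \<in> {t<..<min T (t + d1)}"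
        using tN d1(1) by (intro eventually_at_rightI[of t "min T (t + d1)"]) auto
      then have "\<forall>\<^sub>F s in at_right t. norm ((f s z - f t z) / complex_of_real (s - t)) \<le> k t + e"
      proof eventually_elim
        case (elim s)
        then have s: "t < s" "s \<le> T" "s - t < d1" by auto
        have "norm (f s z - f t z) \<le> integral {t..s} k" using k(4)[OF z, of t s] s tN by simp
        also have "\<dots> \<le> (s - t) * k t + e * (s - t)" using d1(2)[rule_format, of t s] s tN by (simp add: abs_le_iff)
        finally have "norm (f s z - f t z) \<le> (k t + e) * (s - t)" by (simp add: algebra_simps)
        moreover have "norm (complex_of_real (s - t)) = s - t" using s by (simp del: of_real_diff)
        ultimately show ?case using s by (simp add: norm_divide pos_divide_le_eq del: of_real_diff)
      qed
      then show "norm (deriv (f t) z * G z t) \<le> k t + e"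
        by (rule tendsto_upperbound[OF lim]) simp
    qed
    moreover have "m \<le> norm (deriv (f t) z)" using m(2)[of t z z] t z by simp
    then have "m * norm (G z t) \<le> norm (deriv (f t) z * G z t)" by (simp add: norm_mult mult_right_mono)
    ultimately have "m * norm (G z t) \<le> k t" by linarith
    then show ?thesis using m(1) by (simp add: pos_le_divide_eq mult.commute)
  qed
  show ?thesis
  proof (intro exI[of _ "\<lambda>t. k t / m"] conjI ballI)
    show "0 \<le> k t / m" if "t \<in> {0..T}" for t using k(1)[OF that] m(1) by simp
    show "in_Ld d T (\<lambda>t. k t / m)" by (rule in_Ld_divide[OF k(2) m(1)])
    show "AE t in lebesgue_on {0..T}. cmod (G z t) \<le> k t / m" if "z \<in> K" for z
    proof (subst AE_lebesgue_on_iff_negligible)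
      show "\<exists>N. negligible N \<and> (\<forall>t\<in>{0..T} - N. cmod (G z t) \<le> k t / m)"
        using bound[OF that] N_negligible N1(1) by (intro exI[of _ "N \<union> N1 \<union> {T}"]) simp
    qed simp
  qed
qed

text \<open>
By nestedness \<open>g t \<circ> f (t + h)\<close> is a self-map of the disc, and \<open>(g t (f (t + h) z) - z) / h\<close> tends to \<open>G z t\<close> as \<open>h\<close>
decreases to \<open>0\<close>.
\<close>

lemma G_generator:
  assumes t: "t \<in> {0..} - N"
  shows "infinitesimal_generator (\<lambda>z. G z t)"
proof -
  have t0: "0 \<le> t" using t by simp
  define h where "h n = inverse (real (Suc n))" for n
  have h: "0 < h n" "h \<longlonglongrightarrow> 0" for n unfolding h_def using LIMSEQ_inverse_real_of_nat by auto
  have th: "0 \<le> t + h n" "t \<le> t + h n" for n using h(1)[of n] t0 by auto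
  have mem: "f (t + h n) z \<in> \<Omega> t" if "z \<in> unit_disc" for n z
    using nested[OF t0 th(2)] f_in[OF that] by blast
  show ?thesis
  proof (rule infinitesimal_generator_if_limit_of_self_maps[where h=h and \<phi>="\<lambda>n z. g t (f (t + h n) z)"])
    show "(\<lambda>z. g t (f (t + h n) z)) holomorphic_on unit_disc" for n
      using holomorphic_on_compose_gen[OF hol[OF th(1)[of n]] g_holomorphic[OF t0]] mem by (auto simp: o_def image_subset_iff simp del: mem_ball)
    show "(\<lambda>z. g t (f (t + h n) z)) ` unit_disc \<subseteq> unit_disc" for n
      using g_in mem by (auto simp: image_subset_iff simp del: mem_ball)
    show "(\<lambda>z. G z t) holomorphic_on unit_disc" by (rule G_holomorphic[OF t0])
    fix z :: complex assume z: "z \<in> unit_disc"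
    let ?w = "\<lambda>n. g t (f (t + h n) z)"
    have fd: "((\<lambda>s. f s z) has_vector_derivative deriv (f t) z * G z t) (at t)" by (rule f_deriv[OF t z])
    have q: "(\<lambda>n. (f (t + h n) z - f t z) / complex_of_real (h n)) \<longlonglongrightarrow> deriv (f t) z * G z t"
      unfolding h_def by (rule right_quotients_tendsto[OF t z])
    have "((\<lambda>s. f s z) \<longlongrightarrow> f t z) (at t)" using has_vector_derivative_continuous[OF fd] by (simp add: continuous_within)
    from filterlim_compose[OF this sequence_from_right, folded h_def] have fl: "(\<lambda>n. f (t + h n) z) \<longlonglongrightarrow> f t z" .
    have "isCont (g t) (f t z)"
      using holomorphic_on_imp_continuous_on[OF g_holomorphic[OF t0]] open_Omega[OF t0] f_in[OF z, of t]
      by (simp add: continuous_on_eq_continuous_at)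
    from isCont_tendsto_compose[OF this fl] have wl: "?w \<longlonglongrightarrow> z" using g_f[OF t0 z] by simp
    have dd: "(\<lambda>n. divided_difference (f t) (?w n) z) \<longlonglongrightarrow> deriv (f t) z"
      by (rule divided_difference_tendsto[OF joint_continuous _ _ z tendsto_const wl tendsto_const]) (use t0 hol in auto)
    have "(\<lambda>n. (f (t + h n) z - f t z) / complex_of_real (h n) / divided_difference (f t) (?w n) z) \<longlonglongrightarrow> deriv (f t) z * G z t / deriv (f t) z"
      by (rule tendsto_divide[OF q dd deriv_neq_0[OF t0 z]])
    moreover have "(f (t + h n) z - f t z) / complex_of_real (h n) / divided_difference (f t) (?w n) z = (?w n - z) / complex_of_real (h n)" for n
    proof -
      have nz: "divided_difference (f t) (?w n) z \<noteq> 0"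
        by (rule divided_difference_neq_0[OF hol[OF t0] open_ball inj[OF t0] g_in[OF mem[OF z]] z])
      have "(?w n - z) * divided_difference (f t) (?w n) z = f (t + h n) z - f t z"
        unfolding divided_difference_mult f_g[OF mem[OF z]] ..
      then have "f (t + h n) z - f t z = (?w n - z) * divided_difference (f t) (?w n) z" by (rule sym)
      then show ?thesis using nz by simp
    qed
    ultimately show "(\<lambda>n. (?w n - z) / complex_of_real (h n)) \<longlonglongrightarrow> G z t" using deriv_neq_0[OF t0 z] by simp
  qed (use h in auto)
qed

lemma Herglotz: "Herglotz_vector_field d G"
  unfolding Herglotz_vector_field_def
proof (intro conjI ballI allI impI)
  show "AE t in lebesgue_on {0..}. infinitesimal_generator (\<lambda>z. G z t)"
    using N_negligible G_generator by (subst AE_lebesgue_on_iff_negligible) auto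
qed ((use G_measurable G_holomorphic G_dominated in blast)+)

section \<open>Uniqueness for the partial differential equation\<close>

text \<open>
The definition of a solution allows the exceptional null set to depend on \<open>z\<close>, whereas following a solution along a moving point needs a
common one. Integrating the equation shows that increments in time are dominated by an integral on compact sets, so the
differentiability theorem for families applies; the value of the derivative is known on a countable dense
set, hence everywhere.
\<close>

lemma pde_common_null_set:
  assumes LK: "Loewner_Kufarev_solution G E F" and E0: "0 \<in> E" and t: "t \<in> E" "0 < t"
  shows "integrally_dominated t (\<lambda>s z. F z s)"
    and "\<exists>N'. negligible N' \<and> (\<forall>s\<in>{0<..<t} - N'. \<forall>z\<in>unit_disc.
       ((\<lambda>s. F z s) has_vector_derivative deriv (\<lambda>x. F x s) z * G z s) (at s))"
proof -
  have E: "is_interval E" "E \<subseteq> {0..}" "continuous_on (unit_disc \<times> E) (\<lambda>(z, t). F z t)"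
    "\<And>t. t \<in> E \<Longrightarrow> (\<lambda>z. F z t) holomorphic_on unit_disc"
    "\<And>z. z \<in> unit_disc \<Longrightarrow> locally_abs_continuous_on E (\<lambda>t. F z t)"
    and ae: "\<And>z. z \<in> unit_disc \<Longrightarrow> AE t in lebesgue_on E. ((\<lambda>s. F z s) has_vector_derivative deriv (\<lambda>x. F x t) z * G z t) (at t within E)"
    using LK unfolding Loewner_Kufarev_solution_def by auto
  have sub: "{0..t} \<subseteq> E" by (rule subinterval[OF E(1) E0 t(1)])
  have pde: "\<exists>N'. negligible N' \<and> (\<forall>s\<in>E - N'. ((\<lambda>s. F z s) has_vector_derivative deriv (\<lambda>x. F x s) z * G z s) (at s within E))"
    if "z \<in> unit_disc" for z
    using ae[OF that] unfolding AE_lebesgue_on_iff_negligible[OF interval_sets_lebesgue[OF E(1)]] .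
  have "continuous_on ({0..t} \<times> unit_disc) (\<lambda>p. (\<lambda>(z, t). F z t) (snd p, fst p))"
    by (rule continuous_on_compose2[OF E(3)]) (use sub in \<open>auto intro!: continuous_intros\<close>)
  then have jc: "continuous_on ({0..t} \<times> unit_disc) (\<lambda>(s, z). F z s)" by (simp add: case_prod_unfold)
  have ho: "(\<lambda>z. F z s) holomorphic_on unit_disc" if "s \<in> {0..t}" for s using E(4) sub that by blast
  show dom: "integrally_dominated t (\<lambda>s z. F z s)"
    unfolding integrally_dominated_def
  proof (intro allI impI, elim conjE)
    fix K :: "complex set" assume K: "compact K" "K \<subseteq> unit_disc"
    obtain M where M: "0 < M" "\<And>s a b. s \<in> {0..t} \<Longrightarrow> a \<in> K \<Longrightarrow> b \<in> K \<Longrightarrow> norm (divided_difference (\<lambda>z. F z s) a b) \<le> M"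
      by (rule divided_difference_bounded[OF jc ho compact_Icc order_refl K]) blast+
    obtain k where k: "\<forall>s\<in>{0..t}. 0 \<le> k s" "in_Ld d t k" "\<forall>z\<in>K. AE s in lebesgue_on {0..t}. cmod (G z s) \<le> k s"
      using Herglotz[unfolded Herglotz_vector_field_def, THEN conjunct2, THEN conjunct2, THEN conjunct1, rule_format, of K t] K t(2) by blast
    have "integrable (lebesgue_on {0..t}) k" by (rule in_Ld_imp_integrable[OF d k(2)])
    then have "k absolutely_integrable_on {0..t}"
      unfolding set_integrable_def by (subst (asm) integrable_restrict_space) simp_all
    then have ki: "k integrable_on {0..t}" by (simp add: absolutely_integrable_on_def)
    show "\<exists>k. k integrable_on {0..t} \<and> (\<forall>x\<in>{0..t}. 0 \<le> k x) \<and>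
       (\<forall>z\<in>K. \<forall>u v. 0 \<le> u \<and> u \<le> v \<and> v \<le> t \<longrightarrow> cmod (F z v - F z u) \<le> integral {u..v} k)"
    proof (intro exI[of _ "\<lambda>s. M * k s"] conjI ballI allI impI)
      show "(\<lambda>s. M * k s) integrable_on {0..t}" by (rule integrable_on_mult_right[OF ki])
      show "0 \<le> M * k x" if "x \<in> {0..t}" for x using k(1) M(1) that by simp
    next
      fix z u v assume z: "z \<in> K" and uv: "0 \<le> u \<and> u \<le> v \<and> v \<le> t"
      have zD: "z \<in> unit_disc" using z K by blast
      obtain N1 where N1: "negligible N1" "\<forall>s\<in>E - N1. ((\<lambda>s. F z s) has_vector_derivative deriv (\<lambda>x. F x s) z * G z s) (at s within E)"
        using pde[OF zD] by blast
      have "\<exists>N. negligible N \<and> (\<forall>s\<in>{0..t} - N. cmod (G z s) \<le> k s)"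
        using k(3)[rule_format, OF z] by (subst (asm) AE_lebesgue_on_iff_negligible) simp_all
      then obtain N2 where N2: "negligible N2" "\<forall>s\<in>{0..t} - N2. cmod (G z s) \<le> k s" by blast
      have uvE: "{u..v} \<subseteq> E" "{u..v} \<subseteq> {0..t}" using sub uv by auto
      show "cmod (F z v - F z u) \<le> integral {u..v} (\<lambda>s. M * k s)"
      proof (rule abs_continuous_derivative_bound[where N="N1 \<union> N2"])
        show "abs_continuous_on_interval u v (\<lambda>s. F z s)"
          using E(5)[OF zD] uvE uv unfolding locally_abs_continuous_on_def by blast
        show "negligible (N1 \<union> N2)" using N1 N2 by simp
        show "(\<lambda>s. M * k s) integrable_on {u..v}"
          by (rule integrable_on_subinterval[OF integrable_on_mult_right[OF ki] uvE(2)])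
        show "0 \<le> M * k x" if "x \<in> {u..v}" for x using k(1) M(1) that uvE by (intro mult_nonneg_nonneg) auto
        fix s assume s: "s \<in> {u..v} - (N1 \<union> N2)"
        have sE: "s \<in> E - N1" "s \<in> {0..t} - N2" "s \<in> {0..t}" using s uvE by auto
        have "((\<lambda>s. F z s) has_vector_derivative deriv (\<lambda>x. F x s) z * G z s) (at s within {u..v})"
          using N1(2)[rule_format, OF sE(1)] uvE(1) by (rule has_vector_derivative_within_subset)
        moreover have "norm (deriv (\<lambda>x. F x s) z * G z s) \<le> M * k s"
          unfolding norm_mult using M(2)[OF sE(3) z z] N2(2)[rule_format, OF sE(2)] M(1) by (intro mult_mono) auto
        ultimately show "\<exists>D. ((\<lambda>s. F z s) has_vector_derivative D) (at s within {u..v}) \<and> norm D \<le> M * k s" by blast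
      qed (use uv in simp)
    qed
  qed
  obtain N3 where N3: "negligible N3"
    "\<And>s. s \<in> {0<..<t} - N3 \<Longrightarrow> \<exists>q. q holomorphic_on unit_disc \<and> (\<forall>z\<in>unit_disc. ((\<lambda>s. F z s) has_vector_derivative q z) (at s))"
  proof (rule dominated_holomorphic_family_differentiable_ae[OF t(2) _ dom])
    show "(\<lambda>z. F z s) holomorphic_on unit_disc" if "0 \<le> s" "s \<le> t" for s using ho that by simp
  qed (rule that)
  obtain A where A: "countable A" "A \<subseteq> unit_disc"
      and determining: "\<forall>p q. p holomorphic_on unit_disc \<longrightarrow> q holomorphic_on unit_disc
        \<longrightarrow> (\<forall>a\<in>A. p a = q a) \<longrightarrow> (\<forall>z\<in>unit_disc. p z = q z)"
      using countable_determining_set by blast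
  have "\<forall>a\<in>A. \<exists>N'. negligible N' \<and> (\<forall>s\<in>E - N'. ((\<lambda>s. F a s) has_vector_derivative deriv (\<lambda>x. F x s) a * G a s) (at s within E))"
    using pde A(2) by blast
  from bchoice[OF this] obtain N4 where N4: "\<forall>a\<in>A. negligible (N4 a) \<and> (\<forall>s\<in>E - N4 a. ((\<lambda>s. F a s) has_vector_derivative deriv (\<lambda>x. F x s) a * G a s) (at s within E))" ..
  have "negligible (\<Union>a\<in>A. N4 a)" using N4 A(1) negligible_countable_Union[of "N4 ` A"] by auto
  then have neg: "negligible (N3 \<union> (\<Union>a\<in>A. N4 a))" using N3(1) by simp
  have "((\<lambda>s. F z s) has_vector_derivative deriv (\<lambda>x. F x s) z * G z s) (at s)"
    if s: "s \<in> {0<..<t} - (N3 \<union> (\<Union>a\<in>A. N4 a))" and z: "z \<in> unit_disc" for s z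
  proof -
    obtain q where q: "q holomorphic_on unit_disc" "\<And>z. z \<in> unit_disc \<Longrightarrow> ((\<lambda>s. F z s) has_vector_derivative q z) (at s)"
      using N3(2)[of s] s by blast
    have s01: "s \<in> {0..t}" "0 \<le> s" using s by auto
    have "q z = deriv (\<lambda>x. F x s) z * G z s"
    proof (rule determining[rule_format, OF q(1) _ _ z])
      show "(\<lambda>z. deriv (\<lambda>x. F x s) z * G z s) holomorphic_on unit_disc"
        by (intro holomorphic_on_mult holomorphic_deriv[OF ho[OF s01(1)] open_ball] G_holomorphic[OF s01(2)])
      fix a assume a: "a \<in> A"
      have "s \<in> E - N4 a" using s sub a by auto
      then have "((\<lambda>s. F a s) has_vector_derivative deriv (\<lambda>x. F x s) a * G a s) (at s within E)"
        using N4 a by blast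
      then have "((\<lambda>s. F a s) has_vector_derivative deriv (\<lambda>x. F x s) a * G a s) (at s within {0..t})"
        using sub by (rule has_vector_derivative_within_subset)
      moreover have "at s within {0..t} = at s" using s by (intro at_within_interior) simp
      ultimately have "((\<lambda>s. F a s) has_vector_derivative deriv (\<lambda>x. F x s) a * G a s) (at s)" by simp
      moreover have "a \<in> unit_disc" using a A(2) by blast
      ultimately show "q a = deriv (\<lambda>x. F x s) a * G a s" using q(2) vector_derivative_unique_at by blast
    qed
    then show ?thesis using q(2)[OF z] by simp
  qed
  then show "\<exists>N'. negligible N' \<and> (\<forall>s\<in>{0<..<t} - N'. \<forall>z\<in>unit_disc.
       ((\<lambda>s. F z s) has_vector_derivative deriv (\<lambda>x. F x s) z * G z s) (at s))"
    using neg by blast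
qed

text \<open>
The curves \<open>s \<mapsto> g s \<zeta>\<close> are the characteristics of the equation: a solution is constant along the one that leads from
\<open>\<zeta> = f t z\<close> at time \<open>0\<close> to \<open>z\<close> at time \<open>t\<close>.
\<close>

lemma pde_solution_unique:
  assumes LK: "Loewner_Kufarev_solution G E F" and E0: "0 \<in> E" and F0: "\<And>z. z \<in> unit_disc \<Longrightarrow> F z 0 = F0 z"
    and t: "t \<in> E" and z: "z \<in> unit_disc"
  shows "F z t = F0 (f t z)"
proof -
  have E: "is_interval E" "E \<subseteq> {0..}" "continuous_on (unit_disc \<times> E) (\<lambda>(z, t). F z t)"
    "\<And>t. t \<in> E \<Longrightarrow> (\<lambda>z. F z t) holomorphic_on unit_disc"
    using LK unfolding Loewner_Kufarev_solution_def by auto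
  have "0 \<le> t" using E(2) t by auto
  then consider "t = 0" | "0 < t" by linarith
  then show ?thesis
  proof cases
    case 1
    then show ?thesis using F0[OF z] f_0[OF z] by simp
  next
    case 2
    then have t0: "0 \<le> t" by simp
    let ?\<zeta> = "f t z"
    have sub: "{0..t} \<subseteq> E" by (rule subinterval[OF E(1) E0 t])
    have J: "t \<in> lifetime ?\<zeta>" using f_in[OF z, of t] t0 by (simp add: lifetime_def)
    have subJ: "{0..t} \<subseteq> lifetime ?\<zeta>" using lifetime_downward[OF J] by auto
    let ?w = "\<lambda>s. g s ?\<zeta>"
    have ac: "abs_continuous_on_interval 0 t ?w"
      using g_locally_abs_continuous[of ?\<zeta>] subJ t0 unfolding locally_abs_continuous_on_def by blast
    have inO: "0 \<le> s" "?\<zeta> \<in> \<Omega> s" if "s \<in> {0..t}" for s using subJ that unfolding lifetime_def by auto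
    have im: "?w ` {0..t} \<subseteq> unit_disc" using g_in inO by blast
    have K: "compact (?w ` {0..t})" by (rule compact_continuous_image[OF abs_continuous_imp_continuous_on[OF ac]]) simp
    obtain k where k: "k integrable_on {0..t}" "\<forall>x\<in>{0..t}. 0 \<le> k x"
      "\<forall>z\<in>?w ` {0..t}. \<forall>u v. 0 \<le> u \<and> u \<le> v \<and> v \<le> t \<longrightarrow> norm (F z v - F z u) \<le> integral {u..v} k"
      using pde_common_null_set(1)[OF LK E0 t 2] K im unfolding integrally_dominated_def by meson
    obtain N' where N': "negligible N'" "\<forall>s\<in>{0<..<t} - N'. \<forall>z\<in>unit_disc.
       ((\<lambda>s. F z s) has_vector_derivative deriv (\<lambda>x. F x s) z * G z s) (at s)"
      using pde_common_null_set(2)[OF LK E0 t 2] by blast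
    have "continuous_on ({0..t} \<times> unit_disc) (\<lambda>p. (\<lambda>(z, t). F z t) (snd p, fst p))"
      by (rule continuous_on_compose2[OF E(3)]) (use sub in \<open>auto intro!: continuous_intros\<close>)
    then have jc: "continuous_on ({0..t} \<times> unit_disc) (\<lambda>(s, z). F z s)" by (simp add: case_prod_unfold)
    have ho: "(\<lambda>z. F z s) holomorphic_on unit_disc" if "s \<in> {0..t}" for s using E(4) sub that by blast
    have "abs_continuous_on_interval 0 t (\<lambda>s. F (?w s) s)"
    proof (rule abs_continuous_along_curve[OF jc ho ac im k(1)])
      show "0 \<le> k x" if "x \<in> {0..t}" for x using k(2) that by blast
      show "norm (F w s' - F w s) \<le> integral {s..s'} k" if "w \<in> ?w ` {0..t}" "0 \<le> s" "s \<le> s'" "s' \<le> t" for w s s'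
        using k(3)[rule_format, OF that(1), of s s'] that by simp
    qed
    then have "F (?w t) t = F (?w 0) 0"
    proof (rule abs_continuous_zero_derivative[OF _ t0, of _ "N \<union> N' \<union> {0, t}"])
      show "negligible (N \<union> N' \<union> {0, t})" using N_negligible N'(1) by simp
      fix s assume s: "s \<in> {0..t} - (N \<union> N' \<union> {0, t})"
      have sm: "s \<in> {0..t}" "s \<in> {0..} - N" "s \<in> {0<..<t} - N'" using s by auto
      note w = g_in[OF inO(2)[OF sm(1)]]
      have "((\<lambda>s. F (?w s) s) has_vector_derivative deriv (\<lambda>x. F x s) (?w s) * - G (?w s) s + deriv (\<lambda>x. F x s) (?w s) * G (?w s) s) (at s within {0..t})"
        by (rule has_vector_derivative_along_curve[OF jc ho sm(1) w
             has_vector_derivative_at_within[OF g_deriv[OF sm(2) inO(2)[OF sm(1)]]]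
             has_vector_derivative_at_within[OF N'(2)[rule_format, OF sm(3) w]]])
      then show "((\<lambda>s. F (?w s) s) has_vector_derivative 0) (at s within {0..t})" by simp
    qed
    moreover have "?w t = z" by (rule g_f[OF t0 z])
    moreover have \<zeta>: "?\<zeta> \<in> unit_disc" using self_map[OF t0] z by blast
    ultimately show ?thesis using g_0[OF \<zeta>] F0[OF \<zeta>] by simp
  qed
qed

lemma pde_ivp: "pde_ivp_statement f G"
  unfolding pde_ivp_statement_def
proof (intro allI impI conjI ballI)
  fix F0 assume F0: "F0 holomorphic_on unit_disc"
  show "Loewner_Kufarev_solution G {0..} (\<lambda>z t. F0 (f t z))" by (rule Loewner_Kufarev_compose[OF F0])
  show "F0 (f 0 z) = F0 z" if "z \<in> unit_disc" for z using f_0[OF that] by simp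
  show "F z t = F0 (f t z)" if "0 \<in> E \<and> Loewner_Kufarev_solution G E F \<and> (\<forall>z\<in>unit_disc. F z 0 = F0 z)" "t \<in> E" "z \<in> unit_disc" for E F t z
    by (rule pde_solution_unique[of E]) (use that in blast)+
qed

section \<open>Essential uniqueness of the vector field\<close>

text \<open>
The first statement, read at \<open>f t w\<close>, gives \<open>G' w t\<close> as minus the derivative of the inverse; the second gives
\<open>deriv (f t) z * G' z t\<close>. The third is applied to the identity as initial value: it gives the same
product, but with a null set that depends on \<open>z\<close>, whence the countable dense set.
\<close>

lemma essentially_unique:
  assumes H: "Herglotz_vector_field d G'" and N': "Lebesgue_null N'"
    and st: "inverse_ode_statement f G' N' \<or> chain_pde_statement f G' N' \<or> pde_ivp_statement f G'"
  shows "\<exists>M. negligible M \<and> (\<forall>t\<in>{0..} - M. \<forall>z\<in>unit_disc. G' z t = G z t)"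
proof -
  have negN': "negligible N'" using N' by (simp add: Lebesgue_null_def negligible_iff_null_sets)
  from st consider (ode) "inverse_ode_statement f G' N'" | (pde) "chain_pde_statement f G' N'" | (ivp) "pde_ivp_statement f G'"
    by blast
  then show ?thesis
  proof cases
    case ode
    have "G' w t = G w t" if t: "t \<in> {0..} - (N \<union> N')" and w: "w \<in> unit_disc" for t w
    proof -
      have t0: "0 \<le> t" using t by simp
      let ?z = "f t w"
      have zD: "?z \<in> unit_disc" using self_map[OF t0] w by blast
      have J: "t \<in> lifetime ?z - N'" using f_in[OF w, of t] t by (simp add: lifetime_def)
      have "((\<lambda>s. g s ?z) has_vector_derivative - G' (g t ?z) t) (at t within lifetime ?z)"
        using ode zD J unfolding inverse_ode_statement_def half_line_exit_time by blast
      moreover have "at t within lifetime ?z = at t"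
        using at_within_lifetime[of t ?z] J at_within_pos[OF regular_time_pos[of t]] t by simp
      moreover have "((\<lambda>s. g s ?z) has_vector_derivative - G (g t ?z) t) (at t)"
        by (rule g_deriv) (use t f_in[OF w] in auto)
      ultimately have "- G' (g t ?z) t = - G (g t ?z) t" using vector_derivative_unique_at by metis
      then show ?thesis using g_f[OF t0 w] by simp
    qed
    then show ?thesis using N_negligible negN' by (intro exI[of _ "N \<union> N'"]) simp
  next
    case pde
    have "G' z t = G z t" if t: "t \<in> {0..} - (N \<union> N')" and z: "z \<in> unit_disc" for t z
    proof -
      have tt: "t \<in> {0..} - N'" "t \<in> {0..} - N" "0 \<le> t" using t by auto
      have "((\<lambda>s. f s z) has_vector_derivative deriv (f t) z * G' z t) (at t within {0..})"
        using pde z tt(1) unfolding chain_pde_statement_def by blast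
      then have "deriv (f t) z * G' z t = deriv (f t) z * G z t"
        unfolding at_within_pos[OF regular_time_pos[OF tt(2)]] using f_deriv[OF tt(2) z] vector_derivative_unique_at by blast
      then show ?thesis using deriv_neq_0[OF tt(3) z] by simp
    qed
    then show ?thesis using N_negligible negN' by (intro exI[of _ "N \<union> N'"]) simp
  next
    case ivp
    then have LK: "Loewner_Kufarev_solution G' {0..} (\<lambda>z t. f t z)"
      unfolding pde_ivp_statement_def using holomorphic_on_ident by blast
    obtain A where A: "countable A" "A \<subseteq> unit_disc"
      and determining: "\<forall>p q. p holomorphic_on unit_disc \<longrightarrow> q holomorphic_on unit_disc
        \<longrightarrow> (\<forall>a\<in>A. p a = q a) \<longrightarrow> (\<forall>z\<in>unit_disc. p z = q z)"
      using countable_determining_set by blast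
    have "\<forall>a\<in>A. \<exists>M. negligible M \<and> (\<forall>t\<in>{0..} - M. ((\<lambda>s. f s a) has_vector_derivative deriv (f t) a * G' a t) (at t within {0..}))"
    proof
      fix a assume "a \<in> A"
      then have "a \<in> unit_disc" using A(2) by blast
      then have "AE t in lebesgue_on {0..}. ((\<lambda>s. f s a) has_vector_derivative deriv (f t) a * G' a t) (at t within {0..})"
        using LK unfolding Loewner_Kufarev_solution_def by blast
      then show "\<exists>M. negligible M \<and> (\<forall>t\<in>{0..} - M. ((\<lambda>s. f s a) has_vector_derivative deriv (f t) a * G' a t) (at t within {0..}))"
        by (subst (asm) AE_lebesgue_on_iff_negligible) simp_all
    qed
    from bchoice[OF this] obtain M where M: "\<forall>a\<in>A. negligible (M a) \<and> (\<forall>t\<in>{0..} - M a. ((\<lambda>s. f s a) has_vector_derivative deriv (f t) a * G' a t) (at t within {0..}))" ..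
    have "negligible (\<Union>a\<in>A. M a)" using M A(1) negligible_countable_Union[of "M ` A"] by auto
    moreover have "G' z t = G z t" if t: "t \<in> {0..} - (N \<union> (\<Union>a\<in>A. M a))" and z: "z \<in> unit_disc" for t z
    proof -
      have tt: "t \<in> {0..} - N" "0 \<le> t" using t by auto
      have hol': "(\<lambda>z. G' z t) holomorphic_on unit_disc" using H tt(2) unfolding Herglotz_vector_field_def by blast
      show ?thesis
      proof (rule determining[rule_format, OF hol' G_holomorphic[OF tt(2)] _ z])
        fix a assume a: "a \<in> A"
        then have aD: "a \<in> unit_disc" using A(2) by blast
        have "t \<in> {0..} - M a" using t a by auto
        then have "((\<lambda>s. f s a) has_vector_derivative deriv (f t) a * G' a t) (at t within {0..})" using M a by blast
        then have "deriv (f t) a * G' a t = deriv (f t) a * G a t"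
          unfolding at_within_pos[OF regular_time_pos[OF tt(1)]] using f_deriv[OF tt(1) aD] vector_derivative_unique_at by blast
        then show "G' a t = G a t" using deriv_neq_0[OF tt(2) aD] by simp
      qed
    qed
    ultimately show ?thesis using N_negligible by (intro exI[of _ "N \<union> (\<Union>a\<in>A. M a)"]) simp
  qed
qed

end

theorem theorem3p2:
  fixes d :: ennreal and f :: "real \<Rightarrow> complex \<Rightarrow> complex"
  assumes "1 \<le> d"
    and "decreasing_Loewner_chain d f"
  shows "(\<exists>G N. Herglotz_vector_field d G \<and> Lebesgue_null N \<and>
            inverse_ode_statement f G N \<and> chain_pde_statement f G N \<and> pde_ivp_statement f G) \<and>
         (\<forall>G\<^sub>1 G\<^sub>2.
            Herglotz_vector_field d G\<^sub>1 \<and> Herglotz_vector_field d G\<^sub>2 \<and>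
            (\<exists>N. Lebesgue_null N \<and>
               (inverse_ode_statement f G\<^sub>1 N \<or> chain_pde_statement f G\<^sub>1 N \<or> pde_ivp_statement f G\<^sub>1)) \<and>
            (\<exists>N. Lebesgue_null N \<and>
               (inverse_ode_statement f G\<^sub>2 N \<or> chain_pde_statement f G\<^sub>2 N \<or> pde_ivp_statement f G\<^sub>2))
            \<longrightarrow> (\<exists>M. Lebesgue_null M \<and> (\<forall>t\<in>{0..} - M. \<forall>z\<in>unit_disc. G\<^sub>1 z t = G\<^sub>2 z t)))"
proof -
  interpret Loewner_chain d f by unfold_locales (fact assms)+
  obtain G N where GN: "velocity_field G N" using velocity_field_exists by blast
  interpret Loewner_chain_velocity d f G N by unfold_locales (rule GN)
  have null: "Lebesgue_null N" using N_negligible N_subset by (simp add: Lebesgue_null_def negligible_iff_null_sets)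
  show ?thesis
  proof (intro conjI allI impI)
    show "\<exists>G N. Herglotz_vector_field d G \<and> Lebesgue_null N \<and>
            inverse_ode_statement f G N \<and> chain_pde_statement f G N \<and> pde_ivp_statement f G"
      using Herglotz null inverse_ode chain_pde pde_ivp by blast
    fix G1 G2 :: "complex \<Rightarrow> real \<Rightarrow> complex"
    assume a: "Herglotz_vector_field d G1 \<and> Herglotz_vector_field d G2 \<and>
            (\<exists>N. Lebesgue_null N \<and>
               (inverse_ode_statement f G1 N \<or> chain_pde_statement f G1 N \<or> pde_ivp_statement f G1)) \<and>
            (\<exists>N. Lebesgue_null N \<and>
               (inverse_ode_statement f G2 N \<or> chain_pde_statement f G2 N \<or> pde_ivp_statement f G2))"
    obtain M1 where M1: "negligible M1" "\<forall>t\<in>{0..} - M1. \<forall>z\<in>unit_disc. G1 z t = G z t"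
      using essentially_unique[of G1] a by blast
    obtain M2 where M2: "negligible M2" "\<forall>t\<in>{0..} - M2. \<forall>z\<in>unit_disc. G2 z t = G z t"
      using essentially_unique[of G2] a by blast
    have "negligible ((M1 \<union> M2) \<inter> {0..})" using M1(1) M2(1) by (intro negligible_Int disjI1) simp
    then have "Lebesgue_null ((M1 \<union> M2) \<inter> {0..})" by (simp add: Lebesgue_null_def negligible_iff_null_sets)
    moreover have "G1 z t = G2 z t" if "t \<in> {0..} - (M1 \<union> M2) \<inter> {0..}" "z \<in> unit_disc" for t z
      using M1(2) M2(2) that by auto
    ultimately show "\<exists>M. Lebesgue_null M \<and> (\<forall>t\<in>{0..} - M. \<forall>z\<in>unit_disc. G1 z t = G2 z t)" by blast
  qed
qed

end
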